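(* Let $K$ be an algebraically closed field of characteristic not $2$ or $3$. Let $c,d,e,k\in K$, $p\in K^*$, $q=p^{-1}$, and let $f'=pt+k$ and $g'=ct^2+dt+e$ in $K[t]$. Let $\mathcal{H}_q(f',g')$ be the $K$-algebra generated by $x,y,t$ with defining relations $$tx=xf',\qquad yt=f'y,\qquad yx-qxy=g'.$$ Then $\mathcal{H}_q(f',g')$ is a Calabi--Yau algebra of dimension $3$.
   Context: Algebras are associative unital $K$-algebras; $K^*=K\setminus\{0\}$. Calabi--Yau: let $B^e=B\otimes_K B^{op}$. An algebra $B$ is Calabi--Yau of dimension $n$ if $B$ has, as a $B^e$-module, a projective resolution of finite length with finitely generated terms, and, as $B^e$-modules, $\mathrm{Ext}^i_{B^e}(B,B^e)=0$ for $i\neq n$ and $\mathrm{Ext}^n_{B^e}(B,B^e)\cong B$. *)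

theory Defs
  imports
    "HOL-Computational_Algebra.Polynomial"
    "HOL-Library.Poly_Mapping"
    "HOL-Library.FuncSet"
    "HOL-Algebra.QuotRing"
    "HOL-Algebra.Module"
begin

section \<open>Algebras over a field\<close>

text \<open>
  The base field is the type \<^typ>\<open>'k::field\<close>.  A \<open>K\<close>-algebra is a record of type
  \<^typ>\<open>('k, 'a) module\<close>, i.e. a ring record (not necessarily commutative) together with a
  scalar multiplication.
\<close>

locale k_algebra = ring A for A :: "('k::field, 'a) module" (structure) +
  assumes scalar_closed: "a \<in> carrier A \<Longrightarrow> r \<odot> a \<in> carrier A"
    and scalar_l_distr: "a \<in> carrier A \<Longrightarrow> (r + s) \<odot> a = r \<odot> a \<oplus> s \<odot> a"
    and scalar_r_distr: "a \<in> carrier A \<Longrightarrow> b \<in> carrier A \<Longrightarrow> r \<odot> (a \<oplus> b) = r \<odot> a \<oplus> r \<odot> b"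
    and scalar_assoc: "a \<in> carrier A \<Longrightarrow> (r * s) \<odot> a = r \<odot> (s \<odot> a)"
    and scalar_one: "a \<in> carrier A \<Longrightarrow> 1 \<odot> a = a"
    and scalar_mult_left: "a \<in> carrier A \<Longrightarrow> b \<in> carrier A \<Longrightarrow> (r \<odot> a) \<otimes> b = r \<odot> (a \<otimes> b)"
    and scalar_mult_right: "a \<in> carrier A \<Longrightarrow> b \<in> carrier A \<Longrightarrow> a \<otimes> (r \<odot> b) = r \<odot> (a \<otimes> b)"

definition opp :: "('a, 'm) ring_scheme \<Rightarrow> ('a, 'm) ring_scheme" where
  "opp R = R\<lparr>mult := (\<lambda>a b. b \<otimes>\<^bsub>R\<^esub> a)\<rparr>"

definition alg_quot :: "('k, 'a) module \<Rightarrow> 'a set \<Rightarrow> ('k, 'a set) module" where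
  "alg_quot A I =
    \<lparr>carrier = carrier (A Quot I), mult = mult (A Quot I), one = one (A Quot I),
     zero = zero (A Quot I), add = add (A Quot I),
     smult = (\<lambda>r X. \<Union>a\<in>X. I +>\<^bsub>A\<^esub> (r \<odot>\<^bsub>A\<^esub> a))\<rparr>"

text \<open>
  The monoid algebra \<open>K[M]\<close> of finitely supported functions \<open>M \<rightarrow> K\<close> with the convolution product.
\<close>

definition monoid_algebra :: "('m, 'z) monoid_scheme \<Rightarrow> ('k::field, 'm \<Rightarrow>\<^sub>0 'k) module" where
  "monoid_algebra M =
    \<lparr>carrier = {f. Poly_Mapping.keys f \<subseteq> carrier M},
     mult = (\<lambda>f g. \<Sum>u\<in>Poly_Mapping.keys f. \<Sum>v\<in>Poly_Mapping.keys g.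
        Poly_Mapping.single (u \<otimes>\<^bsub>M\<^esub> v) (Poly_Mapping.lookup f u * Poly_Mapping.lookup g v)),
     one = Poly_Mapping.single \<one>\<^bsub>M\<^esub> 1,
     zero = 0,
     add = (+),
     smult = (\<lambda>r f. Poly_Mapping.map ((*) r) f)\<rparr>"

definition free_monoid :: "'g list monoid" where
  "free_monoid = \<lparr>carrier = UNIV, mult = (@), one = []\<rparr>"

definition free_algebra :: "('k::field, 'g list \<Rightarrow>\<^sub>0 'k) module" where
  "free_algebra = monoid_algebra free_monoid"

definition free_gen :: "'g \<Rightarrow> ('g list \<Rightarrow>\<^sub>0 'k::field)" where
  "free_gen g = Poly_Mapping.single [g] 1"

definition alg_poly :: "('k::field, 'a) module \<Rightarrow> 'k poly \<Rightarrow> 'a \<Rightarrow> 'a" where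
  "alg_poly A f a = (\<Oplus>\<^bsub>A\<^esub>i\<in>{..degree f}. coeff f i \<odot>\<^bsub>A\<^esub> (a [^]\<^bsub>A\<^esub> i))"


section \<open>Tensor products and the enveloping algebra\<close>

text \<open>
  \<open>A \<otimes>\<^sub>K B\<close>, as a ring, is the free vector space on the set \<open>A \<times> B\<close>, with the product induced by
  \<open>(a, b)(a', b') = (aa', bb')\<close>, modulo the bilinearity relations.  (The subspace spanned by
  these relations is already a two-sided ideal.)
\<close>

definition tensor_rels ::
    "('k::field, 'a) module \<Rightarrow> ('k, 'b) module \<Rightarrow> ('a \<times> 'b \<Rightarrow>\<^sub>0 'k) set" where
  "tensor_rels A B =
     {Poly_Mapping.single (a \<oplus>\<^bsub>A\<^esub> a', b) 1 - Poly_Mapping.single (a, b) 1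
        - Poly_Mapping.single (a', b) 1
        | a a' b. a \<in> carrier A \<and> a' \<in> carrier A \<and> b \<in> carrier B} \<union>
     {Poly_Mapping.single (a, b \<oplus>\<^bsub>B\<^esub> b') 1 - Poly_Mapping.single (a, b) 1
        - Poly_Mapping.single (a, b') 1
        | a b b'. a \<in> carrier A \<and> b \<in> carrier B \<and> b' \<in> carrier B} \<union>
     {Poly_Mapping.single (r \<odot>\<^bsub>A\<^esub> a, b) 1 - Poly_Mapping.single (a, b) r
        | r a b. a \<in> carrier A \<and> b \<in> carrier B} \<union>
     {Poly_Mapping.single (a, r \<odot>\<^bsub>B\<^esub> b) 1 - Poly_Mapping.single (a, b) r
        | r a b. a \<in> carrier A \<and> b \<in> carrier B}"

definition tensor_ring ::
    "('k::field, 'a) module \<Rightarrow> ('k, 'b) module \<Rightarrow> ('a \<times> 'b \<Rightarrow>\<^sub>0 'k) set ring" where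
  "tensor_ring A B =
     monoid_algebra (A \<times>\<times> B) Quot genideal (monoid_algebra (A \<times>\<times> B)) (tensor_rels A B)"

definition enveloping :: "('k::field, 'a) module \<Rightarrow> ('a \<times> 'a \<Rightarrow>\<^sub>0 'k) set ring" where
  "enveloping B = tensor_ring B (opp B)"


section \<open>Modules over noncommutative rings\<close>

text \<open>
  As for modules over commutative rings in the library, the ring operations \<open>mult\<close> and \<open>one\<close> of
  the record representing a module are irrelevant.  Right modules over \<open>R\<close> are left modules
  over \<open>opp R\<close>.
\<close>

locale left_module = R?: ring R + M?: abelian_group M
  for R (structure) and M :: "('r, 'm) module" (structure) +
  assumes act_closed: "\<lbrakk>r \<in> carrier R; x \<in> carrier M\<rbrakk> \<Longrightarrow> r \<odot>\<^bsub>M\<^esub> x \<in> carrier M"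
    and act_l_distr: "\<lbrakk>r \<in> carrier R; s \<in> carrier R; x \<in> carrier M\<rbrakk> \<Longrightarrow>
      (r \<oplus>\<^bsub>R\<^esub> s) \<odot>\<^bsub>M\<^esub> x = r \<odot>\<^bsub>M\<^esub> x \<oplus>\<^bsub>M\<^esub> s \<odot>\<^bsub>M\<^esub> x"
    and act_r_distr: "\<lbrakk>r \<in> carrier R; x \<in> carrier M; y \<in> carrier M\<rbrakk> \<Longrightarrow>
      r \<odot>\<^bsub>M\<^esub> (x \<oplus>\<^bsub>M\<^esub> y) = r \<odot>\<^bsub>M\<^esub> x \<oplus>\<^bsub>M\<^esub> r \<odot>\<^bsub>M\<^esub> y"
    and act_assoc: "\<lbrakk>r \<in> carrier R; s \<in> carrier R; x \<in> carrier M\<rbrakk> \<Longrightarrow>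
      (r \<otimes>\<^bsub>R\<^esub> s) \<odot>\<^bsub>M\<^esub> x = r \<odot>\<^bsub>M\<^esub> (s \<odot>\<^bsub>M\<^esub> x)"
    and act_one: "x \<in> carrier M \<Longrightarrow> \<one>\<^bsub>R\<^esub> \<odot>\<^bsub>M\<^esub> x = x"

definition mod_hom :: "'r ring \<Rightarrow> ('r, 'm) module \<Rightarrow> ('r, 'n) module \<Rightarrow> ('m \<Rightarrow> 'n) set" where
  "mod_hom R M N =
     {h \<in> carrier M \<rightarrow> carrier N.
        (\<forall>x\<in>carrier M. \<forall>y\<in>carrier M. h (x \<oplus>\<^bsub>M\<^esub> y) = h x \<oplus>\<^bsub>N\<^esub> h y) \<and>
        (\<forall>r\<in>carrier R. \<forall>x\<in>carrier M. h (r \<odot>\<^bsub>M\<^esub> x) = r \<odot>\<^bsub>N\<^esub> h x)}"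

definition mod_isomorphic :: "'r ring \<Rightarrow> ('r, 'm) module \<Rightarrow> ('r, 'n) module \<Rightarrow> bool" where
  "mod_isomorphic R M N \<longleftrightarrow> (\<exists>h\<in>mod_hom R M N. bij_betw h (carrier M) (carrier N))"

definition mod_quot :: "('r, 'm) module \<Rightarrow> 'm set \<Rightarrow> ('r, 'm set) module" where
  "mod_quot M U =
    \<lparr>carrier = a_rcosets\<^bsub>M\<^esub> U, mult = undefined, one = undefined, zero = U, add = set_add M,
     smult = (\<lambda>r X. \<Union>x\<in>X. U +>\<^bsub>M\<^esub> (r \<odot>\<^bsub>M\<^esub> x))\<rparr>"

definition zero_module :: "('r, unit) module" where
  "zero_module =
    \<lparr>carrier = UNIV, mult = (\<lambda>_ _. ()), one = (), zero = (), add = (\<lambda>_ _. ()),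
     smult = (\<lambda>_ _. ())\<rparr>"

definition regular_module :: "'r ring \<Rightarrow> ('r, 'r) module" where
  "regular_module R =
    \<lparr>carrier = carrier R, mult = mult R, one = one R, zero = zero R, add = add R,
     smult = mult R\<rparr>"

text \<open>The free module \<open>R\<^sup>(\<^sup>I\<^sup>)\<close> of finitely supported families indexed by \<open>I\<close>.\<close>

definition free_module :: "'r ring \<Rightarrow> 'i set \<Rightarrow> ('r, 'i \<Rightarrow> 'r) module" where
  "free_module R I =
    \<lparr>carrier = {f. (\<forall>i. f i \<in> carrier R) \<and> (\<forall>i. i \<notin> I \<longrightarrow> f i = \<zero>\<^bsub>R\<^esub>) \<and>
                   finite {i. f i \<noteq> \<zero>\<^bsub>R\<^esub>}},
     mult = undefined, one = undefined,
     zero = (\<lambda>i. \<zero>\<^bsub>R\<^esub>), add = (\<lambda>f g i. f i \<oplus>\<^bsub>R\<^esub> g i), smult = (\<lambda>r f i. r \<otimes>\<^bsub>R\<^esub> f i)\<rparr>"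

text \<open>
  Projective modules are the direct summands of free modules.  It is no restriction to take the
  index set among the sets of elements of \<open>P\<close>, since \<open>P\<close> is a quotient of the free
  module on its own underlying set.
\<close>

definition projective :: "'r ring \<Rightarrow> ('r, 'p) module \<Rightarrow> bool" where
  "projective R P \<longleftrightarrow> left_module R P \<and>
     (\<exists>(I :: 'p set) s \<pi>. s \<in> mod_hom R P (free_module R I) \<and> \<pi> \<in> mod_hom R (free_module R I) P \<and>
        (\<forall>x\<in>carrier P. \<pi> (s x) = x))"

definition fin_gen :: "'r ring \<Rightarrow> ('r, 'm) module \<Rightarrow> bool" where
  "fin_gen R M \<longleftrightarrow> (\<exists>S. finite S \<and> S \<subseteq> carrier M \<and>
     (\<forall>x\<in>carrier M. \<exists>c. c \<in> S \<rightarrow> carrier R \<and> x = (\<Oplus>\<^bsub>M\<^esub>v\<in>S. c v \<odot>\<^bsub>M\<^esub> v)))"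


section \<open>Projective resolutions and Ext\<close>

text \<open>
  A projective resolution
  \<open>\<dots> \<rightarrow> P 2 \<rightarrow> P 1 \<rightarrow> P 0 \<rightarrow> M \<rightarrow> 0\<close> with differentials \<open>d i : P (i+1) \<rightarrow> P i\<close> and augmentation \<open>\<epsilon>\<close>.
\<close>

definition proj_resolution ::
    "'r ring \<Rightarrow> ('r, 'm) module \<Rightarrow> (nat \<Rightarrow> ('r, 'p) module) \<Rightarrow> (nat \<Rightarrow> 'p \<Rightarrow> 'p) \<Rightarrow> ('p \<Rightarrow> 'm) \<Rightarrow> bool"
  where
  "proj_resolution R M P d \<epsilon> \<longleftrightarrow>
     left_module R M \<and>
     (\<forall>i. projective R (P i)) \<and>
     (\<forall>i. d i \<in> mod_hom R (P (Suc i)) (P i)) \<and>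
     \<epsilon> \<in> mod_hom R (P 0) M \<and>
     \<epsilon> ` carrier (P 0) = carrier M \<and>
     {x \<in> carrier (P 0). \<epsilon> x = \<zero>\<^bsub>M\<^esub>} = d 0 ` carrier (P 1) \<and>
     (\<forall>i. {x \<in> carrier (P (Suc i)). d i x = \<zero>\<^bsub>P i\<^esub>} = d (Suc i) ` carrier (P (Suc (Suc i))))"

text \<open>
  \<open>Hom\<^sub>R(P, R)\<close>, a right \<open>R\<close>-module (record over \<open>opp R\<close>) by \<open>(h r)(x) = h(x) r\<close>.
  Homomorphisms are represented by functions that are \<open>undefined\<close> outside the carrier of \<open>P\<close>.
\<close>

definition dual_module :: "'r ring \<Rightarrow> ('r, 'p) module \<Rightarrow> ('r, 'p \<Rightarrow> 'r) module" where
  "dual_module R P =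
    \<lparr>carrier = mod_hom R P (regular_module R) \<inter> extensional (carrier P),
     mult = undefined, one = undefined,
     zero = (\<lambda>x\<in>carrier P. \<zero>\<^bsub>R\<^esub>),
     add = (\<lambda>h h'. \<lambda>x\<in>carrier P. h x \<oplus>\<^bsub>R\<^esub> h' x),
     smult = (\<lambda>r h. \<lambda>x\<in>carrier P. h x \<otimes>\<^bsub>R\<^esub> r)\<rparr>"

definition dual_cocycles ::
    "'r ring \<Rightarrow> (nat \<Rightarrow> ('r, 'p) module) \<Rightarrow> (nat \<Rightarrow> 'p \<Rightarrow> 'p) \<Rightarrow> nat \<Rightarrow> ('p \<Rightarrow> 'r) set" where
  "dual_cocycles R P d i =
     {h \<in> carrier (dual_module R (P i)). \<forall>x\<in>carrier (P (Suc i)). h (d i x) = \<zero>\<^bsub>R\<^esub>}"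

definition dual_coboundaries ::
    "'r ring \<Rightarrow> (nat \<Rightarrow> ('r, 'p) module) \<Rightarrow> (nat \<Rightarrow> 'p \<Rightarrow> 'p) \<Rightarrow> nat \<Rightarrow> ('p \<Rightarrow> 'r) set" where
  "dual_coboundaries R P d i =
     (case i of
        0 \<Rightarrow> {\<zero>\<^bsub>dual_module R (P 0)\<^esub>}
      | Suc j \<Rightarrow> {\<lambda>x\<in>carrier (P (Suc j)). h (d j x) | h. h \<in> carrier (dual_module R (P j))})"

text \<open>The right \<open>R\<close>-module \<open>H\<^sup>i(Hom\<^sub>R(P\<^sub>\<bullet>, R))\<close>.\<close>

definition dual_cohomology ::
    "'r ring \<Rightarrow> (nat \<Rightarrow> ('r, 'p) module) \<Rightarrow> (nat \<Rightarrow> 'p \<Rightarrow> 'p) \<Rightarrow> nat \<Rightarrow> ('r, ('p \<Rightarrow> 'r) set) module" where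
  "dual_cohomology R P d i =
     mod_quot ((dual_module R (P i))\<lparr>carrier := dual_cocycles R P d i\<rparr>) (dual_coboundaries R P d i)"

text \<open>
  Elements of the terms of resolutions of an \<open>R\<close>-module \<open>M\<close> are taken from the following type.
  It is large enough: the free modules on subsets of \<^typ>\<open>'m \<times> 'r \<times> nat\<close> have their elements
  there, and their submodules have at most as many elements as \<^typ>\<open>'m \<times> 'r \<times> nat\<close>; so every
  \<open>M\<close> has a free resolution with elements in this type, and every resolution by finitely generated
  projectives is isomorphic to one with elements in this type.
\<close>

type_synonym ('r, 'm) res_elem = "'m \<times> 'r \<times> nat \<Rightarrow> 'r"

text \<open>
  \<open>is_Ext R M i E\<close>: the right \<open>R\<close>-module \<open>Ext\<^sup>i\<^sub>R(M, R)\<close>, computed from a projective resolution of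
  \<open>M\<close> (and hence determined up to isomorphism), is isomorphic to \<open>E\<close>.
\<close>

definition is_Ext :: "'r ring \<Rightarrow> ('r, 'm) module \<Rightarrow> nat \<Rightarrow> ('r, 'e) module \<Rightarrow> bool" where
  "is_Ext R M i E \<longleftrightarrow>
     (\<exists>(P :: nat \<Rightarrow> ('r, ('r, 'm) res_elem) module) d \<epsilon>.
        proj_resolution R M P d \<epsilon> \<and> mod_isomorphic (opp R) (dual_cohomology R P d i) E)"


section \<open>Calabi--Yau algebras\<close>

text \<open>
  \<open>B\<close> as a left \<open>B\<^sup>e\<close>-module, \<open>(a \<otimes> b) m = a m b\<close>, and as a right \<open>B\<^sup>e\<close>-module,
  \<open>m (a \<otimes> b) = b m a\<close>.  The two correspond to each other under the flip \<open>a \<otimes> b \<mapsto> b \<otimes> a\<close>, an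
  anti-automorphism of \<open>B\<^sup>e\<close>.  An element of \<open>B\<^sup>e\<close> is a coset; its action
  is computed from any of its representatives.
\<close>

definition bimod_left :: "('k::field, 'a) module \<Rightarrow> (('a \<times> 'a \<Rightarrow>\<^sub>0 'k) set, 'a) module" where
  "bimod_left B =
    \<lparr>carrier = carrier B, mult = mult B, one = one B, zero = zero B, add = add B,
     smult = (\<lambda>X m. the_elem ((\<lambda>f. \<Oplus>\<^bsub>B\<^esub>u\<in>Poly_Mapping.keys f.
        Poly_Mapping.lookup f u \<odot>\<^bsub>B\<^esub> (fst u \<otimes>\<^bsub>B\<^esub> m \<otimes>\<^bsub>B\<^esub> snd u)) ` X))\<rparr>"

definition bimod_right :: "('k::field, 'a) module \<Rightarrow> (('a \<times> 'a \<Rightarrow>\<^sub>0 'k) set, 'a) module" where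
  "bimod_right B =
    \<lparr>carrier = carrier B, mult = mult B, one = one B, zero = zero B, add = add B,
     smult = (\<lambda>X m. the_elem ((\<lambda>f. \<Oplus>\<^bsub>B\<^esub>u\<in>Poly_Mapping.keys f.
        Poly_Mapping.lookup f u \<odot>\<^bsub>B\<^esub> (snd u \<otimes>\<^bsub>B\<^esub> m \<otimes>\<^bsub>B\<^esub> fst u)) ` X))\<rparr>"

definition finite_fg_resolvable :: "'r ring \<Rightarrow> ('r, 'm) module \<Rightarrow> bool" where
  "finite_fg_resolvable R M \<longleftrightarrow>
     (\<exists>(P :: nat \<Rightarrow> ('r, ('r, 'm) res_elem) module) d \<epsilon>.
        proj_resolution R M P d \<epsilon> \<and>
        (\<forall>i. fin_gen R (P i)) \<and>
        (\<exists>l. \<forall>i>l. carrier (P i) = {\<zero>\<^bsub>P i\<^esub>}))"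

definition calabi_yau :: "nat \<Rightarrow> ('k::field, 'a) module \<Rightarrow> bool" where
  "calabi_yau n B \<longleftrightarrow>
     k_algebra B \<and>
     finite_fg_resolvable (enveloping B) (bimod_left B) \<and>
     (\<forall>i. i \<noteq> n \<longrightarrow> is_Ext (enveloping B) (bimod_left B) i zero_module) \<and>
     is_Ext (enveloping B) (bimod_left B) n (bimod_right B)"


section \<open>The algebras \<open>H\<^sub>q(f, g)\<close>\<close>

datatype hgen = X_gen | Y_gen | T_gen

definition H_rels :: "'k::field \<Rightarrow> 'k poly \<Rightarrow> 'k poly \<Rightarrow> (hgen list \<Rightarrow>\<^sub>0 'k) set" where
  "H_rels q f g =
     (let F = free_algebra; x = free_gen X_gen; y = free_gen Y_gen; t = free_gen T_gen in
      {t \<otimes>\<^bsub>F\<^esub> x \<ominus>\<^bsub>F\<^esub> x \<otimes>\<^bsub>F\<^esub> alg_poly F f t,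
       y \<otimes>\<^bsub>F\<^esub> t \<ominus>\<^bsub>F\<^esub> alg_poly F f t \<otimes>\<^bsub>F\<^esub> y,
       y \<otimes>\<^bsub>F\<^esub> x \<ominus>\<^bsub>F\<^esub> q \<odot>\<^bsub>F\<^esub> (x \<otimes>\<^bsub>F\<^esub> y) \<ominus>\<^bsub>F\<^esub> alg_poly F g t})"

definition H_alg :: "'k::field \<Rightarrow> 'k poly \<Rightarrow> 'k poly \<Rightarrow> ('k, (hgen list \<Rightarrow>\<^sub>0 'k) set) module" where
  "H_alg q f g = alg_quot free_algebra (genideal free_algebra (H_rels q f g))"

end

theory Submission
  imports Defs
begin

text \<open>
  Write \<open>A\<close> for \<open>H\<^sub>q(f', g')\<close>. The monomials \<open>x\<^sup>i t\<^sup>j y\<^sup>l\<close> form a basis of \<open>A\<close>, so every element of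
  \<open>A\<^sup>e\<close> is a unique finite sum of terms \<open>x\<^sup>i t\<^sup>j y\<^sup>l \<otimes> a\<close>. The defining relations are the cyclic
  derivatives of a potential. Its noncommutative Hessian gives a complex
  \<open>0 \<rightarrow> A\<^sup>e \<rightarrow> (A\<^sup>e)\<^sup>3 \<rightarrow> (A\<^sup>e)\<^sup>3 \<rightarrow> A\<^sup>e \<rightarrow> A \<rightarrow> 0\<close>.

  Let \<open>B\<^sub>0 \<subseteq> B\<^sub>1\<close> be spanned by the \<open>x\<^sup>i \<otimes> a\<close> and by the \<open>x\<^sup>i t\<^sup>j \<otimes> a\<close>. Right division by linear forms
  gives \<open>A\<^sup>e = B\<^sub>1 \<oplus> A\<^sup>e(y \<otimes> 1 - 1 \<otimes> v)\<close>, \<open>B\<^sub>1 = B\<^sub>0 \<oplus> B\<^sub>1(t \<otimes> 1 - 1 \<otimes> v)\<close> and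
  \<open>B\<^sub>0 = (1 \<otimes> A) \<oplus> B\<^sub>0(x \<otimes> 1 - 1 \<otimes> v)\<close> for every \<open>v \<in> A\<close>, and these factors are cancellable. With
  respect to these decompositions the differentials are triangular, so that the complex is exact by
  elimination.

  The flip \<open>a \<otimes> b \<mapsto> b \<otimes> a\<close> is an anti-automorphism of \<open>A\<^sup>e\<close>. It maps the Hessian to its transpose,
  and therefore identifies the dual complex with the original one up to signs. Hence the only
  cohomology of the dual is \<open>A\<close>, in degree \<open>3\<close>.
\<close>


section \<open>Vector spaces and monoid algebras\<close>

text \<open>The enveloping algebra is a quotient of a free vector space by an ideal and A a quotient
  of a free algebra, so neither comes with a basis. Independence is obtained from outside: the free
  algebra acts on families of polynomials in t, the relations act as zero, and applying an element
  to the family representing 1 reads off its coordinates. Tensoring these functionals with the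
  identity of the second factor gives the coefficients of elements of A^e. With the order x, t, y in
  the monomials, right multiplication by \<open>y \<bowtie> \<one>\<close> shifts every monomial,
  but \<open>t \<bowtie> \<one>\<close> only those without y and \<open>x \<bowtie> \<one>\<close>
  only those without t and y; this dictates the two subspaces. All divisors are monic, except for
  the Hessian entry \<open>Mtx\<close>, whose leading coefficient -p is inverted by q. The same
  equation pq = 1 makes the cyclic derivative xy - p yx + p g'(t) a multiple of the third relation.
  Exactness is phrased as solvability of linear systems over A^e, because the dual of a free module
  is then a space of columns on which the same matrices act from the left.\<close>

locale k_space = abelian_group C for C :: "('k::field, 'c) module" (structure) +
  assumes smult_closed [simp, intro]: "a \<in> carrier C \<Longrightarrow> r \<odot> a \<in> carrier C"
    and smult_l_distr: "a \<in> carrier C \<Longrightarrow> (r + s) \<odot> a = r \<odot> a \<oplus> s \<odot> a"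
    and smult_r_distr: "a \<in> carrier C \<Longrightarrow> b \<in> carrier C \<Longrightarrow> r \<odot> (a \<oplus> b) = r \<odot> a \<oplus> r \<odot> b"
    and smult_assoc: "a \<in> carrier C \<Longrightarrow> (r * s) \<odot> a = r \<odot> (s \<odot> a)"
    and smult_one [simp]: "a \<in> carrier C \<Longrightarrow> 1 \<odot> a = a"
begin

lemma smult_zero_left [simp]: "a \<in> carrier C \<Longrightarrow> 0 \<odot> a = \<zero>"
  using smult_l_distr[of a 0 0] by (simp add: add.l_cancel_one)

lemma smult_zero_right [simp]: "r \<odot> \<zero> = \<zero>"
  using smult_r_distr[of \<zero> \<zero> r] by (simp add: add.l_cancel_one)

lemma sum_zero_eq_neg: "a \<in> carrier C \<Longrightarrow> b \<in> carrier C \<Longrightarrow> a \<oplus> b = \<zero> \<Longrightarrow> a = \<ominus> b"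
  by (rule add.inv_equality[symmetric])

lemma smult_minus_right: "a \<in> carrier C \<Longrightarrow> r \<odot> (\<ominus> a) = \<ominus> (r \<odot> a)"
  using smult_r_distr[of a "\<ominus> a" r] by (intro sum_zero_eq_neg) (auto simp: r_neg l_neg a_comm)

lemma smult_minus_left: "a \<in> carrier C \<Longrightarrow> (- r) \<odot> a = \<ominus> (r \<odot> a)"
  using smult_l_distr[of a r "- r"] by (intro sum_zero_eq_neg) (auto simp: a_comm)

lemma finsum_smult:
  "g \<in> S \<rightarrow> carrier C \<Longrightarrow> r \<odot> (\<Oplus>u\<in>S. g u) = (\<Oplus>u\<in>S. r \<odot> g u)"
  by (induction S rule: infinite_finite_induct) (auto simp: smult_r_distr Pi_iff)

end

sublocale k_algebra \<subseteq> k_space A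
  by unfold_locales
    (auto simp: scalar_closed scalar_l_distr scalar_r_distr scalar_assoc scalar_one)

section \<open>Linear extension of a map given on a basis\<close>

definition lin :: "('k::field, 'c) module \<Rightarrow> ('u \<Rightarrow> 'c) \<Rightarrow> ('u \<Rightarrow>\<^sub>0 'k) \<Rightarrow> 'c" where
  "lin C \<beta> f = (\<Oplus>\<^bsub>C\<^esub>u\<in>Poly_Mapping.keys f. Poly_Mapping.lookup f u \<odot>\<^bsub>C\<^esub> \<beta> u)"

text \<open>Subtracting the value at one point removes that point from the support, so the induction
  runs over a finite set of keys. Keeping all supports inside \<open>S\<close> makes it applicable
  to monoid algebras, whose carrier restricts the support.\<close>

lemma poly_mapping_restrict_induct [consumes 1, case_names zero single add]:
  fixes f :: "'u \<Rightarrow>\<^sub>0 'k::ab_group_add"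
  assumes "Poly_Mapping.keys f \<subseteq> S" and "P 0"
    and single: "\<And>u r. u \<in> S \<Longrightarrow> P (Poly_Mapping.single u r)"
    and add: "\<And>f g. Poly_Mapping.keys f \<subseteq> S \<Longrightarrow> Poly_Mapping.keys g \<subseteq> S \<Longrightarrow> P f \<Longrightarrow> P g \<Longrightarrow> P (f + g)"
  shows "P f"
proof -
  have "\<And>f :: 'u \<Rightarrow>\<^sub>0 'k. Poly_Mapping.keys f = T \<Longrightarrow> T \<subseteq> S \<Longrightarrow> P f" if "finite T" for T
    using that
  proof (induction T rule: finite_induct)
    case empty
    then show ?case using \<open>P 0\<close> by simp
  next
    case (insert u T)
    let ?s = "Poly_Mapping.single u (Poly_Mapping.lookup f u)"
    have k: "Poly_Mapping.keys (f - ?s) = T"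
      using insert.hyps insert.prems(1)
      by (auto simp: in_keys_iff lookup_minus lookup_single when_def set_eq_iff split: if_splits)
    have "P (?s + (f - ?s))"
    proof (rule add)
      show "Poly_Mapping.keys ?s \<subseteq> S" using insert.prems by auto
      show "P ?s" using insert.prems by (auto intro: single)
      show "P (f - ?s)" using insert.IH[OF k] insert.prems by auto
      show "Poly_Mapping.keys (f - ?s) \<subseteq> S" using k insert.prems by auto
    qed
    then show ?case by simp
  qed
  then show ?thesis using assms(1) finite_keys by blast
qed

context k_space
begin

lemma lin_superset:
  assumes "\<beta> \<in> S \<rightarrow> carrier C" "Poly_Mapping.keys f \<subseteq> T" "T \<subseteq> S" "finite T"
  shows "lin C \<beta> f = (\<Oplus>u\<in>T. Poly_Mapping.lookup f u \<odot> \<beta> u)"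
  unfolding lin_def using assms
  by (intro add.finprod_mono_neutral_cong_left) (auto simp: in_keys_iff Pi_iff subset_iff)

lemma lin_closed [simp, intro]:
  assumes "\<beta> \<in> S \<rightarrow> carrier C" "Poly_Mapping.keys f \<subseteq> S"
  shows "lin C \<beta> f \<in> carrier C"
  unfolding lin_def using assms by (auto intro!: finsum_closed)

lemma lin_0 [simp]: "lin C \<beta> 0 = \<zero>"
  by (simp add: lin_def)

lemma lin_single:
  assumes "\<beta> u \<in> carrier C"
  shows "lin C \<beta> (Poly_Mapping.single u r) = r \<odot> \<beta> u"
proof -
  have "lin C \<beta> (Poly_Mapping.single u r) = (\<Oplus>v\<in>{u}. Poly_Mapping.lookup (Poly_Mapping.single u r) v \<odot> \<beta> v)"
    by (rule lin_superset[where S="{u}"]) (use assms in auto)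
  then show ?thesis using assms by simp
qed

lemma lin_add:
  assumes "\<beta> \<in> S \<rightarrow> carrier C" "Poly_Mapping.keys f \<subseteq> S" "Poly_Mapping.keys g \<subseteq> S"
  shows "lin C \<beta> (f + g) = lin C \<beta> f \<oplus> lin C \<beta> g"
proof -
  let ?T = "Poly_Mapping.keys f \<union> Poly_Mapping.keys g"
  have b: "\<beta> u \<in> carrier C" if "u \<in> ?T" for u using assms that by auto
  have "lin C \<beta> (f + g) = (\<Oplus>u\<in>?T. Poly_Mapping.lookup (f + g) u \<odot> \<beta> u)"
    using assms keys_add[of f g] by (intro lin_superset[where S=S]) auto
  also have "\<dots> = (\<Oplus>u\<in>?T. Poly_Mapping.lookup f u \<odot> \<beta> u \<oplus> Poly_Mapping.lookup g u \<odot> \<beta> u)"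
    using b by (intro finsum_cong') (auto simp: lookup_add smult_l_distr)
  also have "\<dots> = (\<Oplus>u\<in>?T. Poly_Mapping.lookup f u \<odot> \<beta> u) \<oplus> (\<Oplus>u\<in>?T. Poly_Mapping.lookup g u \<odot> \<beta> u)"
    using b by (intro finsum_addf) auto
  also have "\<dots> = lin C \<beta> f \<oplus> lin C \<beta> g"
    using assms lin_superset[of \<beta> S f ?T] lin_superset[of \<beta> S g ?T] by auto
  finally show ?thesis .
qed

lemma lin_uminus:
  assumes "\<beta> \<in> S \<rightarrow> carrier C" "Poly_Mapping.keys f \<subseteq> S"
  shows "lin C \<beta> (- f) = \<ominus> lin C \<beta> f"
proof -
  have "lin C \<beta> f \<oplus> lin C \<beta> (- f) = \<zero>"
    using lin_add[of \<beta> S f "- f"] assms by simp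
  then show ?thesis
    using lin_closed[OF assms] lin_closed[of \<beta> S "- f"] assms
    by (intro sum_zero_eq_neg) (simp_all add: a_comm)
qed

lemma lin_diff:
  assumes "\<beta> \<in> S \<rightarrow> carrier C" "Poly_Mapping.keys f \<subseteq> S" "Poly_Mapping.keys g \<subseteq> S"
  shows "lin C \<beta> (f - g) = lin C \<beta> f \<ominus> lin C \<beta> g"
  using lin_add[of \<beta> S f "- g"] lin_uminus[of \<beta> S g] assms by (simp add: a_minus_def)

lemma lin_cong:
  assumes "\<And>u. u \<in> S \<Longrightarrow> \<beta> u = \<gamma> u" "\<gamma> \<in> S \<rightarrow> carrier C" "Poly_Mapping.keys f \<subseteq> S"
  shows "lin C \<beta> f = lin C \<gamma> f"
  unfolding lin_def using assms by (intro finsum_cong') (auto simp: Pi_iff subset_iff)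

lemma lin_fun_add:
  assumes "\<beta> \<in> S \<rightarrow> carrier C" "\<gamma> \<in> S \<rightarrow> carrier C" "Poly_Mapping.keys f \<subseteq> S"
  shows "lin C (\<lambda>u. \<beta> u \<oplus> \<gamma> u) f = lin C \<beta> f \<oplus> lin C \<gamma> f"
proof -
  have "lin C (\<lambda>u. \<beta> u \<oplus> \<gamma> u) f =
      (\<Oplus>u\<in>Poly_Mapping.keys f. Poly_Mapping.lookup f u \<odot> \<beta> u \<oplus> Poly_Mapping.lookup f u \<odot> \<gamma> u)"
    unfolding lin_def using assms
    by (intro finsum_cong') (auto simp: Pi_iff subset_iff smult_r_distr)
  also have "\<dots> = lin C \<beta> f \<oplus> lin C \<gamma> f"
    unfolding lin_def using assms by (intro finsum_addf) auto
  finally show ?thesis .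
qed

lemma lin_fun_smult:
  assumes "\<beta> \<in> S \<rightarrow> carrier C" "Poly_Mapping.keys f \<subseteq> S"
  shows "lin C (\<lambda>u. r \<odot> \<beta> u) f = r \<odot> lin C \<beta> f"
proof -
  have "lin C (\<lambda>u. r \<odot> \<beta> u) f =
      (\<Oplus>u\<in>Poly_Mapping.keys f. r \<odot> (Poly_Mapping.lookup f u \<odot> \<beta> u))"
    unfolding lin_def using assms
    by (intro finsum_cong') (auto simp: Pi_iff subset_iff smult_assoc[symmetric] mult.commute)
  also have "\<dots> = r \<odot> lin C \<beta> f"
    unfolding lin_def using assms by (intro finsum_smult[symmetric]) auto
  finally show ?thesis .
qed

lemma lin_const_zero: "lin C (\<lambda>u. \<zero>) f = \<zero>"
  unfolding lin_def by simp

end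

lemma lin_commute:
  assumes "k_space C" "k_space D"
    and b: "\<beta> \<in> S \<rightarrow> carrier C" and f: "Poly_Mapping.keys f \<subseteq> S"
    and h: "h \<in> carrier C \<rightarrow> carrier D"
    and add: "\<And>a b. a \<in> carrier C \<Longrightarrow> b \<in> carrier C \<Longrightarrow> h (a \<oplus>\<^bsub>C\<^esub> b) = h a \<oplus>\<^bsub>D\<^esub> h b"
    and sm: "\<And>r a. a \<in> carrier C \<Longrightarrow> h (r \<odot>\<^bsub>C\<^esub> a) = r \<odot>\<^bsub>D\<^esub> h a"
  shows "h (lin C \<beta> f) = lin D (\<lambda>u. h (\<beta> u)) f"
proof -
  interpret C: k_space C by fact
  interpret D: k_space D by fact
  have hb: "(\<lambda>u. h (\<beta> u)) \<in> S \<rightarrow> carrier D" using b h by auto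
  have h0: "h \<zero>\<^bsub>C\<^esub> = \<zero>\<^bsub>D\<^esub>"
    using sm[of "\<zero>\<^bsub>C\<^esub>" 0] h by (simp add: Pi_iff)
  show ?thesis using f
  proof (induction rule: poly_mapping_restrict_induct)
    case zero
    then show ?case by (simp add: h0)
  next
    case (single u r)
    then show ?case using b hb by (simp add: C.lin_single D.lin_single sm Pi_iff)
  next
    case (add f g)
    then show ?case using b hb
      by (simp add: C.lin_add[where S=S] D.lin_add[where S=S] assms(6) C.lin_closed[where S=S])
  qed
qed

section \<open>Monoid algebras\<close>

lemma monoid_algebra_simps [simp]:
  "carrier (monoid_algebra M) = {f. Poly_Mapping.keys f \<subseteq> carrier M}"
  "\<one>\<^bsub>monoid_algebra M\<^esub> = Poly_Mapping.single \<one>\<^bsub>M\<^esub> 1"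
  "\<zero>\<^bsub>monoid_algebra M\<^esub> = 0"
  "f \<oplus>\<^bsub>monoid_algebra M\<^esub> g = f + g"
  "r \<odot>\<^bsub>monoid_algebra M\<^esub> f = Poly_Mapping.map ((*) r) f"
  by (simp_all add: monoid_algebra_def)

text \<open>The support of a sum can be smaller than the union of the supports. With arbitrary
  finite index sets containing the supports, distributivity becomes an identity between
  summands.\<close>

lemma monoid_algebra_mult_superset:
  assumes "finite S" "finite T" "Poly_Mapping.keys f \<subseteq> S" "Poly_Mapping.keys g \<subseteq> T"
  shows "f \<otimes>\<^bsub>monoid_algebra M\<^esub> g = (\<Sum>u\<in>S. \<Sum>v\<in>T.
        Poly_Mapping.single (u \<otimes>\<^bsub>M\<^esub> v) (Poly_Mapping.lookup f u * Poly_Mapping.lookup g v))"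
proof -
  have "f \<otimes>\<^bsub>monoid_algebra M\<^esub> g = (\<Sum>u\<in>Poly_Mapping.keys f. \<Sum>v\<in>T.
        Poly_Mapping.single (u \<otimes>\<^bsub>M\<^esub> v) (Poly_Mapping.lookup f u * Poly_Mapping.lookup g v))"
    using assms unfolding monoid_algebra_def monoid.simps
    by (intro sum.cong refl sum.mono_neutral_left) (auto simp: in_keys_iff)
  also have "\<dots> = (\<Sum>u\<in>S. \<Sum>v\<in>T.
        Poly_Mapping.single (u \<otimes>\<^bsub>M\<^esub> v) (Poly_Mapping.lookup f u * Poly_Mapping.lookup g v))"
    using assms by (intro sum.mono_neutral_left) (auto simp: in_keys_iff)
  finally show ?thesis .
qed

lemma monoid_algebra_mult_single [simp]:
  "Poly_Mapping.single u r \<otimes>\<^bsub>monoid_algebra M\<^esub> Poly_Mapping.single v s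
    = Poly_Mapping.single (u \<otimes>\<^bsub>M\<^esub> v) (r * s)"
  by (subst monoid_algebra_mult_superset[of "{u}" "{v}"]) auto

lemma monoid_algebra_mult_add_left:
  "(f + g) \<otimes>\<^bsub>monoid_algebra M\<^esub> h = f \<otimes>\<^bsub>monoid_algebra M\<^esub> h + g \<otimes>\<^bsub>monoid_algebra M\<^esub> h"
  using keys_add[of f g]
  by (simp add: monoid_algebra_mult_superset[of "Poly_Mapping.keys f \<union> Poly_Mapping.keys g" "Poly_Mapping.keys h"]
      lookup_add distrib_right single_add sum.distrib)

lemma monoid_algebra_mult_add_right:
  "f \<otimes>\<^bsub>monoid_algebra M\<^esub> (g + h) = f \<otimes>\<^bsub>monoid_algebra M\<^esub> g + f \<otimes>\<^bsub>monoid_algebra M\<^esub> h"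
  using keys_add[of g h]
  by (simp add: monoid_algebra_mult_superset[of "Poly_Mapping.keys f" "Poly_Mapping.keys g \<union> Poly_Mapping.keys h"]
      lookup_add distrib_left single_add sum.distrib)

lemma monoid_algebra_mult_zero [simp]:
  "0 \<otimes>\<^bsub>monoid_algebra M\<^esub> h = 0" "h \<otimes>\<^bsub>monoid_algebra M\<^esub> 0 = 0"
  by (simp_all add: monoid_algebra_def)

lemma map_mult_single [simp]:
  "Poly_Mapping.map ((*) r) (Poly_Mapping.single u s) = Poly_Mapping.single u (r * s :: 'k::field)"
  by (rule map_single) simp

lemma lookup_map_mult [simp]:
  "Poly_Mapping.lookup (Poly_Mapping.map ((*) r) f) u = r * (Poly_Mapping.lookup f u :: 'k::field)"
  by transfer (simp add: when_def)

lemma map_mult_zero [simp]: "Poly_Mapping.map ((*) r) (0 :: 'u \<Rightarrow>\<^sub>0 'k::field) = 0"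
  by (rule poly_mapping_eqI) simp

lemma map_mult_add [simp]:
  "Poly_Mapping.map ((*) r) (f + g) = Poly_Mapping.map ((*) r) f + (Poly_Mapping.map ((*) r) g :: 'u \<Rightarrow>\<^sub>0 'k::field)"
  by (rule poly_mapping_eqI) (simp add: lookup_add distrib_left)

lemma keys_map_mult: "Poly_Mapping.keys (Poly_Mapping.map ((*) r) f) \<subseteq> Poly_Mapping.keys (f :: 'u \<Rightarrow>\<^sub>0 'k::field)"
  by (auto simp: in_keys_iff)

text \<open>The laws for the product are additive in each argument, so induction over the support
  reduces them to multiples of single monoid elements, where they are laws of the monoid and of the
  field.\<close>

lemma monoid_algebra_k_algebra:
  assumes "Group.monoid M"
  shows "k_algebra (monoid_algebra M :: ('k::field, _) module)"
proof -
  interpret M: Group.monoid M by fact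
  let ?A = "monoid_algebra M :: ('k, _) module"
  have closed: "f \<otimes>\<^bsub>?A\<^esub> g \<in> carrier ?A" if f: "f \<in> carrier ?A" and g: "g \<in> carrier ?A" for f g
  proof -
    from f have "Poly_Mapping.keys f \<subseteq> carrier M" by simp
    then show ?thesis
    proof (induction rule: poly_mapping_restrict_induct)
      case (single u r)
      from g have "Poly_Mapping.keys g \<subseteq> carrier M" by simp
      then show ?case
      proof (induction rule: poly_mapping_restrict_induct)
        case (add f g)
        then show ?case
          using keys_add[of "Poly_Mapping.single u r \<otimes>\<^bsub>?A\<^esub> f" "Poly_Mapping.single u r \<otimes>\<^bsub>?A\<^esub> g"]
          by (auto simp: monoid_algebra_mult_add_right)
      qed (use single in auto)
    next
      case (add f h)
      then show ?case using keys_add[of "f \<otimes>\<^bsub>?A\<^esub> g" "h \<otimes>\<^bsub>?A\<^esub> g"]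
        by (auto simp: monoid_algebra_mult_add_left)
    qed auto
  qed
  have assoc: "f \<otimes>\<^bsub>?A\<^esub> g \<otimes>\<^bsub>?A\<^esub> h = f \<otimes>\<^bsub>?A\<^esub> (g \<otimes>\<^bsub>?A\<^esub> h)"
    if f: "f \<in> carrier ?A" and g: "g \<in> carrier ?A" and h: "h \<in> carrier ?A" for f g h
  proof -
    from f have "Poly_Mapping.keys f \<subseteq> carrier M" by simp
    then show ?thesis
    proof (induction rule: poly_mapping_restrict_induct)
      case u: (single u r)
      from g have "Poly_Mapping.keys g \<subseteq> carrier M" by simp
      then show ?case
      proof (induction rule: poly_mapping_restrict_induct)
        case v: (single v s)
        from h have "Poly_Mapping.keys h \<subseteq> carrier M" by simp
        then show ?case
          by (induction rule: poly_mapping_restrict_induct)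
            (use u v in \<open>auto simp: monoid_algebra_mult_add_right M.m_assoc mult.assoc\<close>)
      qed (auto simp: monoid_algebra_mult_add_right monoid_algebra_mult_add_left)
    qed (auto simp: monoid_algebra_mult_add_left)
  qed
  have one: "\<one>\<^bsub>?A\<^esub> \<otimes>\<^bsub>?A\<^esub> f = f" "f \<otimes>\<^bsub>?A\<^esub> \<one>\<^bsub>?A\<^esub> = f" if f: "f \<in> carrier ?A" for f
  proof -
    from f have "Poly_Mapping.keys f \<subseteq> carrier M" by simp
    then have "\<one>\<^bsub>?A\<^esub> \<otimes>\<^bsub>?A\<^esub> f = f \<and> f \<otimes>\<^bsub>?A\<^esub> \<one>\<^bsub>?A\<^esub> = f"
      by (induction rule: poly_mapping_restrict_induct)
        (auto simp: monoid_algebra_mult_add_left monoid_algebra_mult_add_right)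
    then show "\<one>\<^bsub>?A\<^esub> \<otimes>\<^bsub>?A\<^esub> f = f" "f \<otimes>\<^bsub>?A\<^esub> \<one>\<^bsub>?A\<^esub> = f" by auto
  qed
  have sl: "(r \<odot>\<^bsub>?A\<^esub> f) \<otimes>\<^bsub>?A\<^esub> g = r \<odot>\<^bsub>?A\<^esub> (f \<otimes>\<^bsub>?A\<^esub> g)"
    and sr: "f \<otimes>\<^bsub>?A\<^esub> (r \<odot>\<^bsub>?A\<^esub> g) = r \<odot>\<^bsub>?A\<^esub> (f \<otimes>\<^bsub>?A\<^esub> g)"
    if f: "f \<in> carrier ?A" and g: "g \<in> carrier ?A" for r f g
  proof -
    from f have "Poly_Mapping.keys f \<subseteq> carrier M" by simp
    then have "(r \<odot>\<^bsub>?A\<^esub> f) \<otimes>\<^bsub>?A\<^esub> g = r \<odot>\<^bsub>?A\<^esub> (f \<otimes>\<^bsub>?A\<^esub> g) \<and> f \<otimes>\<^bsub>?A\<^esub> (r \<odot>\<^bsub>?A\<^esub> g) = r \<odot>\<^bsub>?A\<^esub> (f \<otimes>\<^bsub>?A\<^esub> g)"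
    proof (induction rule: poly_mapping_restrict_induct)
      case u: (single u s)
      from g have "Poly_Mapping.keys g \<subseteq> carrier M" by simp
      then show ?case
        by (induction rule: poly_mapping_restrict_induct)
          (auto simp: monoid_algebra_mult_add_right algebra_simps)
    qed (auto simp: monoid_algebra_mult_add_left)
    then show "(r \<odot>\<^bsub>?A\<^esub> f) \<otimes>\<^bsub>?A\<^esub> g = r \<odot>\<^bsub>?A\<^esub> (f \<otimes>\<^bsub>?A\<^esub> g)"
      "f \<otimes>\<^bsub>?A\<^esub> (r \<odot>\<^bsub>?A\<^esub> g) = r \<odot>\<^bsub>?A\<^esub> (f \<otimes>\<^bsub>?A\<^esub> g)" by auto
  qed
  have "ring ?A"
  proof (rule ringI)
    show "abelian_group ?A"
    proof (rule abelian_groupI)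
      fix f g assume "f \<in> carrier ?A" "g \<in> carrier ?A"
      then show "f \<oplus>\<^bsub>?A\<^esub> g \<in> carrier ?A" using keys_add[of f g] by auto
    next
      fix f assume "f \<in> carrier ?A"
      then show "\<exists>g\<in>carrier ?A. g \<oplus>\<^bsub>?A\<^esub> f = \<zero>\<^bsub>?A\<^esub>"
        by (intro bexI[of _ "- f"]) auto
    qed (simp_all add: add.assoc add.commute)
    show "Group.monoid ?A"
      by (rule monoidI) (use closed assoc one in auto)
  qed (auto simp: monoid_algebra_mult_add_left monoid_algebra_mult_add_right)
  then show ?thesis
  proof (intro k_algebra.intro k_algebra_axioms.intro)
    fix r f assume "f \<in> carrier ?A"
    then show "r \<odot>\<^bsub>?A\<^esub> f \<in> carrier ?A" using keys_map_mult[of r f] by auto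
  next
    fix r s f
    show "(r + s) \<odot>\<^bsub>?A\<^esub> f = r \<odot>\<^bsub>?A\<^esub> f \<oplus>\<^bsub>?A\<^esub> s \<odot>\<^bsub>?A\<^esub> f"
      by (rule poly_mapping_eqI) (simp add: lookup_add distrib_right)
    show "(r * s) \<odot>\<^bsub>?A\<^esub> f = r \<odot>\<^bsub>?A\<^esub> (s \<odot>\<^bsub>?A\<^esub> f)"
      by (rule poly_mapping_eqI) simp
    show "1 \<odot>\<^bsub>?A\<^esub> f = f"
      by (rule poly_mapping_eqI) simp
  qed (simp_all add: sl[simplified] sr[simplified])
qed

text \<open>This double sum serves twice: it shows that the elements killed by all bilinear maps
  form an ideal, and that the action of words on families of polynomials is multiplicative.\<close>

lemma (in k_space) lin_mult:
  fixes f g :: "'m \<Rightarrow>\<^sub>0 'k"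
  assumes "Group.monoid M" and b: "\<beta> \<in> carrier M \<rightarrow> carrier C"
    and f: "Poly_Mapping.keys f \<subseteq> carrier M" and g: "Poly_Mapping.keys g \<subseteq> carrier M"
  shows "lin C \<beta> (f \<otimes>\<^bsub>monoid_algebra M\<^esub> g) = lin C (\<lambda>u. lin C (\<lambda>v. \<beta> (u \<otimes>\<^bsub>M\<^esub> v)) g) f"
proof -
  interpret M: Group.monoid M by fact
  interpret A: k_algebra "monoid_algebra M :: ('k, _) module" by (rule monoid_algebra_k_algebra) fact
  have b': "(\<lambda>v. \<beta> (u \<otimes>\<^bsub>M\<^esub> v)) \<in> carrier M \<rightarrow> carrier C" if "u \<in> carrier M" for u using b that by auto
  have l: "(\<lambda>u. lin C (\<lambda>v. \<beta> (u \<otimes>\<^bsub>M\<^esub> v)) g) \<in> carrier M \<rightarrow> carrier C"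
    using lin_closed[OF b' g] by auto
  have k: "Poly_Mapping.keys (f \<otimes>\<^bsub>monoid_algebra M\<^esub> g) \<subseteq> carrier M"
    if "Poly_Mapping.keys f \<subseteq> carrier M" "Poly_Mapping.keys g \<subseteq> carrier M" for f g :: "_ \<Rightarrow>\<^sub>0 'k"
    using A.m_closed that by auto
  show ?thesis using f
  proof (induction rule: poly_mapping_restrict_induct)
    case (single u r)
    have "lin C \<beta> (Poly_Mapping.single u r \<otimes>\<^bsub>monoid_algebra M\<^esub> g) = r \<odot> lin C (\<lambda>v. \<beta> (u \<otimes>\<^bsub>M\<^esub> v)) g"
      using g
    proof (induction rule: poly_mapping_restrict_induct)
      case v: (single v s)
      then show ?case using b single by (simp add: lin_single Pi_iff smult_assoc)
    next
      case (add g h)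
      then show ?case using single b b'[of u]
        by (simp add: monoid_algebra_mult_add_right lin_add[where S="carrier M"] k smult_r_distr lin_closed[where S="carrier M"])
    qed simp
    then show ?case using l single by (simp add: lin_single Pi_iff)
  next
    case (add f h)
    then show ?case using b l g
      by (simp add: monoid_algebra_mult_add_left lin_add[where S="carrier M"] k)
  qed simp
qed

lemma monoid_algebra_minus:
  assumes "Group.monoid M" "Poly_Mapping.keys f \<subseteq> carrier M"
  shows "\<ominus>\<^bsub>monoid_algebra M :: ('k::field, _) module\<^esub> f = - f"
proof -
  interpret k_algebra "monoid_algebra M :: ('k, _) module" by (rule monoid_algebra_k_algebra) fact
  show ?thesis using assms by (intro minus_equality) auto
qed

lemma monoid_algebra_diff:
  assumes "Group.monoid M" "Poly_Mapping.keys g \<subseteq> carrier M"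
  shows "f \<ominus>\<^bsub>monoid_algebra M :: ('k::field, _) module\<^esub> g = f - g"
  using assms by (simp add: a_minus_def monoid_algebra_minus)

lemma monoid_algebra_idealI:
  fixes J :: "('m \<Rightarrow>\<^sub>0 'k::field) set"
  assumes "Group.monoid M" and sub: "\<And>f. f \<in> J \<Longrightarrow> Poly_Mapping.keys f \<subseteq> carrier M"
    and "0 \<in> J" and "\<And>f g. f \<in> J \<Longrightarrow> g \<in> J \<Longrightarrow> f + g \<in> J" and "\<And>f. f \<in> J \<Longrightarrow> - f \<in> J"
    and "\<And>f g. f \<in> J \<Longrightarrow> Poly_Mapping.keys g \<subseteq> carrier M \<Longrightarrow> g \<otimes>\<^bsub>monoid_algebra M\<^esub> f \<in> J"
    and "\<And>f g. f \<in> J \<Longrightarrow> Poly_Mapping.keys g \<subseteq> carrier M \<Longrightarrow> f \<otimes>\<^bsub>monoid_algebra M\<^esub> g \<in> J"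
  shows "ideal J (monoid_algebra M)"
proof -
  interpret k_algebra "monoid_algebra M :: ('k, _) module" by (rule monoid_algebra_k_algebra) fact
  show ?thesis
  proof (rule idealI)
    show "subgroup J (add_monoid (monoid_algebra M))"
      by (rule add.subgroupI)
        (use assms sub[THEN monoid_algebra_minus[OF assms(1)]] in \<open>auto simp: a_inv_def[symmetric]\<close>)
  qed (use assms in \<open>auto intro: local.ring_axioms\<close>)
qed

section \<open>Quotient algebras\<close>

lemma abelian_group_cong:
  assumes "abelian_group M" "carrier N = carrier M" "add N = add M" "zero N = zero M"
  shows "abelian_group N"
proof -
  interpret M: abelian_group M by fact
  show ?thesis
  proof (rule abelian_groupI)
    fix x assume "x \<in> carrier N"
    then show "\<exists>y\<in>carrier N. y \<oplus>\<^bsub>N\<^esub> x = \<zero>\<^bsub>N\<^esub>"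
      using M.l_neg[of x] by (intro bexI[of _ "\<ominus>\<^bsub>M\<^esub> x"]) (simp_all add: assms)
  qed (simp_all add: assms M.a_ac)
qed

text \<open>Records with the same operations but different extra fields have different types, so the
  axioms are transported field by field. This carries the ring structure from
  \<open>env_algebra A\<close> to the bare ring record \<open>enveloping A\<close>.\<close>

lemma ring_cong:
  assumes "ring R" "carrier S = carrier R" "add S = add R" "zero S = zero R"
    "mult S = mult R" "one S = one R"
  shows "ring S"
proof -
  interpret ring R by fact
  show ?thesis
  proof (rule ringI)
    show "abelian_group S" by (rule abelian_group_cong[OF abelian_group_axioms assms(2-4)])
    show "Group.monoid S" by (rule monoidI) (auto simp: assms m_assoc)
  qed (auto simp: assms l_distr r_distr)
qed

context
  fixes A :: "('k::field, 'a) module" (structure) and I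
  assumes A: "k_algebra A" and I: "ideal I A"
begin

interpretation k_algebra A by (rule A)
interpretation ideal I A by (rule I)

lemma alg_quot_simps:
  "carrier (alg_quot A I) = a_rcosets\<^bsub>A\<^esub> I"
  "\<one>\<^bsub>alg_quot A I\<^esub> = I +> \<one>"
  "\<zero>\<^bsub>alg_quot A I\<^esub> = I"
  by (simp_all add: alg_quot_def FactRing_def)

lemma alg_quot_carrierI: "a \<in> carrier A \<Longrightarrow> I +> a \<in> carrier (alg_quot A I)"
  by (simp add: alg_quot_simps a_rcosetsI a_subset)

lemma alg_quot_carrierE:
  assumes "X \<in> carrier (alg_quot A I)"
  obtains a where "a \<in> carrier A" "X = I +> a"
  using assms by (auto simp: alg_quot_simps A_RCOSETS_def RCOSETS_def a_r_coset_def)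

lemma alg_quot_add:
  "a \<in> carrier A \<Longrightarrow> b \<in> carrier A \<Longrightarrow> (I +> a) \<oplus>\<^bsub>alg_quot A I\<^esub> (I +> b) = I +> (a \<oplus> b)"
  by (simp add: alg_quot_def FactRing_def a_rcos_sum)

lemma alg_quot_mult:
  "a \<in> carrier A \<Longrightarrow> b \<in> carrier A \<Longrightarrow> (I +> a) \<otimes>\<^bsub>alg_quot A I\<^esub> (I +> b) = I +> (a \<otimes> b)"
  by (simp add: alg_quot_def FactRing_def rcoset_mult_add)

text \<open>A ring ideal absorbs scalars because ra is the product of r1 and a.\<close>

lemma ideal_smult_closed: "a \<in> I \<Longrightarrow> r \<odot> a \<in> I"
  using I_l_closed[of a "r \<odot> \<one>"] by (simp add: scalar_mult_left)

lemma coset_eq_iff: "a \<in> carrier A \<Longrightarrow> b \<in> carrier A \<Longrightarrow> I +> a = I +> b \<longleftrightarrow> a \<ominus> b \<in> I"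
  by (metis a_rcos_module_minus a_rcos_self a_repr_independence' local.ring_axioms)

lemma alg_quot_smult:
  assumes "a \<in> carrier A"
  shows "r \<odot>\<^bsub>alg_quot A I\<^esub> (I +> a) = I +> (r \<odot> a)"
proof -
  have "I +> (r \<odot> b) = I +> (r \<odot> a)" if "b \<in> I +> a" for b
  proof -
    have b: "b \<in> carrier A" using a_elemrcos_carrier assms that by blast
    have "b \<ominus> a \<in> I" using that assms b a_rcos_module_minus local.ring_axioms by blast
    then have "r \<odot> (b \<ominus> a) \<in> I" by (rule ideal_smult_closed)
    then have "r \<odot> b \<ominus> r \<odot> a \<in> I"
      using assms b by (simp add: a_minus_def smult_r_distr smult_minus_right)
    then show ?thesis using assms b by (simp add: coset_eq_iff)
  qed
  moreover have "I +> a \<noteq> {}" using a_rcos_self assms by blast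
  ultimately show ?thesis by (auto simp: alg_quot_def)
qed

lemma truncate_alg_quot: "ring.truncate (alg_quot A I) = A Quot I"
  by (simp add: alg_quot_def ring.truncate_def)

lemma alg_quot_k_algebra: "k_algebra (alg_quot A I)"
proof (intro k_algebra.intro k_algebra_axioms.intro ringI)
  show "abelian_group (alg_quot A I)"
  proof (rule abelian_groupI)
    show "\<zero>\<^bsub>alg_quot A I\<^esub> \<in> carrier (alg_quot A I)"
      using alg_quot_carrierI[of "\<zero>"] by (simp add: alg_quot_simps a_subset)
    fix X assume "X \<in> carrier (alg_quot A I)"
    then obtain a where a: "a \<in> carrier A" "X = I +> a" by (rule alg_quot_carrierE)
    then show "\<exists>Y\<in>carrier (alg_quot A I). Y \<oplus>\<^bsub>alg_quot A I\<^esub> X = \<zero>\<^bsub>alg_quot A I\<^esub>"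
      by (intro bexI[of _ "I +> (\<ominus> a)"])
        (auto simp: alg_quot_add alg_quot_carrierI l_neg alg_quot_simps(3) a_subset)
    show "\<zero>\<^bsub>alg_quot A I\<^esub> \<oplus>\<^bsub>alg_quot A I\<^esub> X = X"
      using alg_quot_add[of "\<zero>" a] a by (simp add: alg_quot_simps a_subset)
  qed (auto elim!: alg_quot_carrierE simp: alg_quot_add alg_quot_carrierI a_ac)
  show "Group.monoid (alg_quot A I)"
    by (rule monoidI)
      (auto elim!: alg_quot_carrierE simp: alg_quot_simps(2) alg_quot_mult alg_quot_carrierI m_assoc)
qed (auto elim!: alg_quot_carrierE simp: alg_quot_smult alg_quot_add alg_quot_mult alg_quot_carrierI
    smult_l_distr smult_r_distr smult_assoc scalar_mult_left scalar_mult_right l_distr r_distr)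

end


section \<open>The enveloping algebra\<close>

lemma opp_simps [simp]:
  "carrier (opp A) = carrier A" "a \<otimes>\<^bsub>opp A\<^esub> b = b \<otimes>\<^bsub>A\<^esub> a" "\<one>\<^bsub>opp A\<^esub> = \<one>\<^bsub>A\<^esub>"
  "\<zero>\<^bsub>opp A\<^esub> = \<zero>\<^bsub>A\<^esub>" "add (opp A) = add A"
  by (simp_all add: opp_def)

lemma smult_opp [simp]: "smult (opp A) = smult A"
  by (simp add: opp_def)

definition env_monoid :: "('k::field, 'a) module \<Rightarrow> ('a \<times> 'a) monoid" where
  "env_monoid A = A \<times>\<times> opp A"

definition env_ideal :: "('k::field, 'a) module \<Rightarrow> ('a \<times> 'a \<Rightarrow>\<^sub>0 'k) set" where
  "env_ideal A = genideal (monoid_algebra (env_monoid A)) (tensor_rels A (opp A))"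

text \<open>The same quotient as \<open>enveloping A\<close>, with the scalar multiplication that
  the ring record drops. Computations take place here, and \<open>enveloping_eq\<close> identifies
  the two after truncation.\<close>

definition env_algebra :: "('k::field, 'a) module \<Rightarrow> ('k, ('a \<times> 'a \<Rightarrow>\<^sub>0 'k) set) module" where
  "env_algebra A = alg_quot (monoid_algebra (env_monoid A)) (env_ideal A)"

definition tens :: "('k::field, 'a) module \<Rightarrow> 'a \<Rightarrow> 'a \<Rightarrow> ('a \<times> 'a \<Rightarrow>\<^sub>0 'k) set" where
  "tens A a b = env_ideal A +>\<^bsub>monoid_algebra (env_monoid A)\<^esub> Poly_Mapping.single (a, b) 1"

definition bilinear_map ::
    "('k::field, 'a) module \<Rightarrow> ('k, 'c) module \<Rightarrow> ('a \<times> 'a \<Rightarrow> 'c) \<Rightarrow> bool" where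
  "bilinear_map A C \<beta> \<longleftrightarrow>
     (\<forall>a\<in>carrier A. \<forall>b\<in>carrier A. \<beta> (a, b) \<in> carrier C) \<and>
     (\<forall>a\<in>carrier A. \<forall>a'\<in>carrier A. \<forall>b\<in>carrier A.
        \<beta> (a \<oplus>\<^bsub>A\<^esub> a', b) = \<beta> (a, b) \<oplus>\<^bsub>C\<^esub> \<beta> (a', b) \<and>
        \<beta> (b, a \<oplus>\<^bsub>A\<^esub> a') = \<beta> (b, a) \<oplus>\<^bsub>C\<^esub> \<beta> (b, a')) \<and>
     (\<forall>r. \<forall>a\<in>carrier A. \<forall>b\<in>carrier A.
        \<beta> (r \<odot>\<^bsub>A\<^esub> a, b) = r \<odot>\<^bsub>C\<^esub> \<beta> (a, b) \<and> \<beta> (a, r \<odot>\<^bsub>A\<^esub> b) = r \<odot>\<^bsub>C\<^esub> \<beta> (a, b))"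

text \<open>Well defined once the linear extension kills the ideal, since it is then constant on
  cosets. Taking the only element of the image of a coset reproduces the form of the actions in
  \<open>bimod_left\<close> and \<open>bimod_right\<close>, so both are instances.\<close>

definition env_lift ::
    "('k::field, 'c) module \<Rightarrow> ('a \<times> 'a \<Rightarrow> 'c) \<Rightarrow> ('a \<times> 'a \<Rightarrow>\<^sub>0 'k) set \<Rightarrow> 'c" where
  "env_lift C \<beta> X = the_elem (lin C \<beta> ` X)"

lemma env_monoid_simps [simp]:
  "carrier (env_monoid A) = carrier A \<times> carrier A"
  "(a, b) \<otimes>\<^bsub>env_monoid A\<^esub> (a', b') = (a \<otimes>\<^bsub>A\<^esub> a', b' \<otimes>\<^bsub>A\<^esub> b)"
  "\<one>\<^bsub>env_monoid A\<^esub> = (\<one>\<^bsub>A\<^esub>, \<one>\<^bsub>A\<^esub>)"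
  by (simp_all add: env_monoid_def DirProd_def)

locale env = k_algebra A for A :: "('k::field, 'a) module" (structure)
begin

abbreviation E where "E \<equiv> env_algebra A"
abbreviation MA where "MA \<equiv> monoid_algebra (env_monoid A) :: ('k, 'a \<times> 'a \<Rightarrow>\<^sub>0 'k) module"
abbreviation tensor (infixl "\<bowtie>" 75) where "a \<bowtie> b \<equiv> tens A a b"
abbreviation E_mult (infixl "\<cdot>" 70) where "E_mult \<equiv> mult E"
abbreviation E_add (infixl "\<boxplus>" 65) where "E_add \<equiv> add E"
abbreviation E_diff (infixl "\<boxminus>" 65) where "a \<boxminus> b \<equiv> a \<ominus>\<^bsub>E\<^esub> b"
abbreviation E_zero ("\<zero>\<^sub>E") where "E_zero \<equiv> zero E"

lemma env_monoid: "Group.monoid (env_monoid A)"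
  by (rule monoidI) (auto simp: m_assoc)

lemma MA: "k_algebra MA"
  by (rule monoid_algebra_k_algebra[OF env_monoid])

sublocale MA: k_algebra MA
  by (rule MA)

lemma tensor_rels_carrier: "tensor_rels A (opp A) \<subseteq> carrier MA"
proof
  fix f assume "f \<in> tensor_rels A (opp A)"
  then show "f \<in> carrier MA"
    unfolding tensor_rels_def
    by (auto dest!: subsetD[OF keys_diff] split: if_splits)
qed

lemma env_ideal: "ideal (env_ideal A) MA"
  unfolding env_ideal_def by (rule MA.genideal_ideal[OF tensor_rels_carrier])

lemma E_k_algebra: "k_algebra E"
  unfolding env_algebra_def by (rule alg_quot_k_algebra[OF MA env_ideal])

sublocale E: k_algebra E
  by (rule E_k_algebra)

lemma enveloping_eq: "enveloping A = ring.truncate E"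
  unfolding enveloping_def tensor_ring_def env_algebra_def truncate_alg_quot[OF MA env_ideal]
  by (simp add: env_ideal_def env_monoid_def)

lemma bilinear_map_lin:
  assumes C: "k_space C" and b: "\<And>v. v \<in> S \<Longrightarrow> bilinear_map A C (\<lambda>u. \<beta> u v)"
    and g: "Poly_Mapping.keys g \<subseteq> S"
  shows "bilinear_map A C (\<lambda>u. lin C (\<beta> u) g)"
proof -
  interpret C: k_space C by fact
  have cl: "\<beta> (a, b) \<in> S \<rightarrow> carrier C" if "a \<in> carrier A" "b \<in> carrier A" for a b
    using b that by (auto simp: bilinear_map_def)
  have "lin C (\<beta> (a \<oplus> a', b)) g = lin C (\<beta> (a, b)) g \<oplus>\<^bsub>C\<^esub> lin C (\<beta> (a', b)) g"
    "lin C (\<beta> (b, a \<oplus> a')) g = lin C (\<beta> (b, a)) g \<oplus>\<^bsub>C\<^esub> lin C (\<beta> (b, a')) g"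
    if "a \<in> carrier A" "a' \<in> carrier A" "b \<in> carrier A" for a a' b
  proof -
    have "lin C (\<beta> (a \<oplus> a', b)) g = lin C (\<lambda>v. \<beta> (a, b) v \<oplus>\<^bsub>C\<^esub> \<beta> (a', b) v) g"
      by (rule C.lin_cong[where S=S]) (use b cl that g in \<open>auto simp: bilinear_map_def Pi_iff\<close>)
    then show "lin C (\<beta> (a \<oplus> a', b)) g = lin C (\<beta> (a, b)) g \<oplus>\<^bsub>C\<^esub> lin C (\<beta> (a', b)) g"
      using C.lin_fun_add[OF cl cl g] that by simp
    have "lin C (\<beta> (b, a \<oplus> a')) g = lin C (\<lambda>v. \<beta> (b, a) v \<oplus>\<^bsub>C\<^esub> \<beta> (b, a') v) g"
      by (rule C.lin_cong[where S=S]) (use b cl that g in \<open>auto simp: bilinear_map_def Pi_iff\<close>)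
    then show "lin C (\<beta> (b, a \<oplus> a')) g = lin C (\<beta> (b, a)) g \<oplus>\<^bsub>C\<^esub> lin C (\<beta> (b, a')) g"
      using C.lin_fun_add[OF cl cl g] that by simp
  qed
  moreover have "lin C (\<beta> (r \<odot> a, b)) g = r \<odot>\<^bsub>C\<^esub> lin C (\<beta> (a, b)) g"
    "lin C (\<beta> (a, r \<odot> b)) g = r \<odot>\<^bsub>C\<^esub> lin C (\<beta> (a, b)) g"
    if "a \<in> carrier A" "b \<in> carrier A" for r a b
  proof -
    have "lin C (\<beta> (r \<odot> a, b)) g = lin C (\<lambda>v. r \<odot>\<^bsub>C\<^esub> \<beta> (a, b) v) g"
      by (rule C.lin_cong[where S=S]) (use b cl that g in \<open>auto simp: bilinear_map_def Pi_iff\<close>)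
    then show "lin C (\<beta> (r \<odot> a, b)) g = r \<odot>\<^bsub>C\<^esub> lin C (\<beta> (a, b)) g"
      using C.lin_fun_smult[OF cl g] that by simp
    have "lin C (\<beta> (a, r \<odot> b)) g = lin C (\<lambda>v. r \<odot>\<^bsub>C\<^esub> \<beta> (a, b) v) g"
      by (rule C.lin_cong[where S=S]) (use b cl that g in \<open>auto simp: bilinear_map_def Pi_iff\<close>)
    then show "lin C (\<beta> (a, r \<odot> b)) g = r \<odot>\<^bsub>C\<^esub> lin C (\<beta> (a, b)) g"
      using C.lin_fun_smult[OF cl g] that by simp
  qed
  moreover have "lin C (\<beta> (a, b)) g \<in> carrier C" if "a \<in> carrier A" "b \<in> carrier A" for a b
    using C.lin_closed[OF cl g] that by blast
  ultimately show ?thesis unfolding bilinear_map_def by auto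
qed

text \<open>The kernel of the linear extension of a single bilinear map is not an ideal, but the
  intersection of all these kernels is.\<close>

lemma lin_env_ideal:
  assumes C: "k_space C" and b: "bilinear_map A C \<beta>" and f: "f \<in> env_ideal A"
  shows "lin C \<beta> f = \<zero>\<^bsub>C\<^esub>"
proof -
  interpret C: k_space C by fact
  define J where "J = {f \<in> carrier MA. \<forall>\<beta>. bilinear_map A C \<beta> \<longrightarrow> lin C \<beta> f = \<zero>\<^bsub>C\<^esub>}"
  have cl: "\<beta> \<in> carrier (env_monoid A) \<rightarrow> carrier C" if "bilinear_map A C \<beta>" for \<beta>
    using that by (auto simp: bilinear_map_def)
  have "ideal J MA"
  proof (rule monoid_algebra_idealI[OF env_monoid])
    fix f g assume fg: "f \<in> J" "g \<in> J"
    show "f + g \<in> J"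
      using fg MA.a_closed[of f g] C.lin_add[OF cl] by (auto simp: J_def)
  next
    fix f assume "f \<in> J"
    then show "- f \<in> J"
      using C.lin_uminus[OF cl] by (auto simp: J_def)
  next
    fix f g :: "'a \<times> 'a \<Rightarrow>\<^sub>0 'k"
    assume f: "f \<in> J" and g: "Poly_Mapping.keys g \<subseteq> carrier (env_monoid A)"
    have "lin C \<beta> (g \<otimes>\<^bsub>MA\<^esub> f) = \<zero>\<^bsub>C\<^esub>" if b: "bilinear_map A C \<beta>" for \<beta>
    proof -
      \<comment> \<open>Translation by a fixed pair sends bilinear maps to bilinear maps; hence
        quantifying over all of them makes the common kernel stable under products.\<close>
      have "bilinear_map A C (\<lambda>v. \<beta> (u \<otimes>\<^bsub>env_monoid A\<^esub> v))" if "u \<in> carrier (env_monoid A)" for u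
        using b that unfolding bilinear_map_def
        by (auto simp: l_distr r_distr scalar_mult_left scalar_mult_right)
      then have "lin C (\<lambda>v. \<beta> (u \<otimes>\<^bsub>env_monoid A\<^esub> v)) f = \<zero>\<^bsub>C\<^esub>" if "u \<in> carrier (env_monoid A)" for u
        using f that by (auto simp: J_def)
      then have "lin C (\<lambda>u. lin C (\<lambda>v. \<beta> (u \<otimes>\<^bsub>env_monoid A\<^esub> v)) f) g = lin C (\<lambda>u. \<zero>\<^bsub>C\<^esub>) g"
        using g by (intro C.lin_cong) auto
      then show ?thesis
        using C.lin_mult[OF env_monoid cl[OF b] g] f by (simp add: J_def C.lin_const_zero)
    qed
    then show "g \<otimes>\<^bsub>MA\<^esub> f \<in> J" using f g MA.m_closed[of g f] by (auto simp: J_def)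
  next
    fix f g :: "'a \<times> 'a \<Rightarrow>\<^sub>0 'k"
    assume f: "f \<in> J" and g: "Poly_Mapping.keys g \<subseteq> carrier (env_monoid A)"
    have "lin C \<beta> (f \<otimes>\<^bsub>MA\<^esub> g) = \<zero>\<^bsub>C\<^esub>" if b: "bilinear_map A C \<beta>" for \<beta>
    proof -
      have "bilinear_map A C (\<lambda>u. \<beta> (u \<otimes>\<^bsub>env_monoid A\<^esub> v))" if "v \<in> carrier (env_monoid A)" for v
        using b that unfolding bilinear_map_def
        by (auto simp: l_distr r_distr scalar_mult_left scalar_mult_right)
      \<comment> \<open>With \<open>g\<close> on the right the outer sum runs over \<open>f\<close>,
        so the whole inner sum over \<open>g\<close> has to be recognised as a single bilinear map
        before the assumption on \<open>f\<close> applies.\<close>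
      then have "bilinear_map A C (\<lambda>u. lin C (\<lambda>v. \<beta> (u \<otimes>\<^bsub>env_monoid A\<^esub> v)) g)"
        using bilinear_map_lin[OF C, of "carrier (env_monoid A)" "\<lambda>u v. \<beta> (u \<otimes>\<^bsub>env_monoid A\<^esub> v)" g] g
        by blast
      then show ?thesis
        using C.lin_mult[OF env_monoid cl[OF b] _ g, of f] f by (simp add: J_def)
    qed
    then show "f \<otimes>\<^bsub>MA\<^esub> g \<in> J" using f g MA.m_closed[of f g] by (auto simp: J_def)
  qed (auto simp: J_def)
  moreover have "tensor_rels A (opp A) \<subseteq> J"
  proof
    fix f assume f: "f \<in> tensor_rels A (opp A)"
    have "lin C \<beta> f = \<zero>\<^bsub>C\<^esub>" if b: "bilinear_map A C \<beta>" for \<beta>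
    proof -
      have diff: "lin C \<beta> (f - g) = lin C \<beta> f \<ominus>\<^bsub>C\<^esub> lin C \<beta> g"
        if "Poly_Mapping.keys f \<subseteq> carrier A \<times> carrier A" "Poly_Mapping.keys g \<subseteq> carrier A \<times> carrier A" for f g
        using C.lin_diff[OF cl[OF b]] that by simp
      have k: "Poly_Mapping.keys (f - g) \<subseteq> carrier A \<times> carrier A"
        if "Poly_Mapping.keys f \<subseteq> carrier A \<times> carrier A" "Poly_Mapping.keys g \<subseteq> carrier A \<times> carrier A" 
        for f g :: "_ \<Rightarrow>\<^sub>0 'k"
        using that keys_diff[of f g] by blast
      have b0: "\<beta> (a, b) \<in> carrier C" if "a \<in> carrier A" "b \<in> carrier A" for a b
        using b that by (auto simp: bilinear_map_def)
      have b1: "\<beta> (a \<oplus> a', b) = \<beta> (a, b) \<oplus>\<^bsub>C\<^esub> \<beta> (a', b)" "\<beta> (b, a \<oplus> a') = \<beta> (b, a) \<oplus>\<^bsub>C\<^esub> \<beta> (b, a')"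
        if "a \<in> carrier A" "a' \<in> carrier A" "b \<in> carrier A" for a a' b
        using b that by (auto simp: bilinear_map_def)
      have b2: "\<beta> (r \<odot> a, b) = r \<odot>\<^bsub>C\<^esub> \<beta> (a, b)" "\<beta> (a, r \<odot> b) = r \<odot>\<^bsub>C\<^esub> \<beta> (a, b)"
        if "a \<in> carrier A" "b \<in> carrier A" for r a b
        using b that by (auto simp: bilinear_map_def)
      have c1: "x \<ominus>\<^bsub>C\<^esub> x = \<zero>\<^bsub>C\<^esub>" if "x \<in> carrier C" for x
        using that by (simp add: a_minus_def C.r_neg)
      have c2: "x \<oplus>\<^bsub>C\<^esub> y \<ominus>\<^bsub>C\<^esub> x \<ominus>\<^bsub>C\<^esub> y = \<zero>\<^bsub>C\<^esub>"
        if "x \<in> carrier C" "y \<in> carrier C" for x y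
        using that by (simp add: a_minus_def C.a_comm[of x y] C.a_assoc C.r_neg)
      from f show ?thesis unfolding tensor_rels_def
        by (auto simp: diff k C.lin_single b0 b1 b2 c1 c2)
    qed
    then show "f \<in> J" using f tensor_rels_carrier by (auto simp: J_def)
  qed
  ultimately have "env_ideal A \<subseteq> J"
    unfolding env_ideal_def by (rule MA.genideal_minimal)
  then show ?thesis using f b by (auto simp: J_def)
qed

lemma env_lift_coset:
  assumes C: "k_space C" and b: "bilinear_map A C \<beta>" and f: "f \<in> carrier MA"
  shows "env_lift C \<beta> (env_ideal A +>\<^bsub>MA\<^esub> f) = lin C \<beta> f"
proof -
  interpret C: k_space C by fact
  interpret I: ideal "env_ideal A" MA by (rule env_ideal)
  have cl: "\<beta> \<in> carrier (env_monoid A) \<rightarrow> carrier C"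
    using b by (auto simp: bilinear_map_def)
  have const: "lin C \<beta> g = lin C \<beta> f" if g: "g \<in> env_ideal A +>\<^bsub>MA\<^esub> f" for g
  proof -
    obtain h where h: "h \<in> env_ideal A" "g = h + f"
      using g by (auto simp: a_r_coset_def')
    then have "h \<in> carrier MA" using I.a_Hcarr by blast
    then show ?thesis
      using C.lin_add[OF cl, of h f] h f lin_env_ideal[OF C b h(1)] C.lin_closed[OF cl, of f] by simp
  qed
  show ?thesis
    unfolding env_lift_def
  proof (rule the_elem_image_unique)
    show "env_ideal A +>\<^bsub>MA\<^esub> f \<noteq> {}" using I.a_rcos_self[OF f] by (rule ex_in_conv[THEN iffD1, OF exI])
  qed (rule const)
qed

lemma E_carrierE:
  assumes "X \<in> carrier E"
  obtains f where "f \<in> carrier MA" "X = env_ideal A +>\<^bsub>MA\<^esub> f"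
  using assms alg_quot_carrierE[OF MA env_ideal] unfolding env_algebra_def by metis

section \<open>Calculus with pure tensors\<close>

lemma tens_closed [simp, intro]: "a \<in> carrier A \<Longrightarrow> b \<in> carrier A \<Longrightarrow> a \<bowtie> b \<in> carrier E"
  unfolding tens_def env_algebra_def by (rule alg_quot_carrierI[OF MA env_ideal]) simp

lemma tens_mult:
  "\<lbrakk>a \<in> carrier A; b \<in> carrier A; a' \<in> carrier A; b' \<in> carrier A\<rbrakk> \<Longrightarrow>
    a \<bowtie> b \<cdot> a' \<bowtie> b' = (a \<otimes> a') \<bowtie> (b' \<otimes> b)"
  unfolding tens_def env_algebra_def by (simp add: alg_quot_mult[OF MA env_ideal])

lemma tens_one: "\<one>\<^bsub>E\<^esub> = \<one> \<bowtie> \<one>"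
  unfolding tens_def env_algebra_def by (simp add: alg_quot_simps[OF MA env_ideal])

lemma tens_relation:
  assumes "f - g \<in> tensor_rels A (opp A)" "Poly_Mapping.keys f \<subseteq> carrier A \<times> carrier A"
    "Poly_Mapping.keys g \<subseteq> carrier A \<times> carrier A"
  shows "env_ideal A +>\<^bsub>MA\<^esub> f = env_ideal A +>\<^bsub>MA\<^esub> g"
proof -
  have "f - g \<in> env_ideal A"
    using MA.genideal_self[OF tensor_rels_carrier] assms(1) unfolding env_ideal_def by blast
  then show ?thesis
    using assms by (simp add: coset_eq_iff[OF MA env_ideal] monoid_algebra_diff[OF env_monoid])
qed

lemma tens_smult_left:
  assumes "a \<in> carrier A" "b \<in> carrier A"
  shows "(r \<odot> a) \<bowtie> b = r \<odot>\<^bsub>E\<^esub> a \<bowtie> b"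
proof -
  have "Poly_Mapping.single (r \<odot> a, b) 1 - Poly_Mapping.single (a, b) r \<in> tensor_rels A (opp A)"
    unfolding tensor_rels_def opp_simps smult_opp
    by (rule UnI1, rule UnI2, rule CollectI, rule exI[of _ r], rule exI[of _ a], rule exI[of _ b]) (use assms in auto)
  from tens_relation[OF this] show ?thesis
    unfolding tens_def env_algebra_def using assms by (simp add: alg_quot_smult[OF MA env_ideal])
qed

lemma tens_smult_right:
  assumes "a \<in> carrier A" "b \<in> carrier A"
  shows "a \<bowtie> (r \<odot> b) = r \<odot>\<^bsub>E\<^esub> a \<bowtie> b"
proof -
  have "Poly_Mapping.single (a, r \<odot> b) 1 - Poly_Mapping.single (a, b) r \<in> tensor_rels A (opp A)"
    unfolding tensor_rels_def opp_simps smult_opp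
    by (rule UnI2, rule CollectI, rule exI[of _ r], rule exI[of _ a], rule exI[of _ b]) (use assms in auto)
  from tens_relation[OF this] show ?thesis
    unfolding tens_def env_algebra_def using assms by (simp add: alg_quot_smult[OF MA env_ideal])
qed

lemma tens_add_left:
  assumes "a \<in> carrier A" "a' \<in> carrier A" "b \<in> carrier A"
  shows "(a \<oplus> a') \<bowtie> b = a \<bowtie> b \<boxplus> a' \<bowtie> b"
proof -
  let ?s = "\<lambda>a b. Poly_Mapping.single (a, b) (1 :: 'k)"
  have "?s (a \<oplus> a') b - ?s a b - ?s a' b \<in> tensor_rels A (opp A)"
    unfolding tensor_rels_def opp_simps smult_opp
    by (rule UnI1, rule UnI1, rule UnI1, rule CollectI, rule exI[of _ a], rule exI[of _ "a'"], rule exI[of _ b]) (use assms in auto)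
  then have "?s (a \<oplus> a') b - (?s a b + ?s a' b) \<in> tensor_rels A (opp A)"
    by (simp add: diff_diff_eq)
  moreover have "Poly_Mapping.keys (?s a b + ?s a' b) \<subseteq> carrier A \<times> carrier A"
    using assms keys_add[of "?s a b" "?s a' b"] by auto
  ultimately show ?thesis
    unfolding tens_def env_algebra_def using assms tens_relation
    by (simp add: alg_quot_add[OF MA env_ideal])
qed

lemma tens_add_right:
  assumes "a \<in> carrier A" "a' \<in> carrier A" "b \<in> carrier A"
  shows "b \<bowtie> (a \<oplus> a') = b \<bowtie> a \<boxplus> b \<bowtie> a'"
proof -
  let ?s = "\<lambda>a b. Poly_Mapping.single (a, b) (1 :: 'k)"
  have "?s b (a \<oplus> a') - ?s b a - ?s b a' \<in> tensor_rels A (opp A)"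
    unfolding tensor_rels_def opp_simps smult_opp
    by (rule UnI1, rule UnI1, rule UnI2, rule CollectI, rule exI[of _ b], rule exI[of _ a], rule exI[of _ "a'"]) (use assms in auto)
  then have "?s b (a \<oplus> a') - (?s b a + ?s b a') \<in> tensor_rels A (opp A)"
    by (simp add: diff_diff_eq)
  moreover have "Poly_Mapping.keys (?s b a + ?s b a') \<subseteq> carrier A \<times> carrier A"
    using assms keys_add[of "?s b a" "?s b a'"] by auto
  ultimately show ?thesis
    unfolding tens_def env_algebra_def using assms tens_relation
    by (simp add: alg_quot_add[OF MA env_ideal])
qed

lemma tens_bilinear: "bilinear_map A E (\<lambda>u. fst u \<bowtie> snd u)" "bilinear_map A E (\<lambda>u. snd u \<bowtie> fst u)"
  by (auto simp: bilinear_map_def tens_add_left tens_add_right tens_smult_left tens_smult_right)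

text \<open>A scalar can be moved into the first factor and zero is the tensor of two zeros, so pure
  tensors and sums cover every element.\<close>

lemma tens_induct [consumes 1, case_names tens add]:
  assumes "X \<in> carrier E"
    and t: "\<And>a b. a \<in> carrier A \<Longrightarrow> b \<in> carrier A \<Longrightarrow> P (a \<bowtie> b)"
    and add: "\<And>X Y. X \<in> carrier E \<Longrightarrow> Y \<in> carrier E \<Longrightarrow> P X \<Longrightarrow> P Y \<Longrightarrow> P (X \<boxplus> Y)"
  shows "P X"
proof -
  let ?c = "\<lambda>f. env_ideal A +>\<^bsub>MA\<^esub> f"
  obtain f where f: "f \<in> carrier MA" and X: "X = ?c f"
    using assms(1) by (rule E_carrierE)
  have s: "?c (Poly_Mapping.single (a, b) r) = (r \<odot> a) \<bowtie> b"
    if "a \<in> carrier A" "b \<in> carrier A" for a b r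
    using that unfolding tens_smult_left[OF that] unfolding tens_def env_algebra_def
    by (simp add: alg_quot_smult[OF MA env_ideal])
  have cl: "?c f \<in> carrier E" if "f \<in> carrier MA" for f
    unfolding env_algebra_def by (rule alg_quot_carrierI[OF MA env_ideal that])
  from f have "Poly_Mapping.keys f \<subseteq> carrier (env_monoid A)" by simp
  then have "P (?c f)"
  proof (induction rule: poly_mapping_restrict_induct)
    case zero
    have "?c 0 = ?c (Poly_Mapping.single (\<zero>, \<zero>) 0)" by simp
    also have "P \<dots>" unfolding s[OF zero_closed zero_closed] by (rule t) auto
    finally show ?case .
  next
    case (single u r)
    then show ?case by (cases u) (auto simp: s intro!: t)
  next
    case (add f g)
    then have "?c (f + g) = ?c f \<boxplus> ?c g"
      unfolding env_algebra_def by (simp add: alg_quot_add[OF MA env_ideal])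
    then show ?case using assms(3)[of "?c f" "?c g"] add cl by auto
  qed
  then show ?thesis by (simp add: X)
qed

context
  fixes C \<beta>
  assumes C: "k_space C" and b: "bilinear_map A C \<beta>"
begin

interpretation C: k_space C by (rule C)

private lemma b': "\<beta> \<in> carrier (env_monoid A) \<rightarrow> carrier C"
  using b by (auto simp: bilinear_map_def)

lemma env_lift_closed [intro]: "X \<in> carrier E \<Longrightarrow> env_lift C \<beta> X \<in> carrier C"
  by (elim E_carrierE) (use C.lin_closed[OF b'] in \<open>auto simp: env_lift_coset[OF C b]\<close>)

lemma env_lift_tens:
  assumes "a \<in> carrier A" "b \<in> carrier A"
  shows "env_lift C \<beta> (a \<bowtie> b) = \<beta> (a, b)"
proof -
  have "\<beta> (a, b) \<in> carrier C" using b' assms by auto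
  then show ?thesis
    unfolding tens_def using assms by (simp add: env_lift_coset[OF C b] C.lin_single)
qed

lemma env_lift_add:
  assumes "X \<in> carrier E" "Y \<in> carrier E"
  shows "env_lift C \<beta> (X \<boxplus> Y) = env_lift C \<beta> X \<oplus>\<^bsub>C\<^esub> env_lift C \<beta> Y"
proof -
  obtain f g where fg: "f \<in> carrier MA" "g \<in> carrier MA"
    and X: "X = env_ideal A +>\<^bsub>MA\<^esub> f" and Y: "Y = env_ideal A +>\<^bsub>MA\<^esub> g"
    using assms by (metis E_carrierE)
  have s: "X \<boxplus> Y = env_ideal A +>\<^bsub>MA\<^esub> (f \<oplus>\<^bsub>MA\<^esub> g)"
    using fg unfolding X Y env_algebra_def by (rule alg_quot_add[OF MA env_ideal])
  show ?thesis
    unfolding s env_lift_coset[OF C b MA.a_closed[OF fg]] unfolding X Y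
    using fg C.lin_add[OF b', of f g] by (simp add: env_lift_coset[OF C b])
qed

end

lemma env_lift_zero: "k_space C \<Longrightarrow> bilinear_map A C \<beta> \<Longrightarrow> env_lift C \<beta> \<zero>\<^sub>E = \<zero>\<^bsub>C\<^esub>"
proof -
  assume *: "k_space C" "bilinear_map A C \<beta>"
  interpret C: k_space C by fact
  show ?thesis
    using env_lift_add[OF *, of "\<zero>\<^sub>E" "\<zero>\<^sub>E"] env_lift_closed[OF *, of "\<zero>\<^sub>E"]
    by (simp add: C.add.l_cancel_one)
qed

lemma env_lift_minus: "k_space C \<Longrightarrow> bilinear_map A C \<beta> \<Longrightarrow> X \<in> carrier E \<Longrightarrow>
    env_lift C \<beta> (\<ominus>\<^bsub>E\<^esub> X) = \<ominus>\<^bsub>C\<^esub> env_lift C \<beta> X"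
proof -
  assume *: "k_space C" "bilinear_map A C \<beta>" and X: "X \<in> carrier E"
  interpret C: k_space C by fact
  show ?thesis
    using env_lift_add[OF *, of "\<ominus>\<^bsub>E\<^esub> X" X] env_lift_closed[OF *] X env_lift_zero[OF *]
    by (intro C.sum_zero_eq_neg) (auto simp: E.l_neg)
qed

subsection \<open>The flip and the bimodule structures\<close>

definition flip where "flip = env_lift E (\<lambda>u. snd u \<bowtie> fst u)"

lemma flip_closed [simp, intro]: "X \<in> carrier E \<Longrightarrow> flip X \<in> carrier E"
  unfolding flip_def by (rule env_lift_closed[OF E.k_space_axioms tens_bilinear(2)])

lemma flip_tens: "a \<in> carrier A \<Longrightarrow> b \<in> carrier A \<Longrightarrow> flip (a \<bowtie> b) = b \<bowtie> a"
  unfolding flip_def by (simp add: env_lift_tens[OF E.k_space_axioms tens_bilinear(2)])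

lemma flip_add: "X \<in> carrier E \<Longrightarrow> Y \<in> carrier E \<Longrightarrow> flip (X \<boxplus> Y) = flip X \<boxplus> flip Y"
  unfolding flip_def by (rule env_lift_add[OF E.k_space_axioms tens_bilinear(2)])

lemma flip_zero [simp]: "flip \<zero>\<^sub>E = \<zero>\<^sub>E"
  unfolding flip_def by (rule env_lift_zero[OF E.k_space_axioms tens_bilinear(2)])

lemma flip_minus: "X \<in> carrier E \<Longrightarrow> flip (\<ominus>\<^bsub>E\<^esub> X) = \<ominus>\<^bsub>E\<^esub> flip X"
  unfolding flip_def by (rule env_lift_minus[OF E.k_space_axioms tens_bilinear(2)])

lemma flip_flip [simp]: "X \<in> carrier E \<Longrightarrow> flip (flip X) = X"
  by (induction rule: tens_induct) (simp_all add: flip_tens flip_add)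

lemma flip_mult:
  assumes "X \<in> carrier E" "Y \<in> carrier E"
  shows "flip (X \<cdot> Y) = flip Y \<cdot> flip X"
  using assms(1)
proof (induction rule: tens_induct)
  case (tens a b)
  from assms(2) show ?case
    by (induction rule: tens_induct)
      (use tens in \<open>simp_all add: tens_mult flip_tens flip_add E.r_distr E.l_distr\<close>)
qed (use assms(2) in \<open>simp_all add: flip_add E.r_distr E.l_distr\<close>)

lemma flip_smult:
  assumes "X \<in> carrier E"
  shows "flip (r \<odot>\<^bsub>E\<^esub> X) = r \<odot>\<^bsub>E\<^esub> flip X"
  using assms by (induction rule: tens_induct)
    (simp_all add: tens_smult_left[symmetric] flip_tens flip_add E.smult_r_distr tens_smult_right)

abbreviation lact where "lact \<equiv> smult (bimod_left A)"
abbreviation ract where "ract \<equiv> smult (bimod_right A)"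

lemma lact_eq: "lact X m = env_lift A (\<lambda>u. fst u \<otimes> m \<otimes> snd u) X"
  by (simp add: bimod_left_def env_lift_def lin_def[abs_def])

lemma ract_eq: "ract X m = env_lift A (\<lambda>u. snd u \<otimes> m \<otimes> fst u) X"
  by (simp add: bimod_right_def env_lift_def lin_def[abs_def])

lemma lact_bilinear: "m \<in> carrier A \<Longrightarrow> bilinear_map A A (\<lambda>u. fst u \<otimes> m \<otimes> snd u)"
  by (auto simp: bilinear_map_def l_distr r_distr scalar_mult_left scalar_mult_right)

lemma ract_bilinear: "m \<in> carrier A \<Longrightarrow> bilinear_map A A (\<lambda>u. snd u \<otimes> m \<otimes> fst u)"
  by (auto simp: bilinear_map_def l_distr r_distr scalar_mult_left scalar_mult_right)

lemma lact_closed [simp, intro]: "X \<in> carrier E \<Longrightarrow> m \<in> carrier A \<Longrightarrow> lact X m \<in> carrier A"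
  unfolding lact_eq by (rule env_lift_closed[OF k_space_axioms lact_bilinear])

lemma lact_add:
  "X \<in> carrier E \<Longrightarrow> Y \<in> carrier E \<Longrightarrow> m \<in> carrier A \<Longrightarrow> lact (X \<boxplus> Y) m = lact X m \<oplus> lact Y m"
  unfolding lact_eq by (rule env_lift_add[OF k_space_axioms lact_bilinear])

lemma lact_tens:
  "a \<in> carrier A \<Longrightarrow> b \<in> carrier A \<Longrightarrow> m \<in> carrier A \<Longrightarrow> lact (a \<bowtie> b) m = a \<otimes> m \<otimes> b"
  unfolding lact_eq by (simp add: env_lift_tens[OF k_space_axioms lact_bilinear])

text \<open>On pure tensors both sides are b m a. Through this identity every statement about the
  right module structure is reduced to the left action and the anti-multiplicativity of the
  flip.\<close>

lemma ract_flip: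
  assumes "X \<in> carrier E" "m \<in> carrier A"
  shows "ract X m = lact (flip X) m"
proof -
  have "ract X m \<in> carrier A \<and> ract X m = lact (flip X) m"
    using assms(1)
  proof (induction rule: tens_induct)
    case (tens a b)
    then show ?case using assms(2)
      unfolding ract_eq by (simp add: env_lift_tens[OF k_space_axioms ract_bilinear] flip_tens lact_tens)
  next
    case (add X Y)
    then show ?case using assms(2)
      unfolding ract_eq by (simp add: env_lift_add[OF k_space_axioms ract_bilinear] flip_add lact_add)
  qed
  then show ?thesis ..
qed

lemma lact_add_right:
  assumes "X \<in> carrier E" "m \<in> carrier A" "n \<in> carrier A"
  shows "lact X (m \<oplus> n) = lact X m \<oplus> lact X n"
  using assms(1) by (induction rule: tens_induct)
    (use assms in \<open>simp_all add: lact_tens lact_add l_distr r_distr a_ac\<close>)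

lemma lact_mult:
  assumes "X \<in> carrier E" "Y \<in> carrier E" "m \<in> carrier A"
  shows "lact (X \<cdot> Y) m = lact X (lact Y m)"
  using assms(1)
proof (induction rule: tens_induct)
  case (tens a b)
  from assms(2) show ?case
    by (induction rule: tens_induct)
      (use tens assms in \<open>simp_all add: tens_mult lact_tens lact_add E.r_distr l_distr r_distr m_assoc\<close>)
qed (use assms in \<open>simp_all add: lact_add E.l_distr\<close>)

lemma lact_one: "m \<in> carrier A \<Longrightarrow> lact \<one>\<^bsub>E\<^esub> m = m"
  by (simp add: tens_one lact_tens)

lemma truncate_simps [simp]:
  "carrier (ring.truncate M) = carrier M" "mult (ring.truncate M) = mult M"
  "one (ring.truncate M) = one M" "zero (ring.truncate M) = zero M" "add (ring.truncate M) = add M"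
  by (simp_all add: ring.truncate_def)

lemma bimod_simps [simp]:
  "carrier (bimod_left A) = carrier A" "zero (bimod_left A) = zero A" "add (bimod_left A) = add A"
  "carrier (bimod_right A) = carrier A" "zero (bimod_right A) = zero A" "add (bimod_right A) = add A"
  by (simp_all add: bimod_left_def bimod_right_def)

lemma enveloping_ring: "ring (enveloping A)"
  by (rule ring_cong[OF E.ring_axioms]) (simp_all add: enveloping_eq)

lemma bimod_left_module: "left_module (enveloping A) (bimod_left A)"
  by (intro left_module.intro left_module_axioms.intro enveloping_ring
      abelian_group_cong[OF abelian_group_axioms])
    (simp_all add: enveloping_eq lact_add lact_add_right lact_mult lact_one)

end


section \<open>A basis of \<open>H\<^sub>q(f, g)\<close>\<close>

text \<open>An interface that hides the cosets: the three relations, generation under left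
  multiplication, and functionals \<open>\<phi> m\<close> dual to the monomials x^i t^j y^l.
  Generation is phrased with left multiplication because the straightening argument below moves one
  generator at a time in from the left.\<close>

locale hq_algebra = k_algebra A for A :: "('k::field, 'a) module" (structure) +
  fixes x t y :: 'a and p q k c d e :: 'k and \<phi> :: "nat \<times> nat \<times> nat \<Rightarrow> 'a \<Rightarrow> 'k"
  assumes gens [simp, intro]: "x \<in> carrier A" "t \<in> carrier A" "y \<in> carrier A"
    and tx: "t \<otimes> x = p \<odot> (x \<otimes> t) \<oplus> k \<odot> x"
    and yt: "y \<otimes> t = p \<odot> (t \<otimes> y) \<oplus> k \<odot> y"
    and yx: "y \<otimes> x = q \<odot> (x \<otimes> y) \<oplus> (e \<odot> \<one> \<oplus> d \<odot> t \<oplus> c \<odot> (t \<otimes> t))"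
    and generated: "\<And>S. \<lbrakk>S \<subseteq> carrier A; \<zero> \<in> S; \<one> \<in> S; \<And>a b. a \<in> S \<Longrightarrow> b \<in> S \<Longrightarrow> a \<oplus> b \<in> S;
        \<And>r a. a \<in> S \<Longrightarrow> r \<odot> a \<in> S; \<And>a. a \<in> S \<Longrightarrow> x \<otimes> a \<in> S; \<And>a. a \<in> S \<Longrightarrow> t \<otimes> a \<in> S;
        \<And>a. a \<in> S \<Longrightarrow> y \<otimes> a \<in> S\<rbrakk> \<Longrightarrow> carrier A \<subseteq> S"
    and \<phi>_add: "\<And>m a b. a \<in> carrier A \<Longrightarrow> b \<in> carrier A \<Longrightarrow> \<phi> m (a \<oplus> b) = \<phi> m a + \<phi> m b"
    and \<phi>_smult: "\<And>m r a. a \<in> carrier A \<Longrightarrow> \<phi> m (r \<odot> a) = r * \<phi> m a"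
    and \<phi>_pbw: "\<And>m i j l. \<phi> m (x [^] i \<otimes> (t [^] j \<otimes> y [^] l)) = (if m = (i, j, l) then 1 else 0)"
begin

definition pbw :: "nat \<Rightarrow> nat \<Rightarrow> nat \<Rightarrow> 'a" where
  "pbw i j l = x [^] i \<otimes> (t [^] j \<otimes> y [^] l)"

lemma pbw_closed [simp, intro]: "pbw i j l \<in> carrier A"
  by (simp add: pbw_def)

inductive_set span :: "'a set" where
  zero: "\<zero> \<in> span"
| pbw: "pbw i j l \<in> span"
| add: "a \<in> span \<Longrightarrow> b \<in> span \<Longrightarrow> a \<oplus> b \<in> span"
| smult: "a \<in> span \<Longrightarrow> r \<odot> a \<in> span"

lemma span_closed [simp, intro]: "a \<in> span \<Longrightarrow> a \<in> carrier A"
  by (induction rule: span.induct) auto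

lemma span_x: "a \<in> span \<Longrightarrow> x \<otimes> a \<in> span"
proof (induction rule: span.induct)
  case (pbw i j l)
  have "x \<otimes> pbw i j l = pbw (Suc i) j l"
    unfolding pbw_def nat_pow_Suc2[OF gens(1)] by (simp add: m_assoc)
  then show ?case by (simp add: span.pbw)
qed (auto simp: r_distr scalar_mult_right intro: span.zero span.add span.smult)

text \<open>Moving t past one x with \<open>tx\<close> leaves two terms with x in front and a
  monomial with one x fewer, so induction on the exponent of x applies.\<close>

lemma span_t: "a \<in> span \<Longrightarrow> t \<otimes> a \<in> span"
proof (induction rule: span.induct)
  case (pbw i j l)
  show ?case
  proof (induction i)
    case 0
    have "t \<otimes> pbw 0 j l = pbw 0 (Suc j) l"
      unfolding pbw_def nat_pow_Suc2[OF gens(2)] by (simp add: m_assoc)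
    then show ?case by (simp add: span.pbw)
  next
    case (Suc i)
    have "t \<otimes> pbw (Suc i) j l = (t \<otimes> x) \<otimes> pbw i j l"
      unfolding pbw_def nat_pow_Suc2[OF gens(1)] by (simp add: m_assoc)
    also have "\<dots> = p \<odot> (x \<otimes> (t \<otimes> pbw i j l)) \<oplus> k \<odot> (x \<otimes> pbw i j l)"
      by (simp add: tx l_distr scalar_mult_left m_assoc)
    also have "\<dots> \<in> span"
      by (intro span.add span.smult span_x Suc.IH span.pbw)
    finally show ?case .
  qed
qed (auto simp: r_distr scalar_mult_right intro: span.zero span.add span.smult)

text \<open>y first has to cross all powers of x and then all powers of t. Crossing an x produces
  the extra terms 1, t and t^2 to the left of the remaining monomial, which is why closure under t
  is established beforehand.\<close>

lemma span_y: "a \<in> span \<Longrightarrow> y \<otimes> a \<in> span"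
proof (induction rule: span.induct)
  case (pbw i j l)
  show ?case
  proof (induction i)
    case 0
    show ?case
    proof (induction j)
      case 0
      have "y \<otimes> pbw 0 0 l = pbw 0 0 (Suc l)"
        unfolding pbw_def nat_pow_Suc2[OF gens(3)] by (simp add: m_assoc)
      then show ?case by (simp add: span.pbw)
    next
      case (Suc j)
      have "y \<otimes> pbw 0 (Suc j) l = (y \<otimes> t) \<otimes> pbw 0 j l"
        unfolding pbw_def nat_pow_Suc2[OF gens(2)] by (simp add: m_assoc)
      also have "\<dots> = p \<odot> (t \<otimes> (y \<otimes> pbw 0 j l)) \<oplus> k \<odot> (y \<otimes> pbw 0 j l)"
        by (simp add: yt l_distr scalar_mult_left m_assoc)
      also have "\<dots> \<in> span"
        by (intro span.add span.smult span_t Suc.IH span.pbw)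
      finally show ?case .
    qed
  next
    case (Suc i)
    let ?m = "pbw i j l"
    have "y \<otimes> pbw (Suc i) j l = (y \<otimes> x) \<otimes> ?m"
      unfolding pbw_def nat_pow_Suc2[OF gens(1)] by (simp add: m_assoc)
    also have "\<dots> = q \<odot> (x \<otimes> (y \<otimes> ?m)) \<oplus> (e \<odot> ?m \<oplus> d \<odot> (t \<otimes> ?m) \<oplus> c \<odot> (t \<otimes> (t \<otimes> ?m)))"
      by (simp add: yx l_distr scalar_mult_left m_assoc)
    also have "\<dots> \<in> span"
      by (intro span.add span.smult span_x span_t Suc.IH span.pbw)
    finally show ?case .
  qed
qed (auto simp: r_distr scalar_mult_right intro: span.zero span.add span.smult)

lemma span_eq: "carrier A = span"
proof
  have "\<one> = pbw 0 0 0" by (simp add: pbw_def)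
  then have "\<one> \<in> span" by (simp add: span.pbw)
  then show "carrier A \<subseteq> span"
    by (intro generated span_x span_y span_t) (auto intro: span.zero span.add span.smult)
qed auto

lemma \<phi>_pbw': "\<phi> m (pbw i j l) = (if m = (i, j, l) then 1 else 0)"
  by (simp add: pbw_def \<phi>_pbw)

end

lemma (in k_algebra) alg_poly_superset:
  assumes "a \<in> carrier A" "degree f \<le> n"
  shows "alg_poly A f a = (\<Oplus>i\<in>{..n}. coeff f i \<odot> (a [^] i))"
  unfolding alg_poly_def using assms
  by (intro add.finprod_mono_neutral_cong_left) (auto simp: coeff_eq_0)

lemma (in k_algebra) alg_poly_linear:
  assumes "a \<in> carrier A"
  shows "alg_poly A [:r, s:] a = s \<odot> a \<oplus> r \<odot> \<one>"
  using assms by (simp add: alg_poly_superset[of a _ 1] numeral_eq_Suc)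

lemma (in k_algebra) alg_poly_quadratic:
  assumes "a \<in> carrier A"
  shows "alg_poly A [:r, s, u:] a = u \<odot> (a \<otimes> a) \<oplus> (s \<odot> a \<oplus> r \<odot> \<one>)"
  using assms by (simp add: alg_poly_superset[of a _ 2] numeral_eq_Suc)

abbreviation (input) psmult :: "'k::comm_semiring_0 \<Rightarrow> 'k poly \<Rightarrow> 'k poly" where
  "psmult \<equiv> Polynomial.smult"

section \<open>An action on families of polynomials that separates the monomials\<close>

context
  fixes p q k c d e :: "'k::field"
begin

primrec f_iter :: "nat \<Rightarrow> 'k poly" where
  "f_iter 0 = [:0, 1:]"
| "f_iter (Suc i) = psmult p (f_iter i) + [:k:]"

text \<open>The recursion comes from y x^(i+1) = (q x y + g(t)) x^i: moving y on through x^i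
  contributes q x^i g_i(t), and g(t) x^i = x^i g(f_i(t)). The initial value is zero because no x is
  crossed.\<close>

primrec g_coeff :: "nat \<Rightarrow> 'k poly" where
  "g_coeff 0 = 0"
| "g_coeff (Suc i) = psmult q (g_coeff i) + pcompose [:e, d, c:] (f_iter i)"

text \<open>A function \<open>F\<close> stands for the formal sum of the \<open>x\<^sup>i F\<^sub>i\<^sub>l(t) y\<^sup>l\<close>; the generators act by left
  multiplication, using \<open>t x\<^sup>i = x\<^sup>i f\<^sub>i(t)\<close> for the \<open>i\<close>-th iterate \<open>f\<^sub>i\<close> of \<open>f\<close>, and
  \<open>y x\<^sup>i = q\<^sup>i x\<^sup>i y + x\<^sup>i\<^sup>-\<^sup>1 g\<^sub>i(t)\<close>.\<close>

primrec gen_op :: "hgen \<Rightarrow> (nat \<Rightarrow> nat \<Rightarrow> 'k poly) \<Rightarrow> nat \<Rightarrow> nat \<Rightarrow> 'k poly" where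
  "gen_op X_gen F = (\<lambda>i l. case i of 0 \<Rightarrow> 0 | Suc i' \<Rightarrow> F i' l)"
| "gen_op T_gen F = (\<lambda>i l. f_iter i * F i l)"
| "gen_op Y_gen F = (\<lambda>i l. (case l of 0 \<Rightarrow> 0 | Suc l' \<Rightarrow> psmult (q ^ i) (pcompose (F i l') [:k, p:]))
      + g_coeff (Suc i) * F (Suc i) l)"

definition word_op :: "hgen list \<Rightarrow> (nat \<Rightarrow> nat \<Rightarrow> 'k poly) \<Rightarrow> nat \<Rightarrow> nat \<Rightarrow> 'k poly" where
  "word_op = foldr gen_op"

definition poly_rep :: "('k, nat \<Rightarrow> nat \<Rightarrow> 'k poly) module" where
  "poly_rep = \<lparr>carrier = UNIV, mult = undefined, one = undefined, zero = (\<lambda>i l. 0),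
    add = (\<lambda>F G i l. F i l + G i l), smult = (\<lambda>r F i l. psmult r (F i l))\<rparr>"

lemma poly_rep_simps [simp]:
  "carrier poly_rep = UNIV" "\<zero>\<^bsub>poly_rep\<^esub> = (\<lambda>i l. 0)" "F \<oplus>\<^bsub>poly_rep\<^esub> G = (\<lambda>i l. F i l + G i l)"
  "r \<odot>\<^bsub>poly_rep\<^esub> F = (\<lambda>i l. psmult r (F i l))"
  by (simp_all add: poly_rep_def)

lemma poly_rep: "k_space poly_rep"
proof (intro k_space.intro k_space_axioms.intro abelian_groupI)
  fix F
  show "\<exists>G\<in>carrier poly_rep. G \<oplus>\<^bsub>poly_rep\<^esub> F = \<zero>\<^bsub>poly_rep\<^esub>"
    by (intro bexI[of _ "\<lambda>i l. - F i l"]) auto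
qed (auto simp: fun_eq_iff smult_add_left smult_add_right add_ac)

interpretation V: k_space poly_rep by (rule poly_rep)

lemma gen_op_add: "gen_op a (F \<oplus>\<^bsub>poly_rep\<^esub> G) = gen_op a F \<oplus>\<^bsub>poly_rep\<^esub> gen_op a G"
  by (cases a) (auto simp: fun_eq_iff algebra_simps pcompose_add smult_add_right split: nat.split)

lemma gen_op_smult: "gen_op a (r \<odot>\<^bsub>poly_rep\<^esub> F) = r \<odot>\<^bsub>poly_rep\<^esub> gen_op a F"
  by (cases a) (auto simp: fun_eq_iff algebra_simps pcompose_smult smult_add_right mult.commute split: nat.split)

lemma word_op_add: "word_op w (F \<oplus>\<^bsub>poly_rep\<^esub> G) = word_op w F \<oplus>\<^bsub>poly_rep\<^esub> word_op w G"
  unfolding word_op_def by (induction w) (simp_all only: foldr.simps gen_op_add o_apply id_apply)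

lemma word_op_smult: "word_op w (r \<odot>\<^bsub>poly_rep\<^esub> F) = r \<odot>\<^bsub>poly_rep\<^esub> word_op w F"
  unfolding word_op_def by (induction w) (simp_all only: foldr.simps gen_op_smult o_apply id_apply)

lemma word_op_append: "word_op (u @ v) F = word_op u (word_op v F)"
  by (simp add: word_op_def)

text \<open>The recursion of \<open>f_iter\<close> applies f from the outside, whereas moving y past
  a polynomial in t substitutes f inside; for iterates of one polynomial the two agree.\<close>

lemma f_iter_pcompose: "pcompose (f_iter i) [:k, p:] = f_iter (Suc i)"
  by (induction i) (auto simp: pcompose_add pcompose_smult pcompose_pCons)

abbreviation "FA \<equiv> free_algebra :: ('k, hgen list \<Rightarrow>\<^sub>0 'k) module"

lemma free_monoid: "Group.monoid free_monoid"
  by (rule monoidI) (auto simp: free_monoid_def)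

lemma free_monoid_simps [simp]:
  "carrier free_monoid = UNIV" "u \<otimes>\<^bsub>free_monoid\<^esub> v = u @ v" "\<one>\<^bsub>free_monoid\<^esub> = []"
  by (simp_all add: free_monoid_def)

lemma FA: "k_algebra FA"
  unfolding free_algebra_def by (rule monoid_algebra_k_algebra[OF free_monoid])

interpretation FA: k_algebra FA by (rule FA)

definition act :: "(hgen list \<Rightarrow>\<^sub>0 'k) \<Rightarrow> (nat \<Rightarrow> nat \<Rightarrow> 'k poly) \<Rightarrow> nat \<Rightarrow> nat \<Rightarrow> 'k poly" where
  "act a F = lin poly_rep (\<lambda>w. word_op w F) a"

lemma act_mult: "act (a \<otimes>\<^bsub>FA\<^esub> b) F = act a (act b F)"
proof -
  have "act (a \<otimes>\<^bsub>FA\<^esub> b) F = lin poly_rep (\<lambda>u. lin poly_rep (\<lambda>v. word_op u (word_op v F)) b) a"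
    unfolding act_def free_algebra_def
    by (subst V.lin_mult[OF free_monoid]) (simp_all add: word_op_append)
  also have "\<dots> = lin poly_rep (\<lambda>u. word_op u (act b F)) a"
  proof -
    have "word_op u (lin poly_rep (\<lambda>v. word_op v F) b) = lin poly_rep (\<lambda>v. word_op u (word_op v F)) b" for u
      by (rule lin_commute[OF poly_rep poly_rep, where S=UNIV]) (simp_all only: word_op_add word_op_smult, auto)
    then show ?thesis by (simp add: act_def)
  qed
  finally show ?thesis by (simp add: act_def)
qed

lemma act_add: "act (a + b) F = act a F \<oplus>\<^bsub>poly_rep\<^esub> act b F"
  unfolding act_def by (rule V.lin_add[where S=UNIV]) auto

lemma act_diff: "act (a - b) F = (\<lambda>i l. act a F i l - act b F i l)"
proof -
  have "act a F = act (a - b) F \<oplus>\<^bsub>poly_rep\<^esub> act b F"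
    by (simp only: act_add[symmetric] diff_add_cancel)
  then show ?thesis by (simp add: fun_eq_iff)
qed

lemma act_single: "act (Poly_Mapping.single w r) F = r \<odot>\<^bsub>poly_rep\<^esub> word_op w F"
  unfolding act_def by (rule V.lin_single) simp

lemma act_0: "act 0 F = \<zero>\<^bsub>poly_rep\<^esub>"
  unfolding act_def by simp

lemma act_smult: "act (r \<odot>\<^bsub>FA\<^esub> a) F = r \<odot>\<^bsub>poly_rep\<^esub> act a F"
proof -
  have "r \<odot>\<^bsub>FA\<^esub> a = Poly_Mapping.single [] r \<otimes>\<^bsub>FA\<^esub> a"
    using FA.scalar_mult_left[of "\<one>\<^bsub>FA\<^esub>" a r] FA.l_one[of a]
    by (simp add: free_algebra_def)
  then show ?thesis by (simp add: act_mult act_single word_op_def)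
qed

lemma act_zero_ideal: "ideal {a. \<forall>F. act a F = \<zero>\<^bsub>poly_rep\<^esub>} FA"
  unfolding free_algebra_def
proof (rule monoid_algebra_idealI[OF free_monoid], goal_cases)
  case (4 a)
  then show ?case using act_diff[of 0 a] act_0 by (simp add: fun_eq_iff)
next
  case (5 a b)
  \<comment> \<open>Multiplicativity applied to b0 = 0 shows that b maps the zero family to itself.
    In the product of b with an element of the ideal, b is the factor that acts last.\<close>
  have "act b (\<lambda>i l. 0) = (\<lambda>i l. 0)" for b
    using act_mult[of b 0] act_0 by (simp add: free_algebra_def)
  then show ?case using 5 act_mult[unfolded free_algebra_def] by simp
next
  case (6 a b)
  then show ?case using act_mult[unfolded free_algebra_def] by simp
qed (auto simp: act_add act_0)

lemma H_rels_eq: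
  "H_rels q [:k, p:] [:e, d, c:] =
    {Poly_Mapping.single [T_gen, X_gen] 1
        - (Poly_Mapping.single [X_gen, T_gen] p + Poly_Mapping.single [X_gen] k),
     Poly_Mapping.single [Y_gen, T_gen] 1
        - (Poly_Mapping.single [T_gen, Y_gen] p + Poly_Mapping.single [Y_gen] k),
     Poly_Mapping.single [Y_gen, X_gen] 1 - Poly_Mapping.single [X_gen, Y_gen] q
        - (Poly_Mapping.single [T_gen, T_gen] c + (Poly_Mapping.single [T_gen] d + Poly_Mapping.single [] e))}"
proof -
  have g: "free_gen a \<in> carrier FA" for a by (simp add: free_algebra_def)
  have m: "a \<ominus>\<^bsub>FA\<^esub> b = a - b" for a b
    unfolding free_algebra_def by (rule monoid_algebra_diff[OF free_monoid]) simp
  show ?thesis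
    unfolding H_rels_def Let_def FA.alg_poly_linear[OF g] FA.alg_poly_quadratic[OF g] m
    by (simp add: free_algebra_def free_gen_def monoid_algebra_mult_add_left monoid_algebra_mult_add_right)
qed

text \<open>The relation for tx is the recursion of \<open>f_iter\<close>, the one for yt uses in
  addition that \<open>f_iter\<close> commutes with f, and the one for yx is the recursion of
  \<open>g_coeff\<close>: at position i the difference of yx and q xy multiplies by g_(i+1) - q g_i,
  which is g(f_i).\<close>

lemma act_H_rels: "H_rels q [:k, p:] [:e, d, c:] \<subseteq> {a. \<forall>F. act a F = \<zero>\<^bsub>poly_rep\<^esub>}"
  unfolding H_rels_eq
  by (auto simp: act_diff act_add act_single word_op_def fun_eq_iff algebra_simps
      pcompose_mult f_iter_pcompose pcompose_pCons smult_add_right split: nat.split)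

definition HI :: "(hgen list \<Rightarrow>\<^sub>0 'k) set" where
  "HI = genideal FA (H_rels q [:k, p:] [:e, d, c:])"

abbreviation "HQ \<equiv> H_alg q [:k, p:] [:e, d, c:]"

lemma H_eq: "HQ = alg_quot FA HI"
  by (simp add: H_alg_def HI_def)

lemma H_rels_carrier: "H_rels q [:k, p:] [:e, d, c:] \<subseteq> carrier FA"
  by (simp add: free_algebra_def)

lemma HI: "ideal HI FA"
  unfolding HI_def by (rule FA.genideal_ideal[OF H_rels_carrier])

lemma act_HI: "a \<in> HI \<Longrightarrow> act a F = \<zero>\<^bsub>poly_rep\<^esub>"
  using FA.genideal_minimal[OF act_zero_ideal act_H_rels] unfolding HI_def by blast

definition hcoset :: "(hgen list \<Rightarrow>\<^sub>0 'k) \<Rightarrow> (hgen list \<Rightarrow>\<^sub>0 'k) set" where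
  "hcoset a = HI +>\<^bsub>FA\<^esub> a"

text \<open>The element is applied to the family that represents 1, and the coefficient of x^i t^j
  y^l is read off from the result. Any representative of the coset serves because the ideal acts as
  zero.\<close>

definition coord :: "nat \<times> nat \<times> nat \<Rightarrow> (hgen list \<Rightarrow>\<^sub>0 'k) set \<Rightarrow> 'k" where
  "coord = (\<lambda>(i, j, l) X.
     the_elem ((\<lambda>a. coeff (act a (\<lambda>i l. if i = 0 \<and> l = 0 then 1 else 0) i l) j) ` X))"

lemma FA_carrier [simp]: "a \<in> carrier FA"
  by (simp add: free_algebra_def)

lemma coord_hcoset:
  "coord (i, j, l) (hcoset a) = coeff (act a (\<lambda>i l. if i = 0 \<and> l = 0 then 1 else 0) i l) j"
  unfolding coord_def prod.case
proof (rule the_elem_image_unique)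
  interpret ideal HI FA by (rule HI)
  show "hcoset a \<noteq> {}"
    unfolding hcoset_def using a_rcos_self[of a] by (rule ex_in_conv[THEN iffD1, OF exI]) simp
  fix b assume "b \<in> hcoset a"
  then obtain h where h: "h \<in> HI" "b = h \<oplus>\<^bsub>FA\<^esub> a"
    unfolding hcoset_def a_r_coset_def' by auto
  then have "b = h + a" by (simp add: free_algebra_def)
  then show "coeff (act b (\<lambda>i l. if i = 0 \<and> l = 0 then 1 else 0) i l) j
      = coeff (act a (\<lambda>i l. if i = 0 \<and> l = 0 then 1 else 0) i l) j"
    using act_HI[OF h(1)] by (simp add: act_add)
qed

lemma hcoset_closed: "hcoset a \<in> carrier HQ"
  unfolding H_eq hcoset_def by (rule alg_quot_carrierI[OF FA HI FA_carrier])

lemma H_carrierE: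
  assumes "X \<in> carrier HQ"
  obtains a where "X = hcoset a"
  using assms alg_quot_carrierE[OF FA HI] unfolding H_eq hcoset_def by metis

lemma hcoset_add: "hcoset a \<oplus>\<^bsub>HQ\<^esub> hcoset b = hcoset (a + b)"
  unfolding H_eq hcoset_def alg_quot_add[OF FA HI FA_carrier FA_carrier]
  by (simp add: free_algebra_def)

lemma hcoset_mult: "hcoset a \<otimes>\<^bsub>HQ\<^esub> hcoset b = hcoset (a \<otimes>\<^bsub>FA\<^esub> b)"
  unfolding H_eq hcoset_def by (rule alg_quot_mult[OF FA HI FA_carrier FA_carrier])

lemma hcoset_smult: "r \<odot>\<^bsub>HQ\<^esub> hcoset a = hcoset (Poly_Mapping.map ((*) r) a)"
  unfolding H_eq hcoset_def alg_quot_smult[OF FA HI FA_carrier] by (simp add: free_algebra_def)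

lemma hcoset_one: "\<one>\<^bsub>HQ\<^esub> = hcoset (Poly_Mapping.single [] 1)"
  unfolding H_eq hcoset_def alg_quot_simps[OF FA HI] by (simp add: free_algebra_def)

lemma hcoset_eqI: "a - b \<in> HI \<Longrightarrow> hcoset a = hcoset b"
  unfolding hcoset_def coset_eq_iff[OF FA HI FA_carrier FA_carrier]
  unfolding free_algebra_def by (simp add: monoid_algebra_diff[OF free_monoid])

lemma H_k_algebra: "k_algebra HQ"
  unfolding H_eq by (rule alg_quot_k_algebra[OF FA HI])

interpretation H: k_algebra HQ by (rule H_k_algebra)

abbreviation "hgen_el a \<equiv> hcoset (free_gen a)"

lemma hgen_pow: "hgen_el a [^]\<^bsub>HQ\<^esub> n = hcoset (Poly_Mapping.single (replicate n a) 1)"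
proof (induction n)
  case (Suc n)
  then show ?case
    by (simp add: hcoset_mult free_gen_def free_algebra_def replicate_append_same)
qed (simp add: hcoset_one)

text \<open>The letters y and t act while the family is still concentrated at i = 0. There
  \<open>f_iter 0\<close> is the variable, q^0 is 1 and the term with \<open>g_coeff\<close> meets
  only zero entries, so a monomial in normal order produces its own basis vector without
  corrections.\<close>

lemma act_pbw_word:
  "word_op (replicate i X_gen @ replicate j T_gen @ replicate l Y_gen) (\<lambda>i l. if i = 0 \<and> l = 0 then 1 else 0)
    = (\<lambda>i' l'. if i' = i \<and> l' = l then monom 1 j else 0)"
proof -
  have Y: "word_op (replicate l Y_gen) (\<lambda>i l. if i = 0 \<and> l = 0 then 1 else 0)
      = (\<lambda>i' l'. if i' = 0 \<and> l' = l then 1 else 0)"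
    by (induction l) (auto simp: word_op_def fun_eq_iff pcompose_1 split: nat.split)
  have T: "word_op (replicate j T_gen) (\<lambda>i' l'. if i' = 0 \<and> l' = l then 1 else 0)
      = (\<lambda>i' l'. if i' = 0 \<and> l' = l then monom 1 j else 0)"
    by (induction j) (auto simp: word_op_def fun_eq_iff monom_Suc)
  have "word_op (replicate i X_gen) (\<lambda>i' l'. if i' = 0 \<and> l' = l then monom 1 j else 0)
      = (\<lambda>i' l'. if i' = i \<and> l' = l then monom 1 j else 0)"
    by (induction i) (auto simp: word_op_def fun_eq_iff split: nat.split)
  then show ?thesis by (simp add: word_op_append Y T)
qed

lemma H_hq_algebra:
  "hq_algebra HQ (hgen_el X_gen) (hgen_el T_gen) (hgen_el Y_gen) p q k c d e coord"
proof (intro hq_algebra.intro hq_algebra_axioms.intro H_k_algebra hcoset_closed)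
  have rels: "a \<in> HI" if "a \<in> H_rels q [:k, p:] [:e, d, c:]" for a
    using FA.genideal_self[OF H_rels_carrier] that unfolding HI_def by blast
  show "hgen_el T_gen \<otimes>\<^bsub>HQ\<^esub> hgen_el X_gen =
      p \<odot>\<^bsub>HQ\<^esub> (hgen_el X_gen \<otimes>\<^bsub>HQ\<^esub> hgen_el T_gen) \<oplus>\<^bsub>HQ\<^esub> k \<odot>\<^bsub>HQ\<^esub> hgen_el X_gen"
    unfolding hcoset_mult hcoset_smult hcoset_add
    by (rule hcoset_eqI, rule rels) (simp add: H_rels_eq free_algebra_def free_gen_def)
  show "hgen_el Y_gen \<otimes>\<^bsub>HQ\<^esub> hgen_el T_gen =
      p \<odot>\<^bsub>HQ\<^esub> (hgen_el T_gen \<otimes>\<^bsub>HQ\<^esub> hgen_el Y_gen) \<oplus>\<^bsub>HQ\<^esub> k \<odot>\<^bsub>HQ\<^esub> hgen_el Y_gen"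
    unfolding hcoset_mult hcoset_smult hcoset_add
    by (rule hcoset_eqI, rule rels) (simp add: H_rels_eq free_algebra_def free_gen_def)
  show "hgen_el Y_gen \<otimes>\<^bsub>HQ\<^esub> hgen_el X_gen =
      q \<odot>\<^bsub>HQ\<^esub> (hgen_el X_gen \<otimes>\<^bsub>HQ\<^esub> hgen_el Y_gen) \<oplus>\<^bsub>HQ\<^esub>
      (e \<odot>\<^bsub>HQ\<^esub> \<one>\<^bsub>HQ\<^esub> \<oplus>\<^bsub>HQ\<^esub> d \<odot>\<^bsub>HQ\<^esub> hgen_el T_gen \<oplus>\<^bsub>HQ\<^esub> c \<odot>\<^bsub>HQ\<^esub> (hgen_el T_gen \<otimes>\<^bsub>HQ\<^esub> hgen_el T_gen))"
    unfolding hcoset_mult hcoset_smult hcoset_add hcoset_one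
    by (rule hcoset_eqI, rule rels) (simp add: H_rels_eq free_algebra_def free_gen_def algebra_simps)
  show "carrier HQ \<subseteq> S"
    if S: "S \<subseteq> carrier HQ" "\<zero>\<^bsub>HQ\<^esub> \<in> S" "\<one>\<^bsub>HQ\<^esub> \<in> S" "\<And>a b. a \<in> S \<Longrightarrow> b \<in> S \<Longrightarrow> a \<oplus>\<^bsub>HQ\<^esub> b \<in> S"
      "\<And>r a. a \<in> S \<Longrightarrow> r \<odot>\<^bsub>HQ\<^esub> a \<in> S" "\<And>a. a \<in> S \<Longrightarrow> hgen_el X_gen \<otimes>\<^bsub>HQ\<^esub> a \<in> S"
      "\<And>a. a \<in> S \<Longrightarrow> hgen_el T_gen \<otimes>\<^bsub>HQ\<^esub> a \<in> S" "\<And>a. a \<in> S \<Longrightarrow> hgen_el Y_gen \<otimes>\<^bsub>HQ\<^esub> a \<in> S" for S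
  proof
    have w: "hcoset (Poly_Mapping.single w 1) \<in> S" for w
    proof (induction w)
      case Nil
      then show ?case using S(3) by (simp add: hcoset_one)
    next
      case (Cons a w)
      have "hcoset (Poly_Mapping.single (a # w) 1) = hgen_el a \<otimes>\<^bsub>HQ\<^esub> hcoset (Poly_Mapping.single w 1)"
        by (simp add: hcoset_mult free_gen_def free_algebra_def)
      then show ?case using S(6-8) Cons by (cases a) simp_all
    qed
    fix X assume "X \<in> carrier HQ"
    then obtain a where X: "X = hcoset a" by (rule H_carrierE)
    have "Poly_Mapping.keys a \<subseteq> UNIV" by simp
    then have "hcoset a \<in> S"
    proof (induction rule: poly_mapping_restrict_induct)
      case zero
      have "hcoset 0 = \<zero>\<^bsub>HQ\<^esub>" using H.smult_zero_left[OF hcoset_closed[of 0]] by (simp add: hcoset_smult)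
      then show ?case using S(2) by simp
    next
      case (single w r)
      then show ?case using S(5)[OF w[of w], of r] by (simp add: hcoset_smult)
    next
      case (add a b)
      then show ?case using S(4)[of "hcoset a" "hcoset b"] by (simp add: hcoset_add)
    qed
    then show "X \<in> S" by (simp add: X)
  qed
  show "coord m (a \<oplus>\<^bsub>HQ\<^esub> b) = coord m a + coord m b" if "a \<in> carrier HQ" "b \<in> carrier HQ" for m a b
    using that by (cases m) (auto elim!: H_carrierE simp: hcoset_add coord_hcoset act_add)
  show "coord m (r \<odot>\<^bsub>HQ\<^esub> a) = r * coord m a" if "a \<in> carrier HQ" for m r a
    using that act_smult
    by (cases m) (auto elim!: H_carrierE simp: hcoset_smult coord_hcoset free_algebra_def)
  show "coord m (hgen_el X_gen [^]\<^bsub>HQ\<^esub> i \<otimes>\<^bsub>HQ\<^esub> (hgen_el T_gen [^]\<^bsub>HQ\<^esub> j \<otimes>\<^bsub>HQ\<^esub> hgen_el Y_gen [^]\<^bsub>HQ\<^esub> l))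
      = (if m = (i, j, l) then 1 else 0)" for m i j l
    by (cases m) (simp add: hgen_pow hcoset_mult free_algebra_def coord_hcoset act_single act_pbw_word)
qed

end


section \<open>Complexes of finitely generated free modules\<close>

text \<open>The first isomorphism theorem, in the form used for cohomology: \<open>M\<close> will be
  the cocycles and \<open>U\<close> the coboundaries, recognised as the kernel of an explicit map
  onto \<open>N\<close>.\<close>

lemma mod_quot_isomorphic:
  fixes M :: "('r, 'm) module" and N :: "('r, 'n) module"
  assumes M: "abelian_group M" and N: "abelian_group N"
    and \<psi>: "\<psi> \<in> mod_hom S M N" and onto: "\<psi> ` carrier M = carrier N"
    and act: "\<And>r x. r \<in> carrier S \<Longrightarrow> x \<in> carrier M \<Longrightarrow> r \<odot>\<^bsub>M\<^esub> x \<in> carrier M"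
    and U: "U = {x \<in> carrier M. \<psi> x = \<zero>\<^bsub>N\<^esub>}"
  shows "mod_isomorphic S (mod_quot M U) N"
proof -
  interpret M: abelian_group M by fact
  interpret N: abelian_group N by fact
  have \<psi>_closed: "\<psi> x \<in> carrier N" if "x \<in> carrier M" for x
    using \<psi> that by (auto simp: mod_hom_def)
  have \<psi>_add: "\<psi> (x \<oplus>\<^bsub>M\<^esub> y) = \<psi> x \<oplus>\<^bsub>N\<^esub> \<psi> y" if "x \<in> carrier M" "y \<in> carrier M" for x y
    using \<psi> that by (auto simp: mod_hom_def)
  have \<psi>_act: "\<psi> (r \<odot>\<^bsub>M\<^esub> x) = r \<odot>\<^bsub>N\<^esub> \<psi> x" if "r \<in> carrier S" "x \<in> carrier M" for r x
    using \<psi> that by (auto simp: mod_hom_def)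
  have hom: "abelian_group_hom M N \<psi>"
    by (intro abelian_group_homI group_hom.intro group_hom_axioms.intro M N M.a_group N.a_group)
      (use \<psi>_closed \<psi>_add in \<open>auto simp: hom_def\<close>)
  interpret h: abelian_group_hom M N \<psi> by (rule hom)
  have Uk: "U = a_kernel M N \<psi>"
    unfolding U a_kernel_def' ..
  interpret U: abelian_subgroup U M
    unfolding Uk by (rule h.abelian_subgroup_a_kernel)
  let ?c = "\<lambda>x. U +>\<^bsub>M\<^esub> x"
  have val: "\<psi> y = \<psi> x" if x: "x \<in> carrier M" and y: "y \<in> ?c x" for x y
  proof -
    obtain u where u: "u \<in> U" "y = u \<oplus>\<^bsub>M\<^esub> x"
      using y unfolding a_r_coset_def' by auto
    have "u \<in> carrier M" "\<psi> u = \<zero>\<^bsub>N\<^esub>" using u(1) unfolding U by auto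
    then show ?thesis using x u(2) \<psi>_add[of u x] \<psi>_closed[OF x] by simp
  qed
  have ceq: "?c x = ?c y \<longleftrightarrow> \<psi> x = \<psi> y" if "x \<in> carrier M" "y \<in> carrier M" for x y
  proof
    assume "?c x = ?c y"
    then have "x \<in> ?c y" using U.a_rcos_self[OF that(1)] by simp
    then show "\<psi> x = \<psi> y" by (rule val[OF that(2)])
  next
    assume eq: "\<psi> x = \<psi> y"
    have "x \<ominus>\<^bsub>M\<^esub> y \<in> U"
    proof -
      have "\<psi> (x \<ominus>\<^bsub>M\<^esub> y) = \<psi> x \<ominus>\<^bsub>N\<^esub> \<psi> y"
        using that \<psi>_add[of x "\<ominus>\<^bsub>M\<^esub> y"] h.hom_a_inv[OF that(2)] by (simp add: a_minus_def)
      then show ?thesis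
        unfolding U using that eq \<psi>_closed[OF that(2)] by (simp add: a_minus_def N.r_neg)
    qed
    moreover have "x = (x \<ominus>\<^bsub>M\<^esub> y) \<oplus>\<^bsub>M\<^esub> y"
      using that by (simp add: a_minus_def M.a_assoc M.l_neg)
    ultimately have "x \<in> ?c y" unfolding a_r_coset_def' by blast
    then show "?c x = ?c y" using U.a_repr_independence' that by metis
  qed
  define \<Phi> where "\<Phi> X = the_elem (\<psi> ` X)" for X
  have \<Phi>: "\<Phi> (?c x) = \<psi> x" if "x \<in> carrier M" for x
    unfolding \<Phi>_def
  proof (rule the_elem_image_unique)
    show "?c x \<noteq> {}" using U.a_rcos_self[OF that] by (rule ex_in_conv[THEN iffD1, OF exI])
  qed (rule val[OF that])
  have carrier: "carrier (mod_quot M U) = ?c ` carrier M"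
    unfolding mod_quot_def by (auto simp: A_RCOSETS_def')
  have add: "?c x \<oplus>\<^bsub>mod_quot M U\<^esub> ?c y = ?c (x \<oplus>\<^bsub>M\<^esub> y)" if "x \<in> carrier M" "y \<in> carrier M" for x y
    unfolding mod_quot_def using U.a_rcos_sum[OF that] by simp
  have sm: "r \<odot>\<^bsub>mod_quot M U\<^esub> ?c x = ?c (r \<odot>\<^bsub>M\<^esub> x)" if r: "r \<in> carrier S" and x: "x \<in> carrier M" for r x
  proof -
    have "?c (r \<odot>\<^bsub>M\<^esub> y) = ?c (r \<odot>\<^bsub>M\<^esub> x)" if y: "y \<in> ?c x" for y
    proof -
      have yc: "y \<in> carrier M" by (rule U.a_elemrcos_carrier[OF x y])
      show ?thesis
        unfolding ceq[OF act[OF r yc] act[OF r x]] \<psi>_act[OF r yc] \<psi>_act[OF r x] val[OF x y] ..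
    qed
    moreover have "?c x \<noteq> {}" using U.a_rcos_self[OF x] by (rule ex_in_conv[THEN iffD1, OF exI])
    ultimately show ?thesis
      unfolding mod_quot_def module.simps by (intro SUP_eq_const)
  qed
  have "\<Phi> \<in> mod_hom S (mod_quot M U) N"
    unfolding mod_hom_def carrier using \<psi>_closed
    by (auto simp: add sm \<Phi> act \<psi>_act \<psi>_add)
  moreover have "bij_betw \<Phi> (carrier (mod_quot M U)) (carrier N)"
    unfolding bij_betw_def carrier
  proof
    show "inj_on \<Phi> (?c ` carrier M)"
      by (rule inj_onI, elim imageE) (simp only: \<Phi> ceq)
    show "\<Phi> ` ?c ` carrier M = carrier N"
      unfolding onto[symmetric] image_image by (rule image_cong) (auto simp: \<Phi>)
  qed
  ultimately show ?thesis unfolding mod_isomorphic_def by blast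
qed

text \<open>Free left modules of rank \<open>N i\<close>; \<open>A i j l\<close> is the entry in row
  j and column l of the differential from degree i+1 to degree i. Left linearity forces the matrices
  to act on row vectors from the right. The map \<open>\<iota>\<close> places the basis in whatever
  index type the elements of a resolution are prescribed to have, and \<open>nontrivial\<close>
  keeps the unit vectors distinct.\<close>

locale matrix_complex = ring R for R :: "'r ring" (structure) +
  fixes \<iota> :: "nat \<Rightarrow> 'i" and N :: "nat \<Rightarrow> nat" and A :: "nat \<Rightarrow> nat \<Rightarrow> nat \<Rightarrow> 'r"
  assumes nontrivial: "\<one> \<noteq> \<zero>"
    and inj_\<iota>: "inj \<iota>"
    and A_closed [simp, intro]: "A i j l \<in> carrier R"
begin

lemma free_module_simps [simp]:
  "\<zero>\<^bsub>free_module R I\<^esub> = (\<lambda>i. \<zero>)" "f \<oplus>\<^bsub>free_module R I\<^esub> g = (\<lambda>i. f i \<oplus> g i)"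
  "r \<odot>\<^bsub>free_module R I\<^esub> f = (\<lambda>i. r \<otimes> f i)"
  by (simp_all add: free_module_def)

lemma free_module_carrier:
  "finite I \<Longrightarrow> f \<in> carrier (free_module R I) \<longleftrightarrow> (\<forall>i. f i \<in> carrier R) \<and> (\<forall>i. i \<notin> I \<longrightarrow> f i = \<zero>)"
  unfolding free_module_def by (auto intro: finite_subset[of _ I])

text \<open>Tuples of length n are padded with zeros, so that passing from a functional to its
  coordinates and back gives equalities of functions.\<close>

definition Vec :: "nat \<Rightarrow> (nat \<Rightarrow> 'r) set" where
  "Vec n = {r. (\<forall>l. r l \<in> carrier R) \<and> (\<forall>l\<ge>n. r l = \<zero>)}"

definition row :: "nat \<Rightarrow> (nat \<Rightarrow> 'r) \<Rightarrow> nat \<Rightarrow> 'r" where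
  "row i r l = (\<Oplus>j\<in>{..<N (Suc i)}. r j \<otimes> A i j l)"

definition col :: "nat \<Rightarrow> (nat \<Rightarrow> 'r) \<Rightarrow> nat \<Rightarrow> 'r" where
  "col i h j = (\<Oplus>l\<in>{..<N i}. A i j l \<otimes> h l)"

definition F :: "nat \<Rightarrow> ('r, 'i \<Rightarrow> 'r) module" where
  "F n = free_module R (\<iota> ` {..<n})"

definition vec :: "nat \<Rightarrow> (nat \<Rightarrow> 'r) \<Rightarrow> 'i \<Rightarrow> 'r" where
  "vec n r = (\<lambda>i. if i \<in> \<iota> ` {..<n} then r (inv_into UNIV \<iota> i) else \<zero>)"

definition unit_vec :: "nat \<Rightarrow> nat \<Rightarrow> 'i \<Rightarrow> 'r" where
  "unit_vec n j = vec n (\<lambda>l. if l = j then \<one> else \<zero>)"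

definition P :: "nat \<Rightarrow> ('r, 'i \<Rightarrow> 'r) module" where
  "P i = F (N i)"

definition D :: "nat \<Rightarrow> ('i \<Rightarrow> 'r) \<Rightarrow> 'i \<Rightarrow> 'r" where
  "D i f = vec (N i) (row i (f \<circ> \<iota>))"

lemma F_simps [simp]:
  "\<zero>\<^bsub>F n\<^esub> = (\<lambda>i. \<zero>)" "f \<oplus>\<^bsub>F n\<^esub> g = (\<lambda>i. f i \<oplus> g i)" "r \<odot>\<^bsub>F n\<^esub> f = (\<lambda>i. r \<otimes> f i)"
  by (simp_all add: F_def)

lemma F_carrier: "f \<in> carrier (F n) \<longleftrightarrow> (\<forall>i. f i \<in> carrier R) \<and> (\<forall>i. i \<notin> \<iota> ` {..<n} \<longrightarrow> f i = \<zero>)"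
  unfolding F_def by (simp add: free_module_carrier)

lemma F_ext:
  assumes "f \<in> carrier (F n)" "g \<in> carrier (F n)" "\<And>j. j < n \<Longrightarrow> f (\<iota> j) = g (\<iota> j)"
  shows "f = g"
proof
  fix i show "f i = g i"
    by (cases "i \<in> \<iota> ` {..<n}") (use assms in \<open>auto simp: F_carrier\<close>)
qed

lemma vec_app: "vec n r (\<iota> j) = (if j < n then r j else \<zero>)"
  using inj_\<iota> by (auto simp: vec_def inj_image_mem_iff)

lemma vec_closed: "(\<And>l. l < n \<Longrightarrow> r l \<in> carrier R) \<Longrightarrow> vec n r \<in> carrier (F n)"
  using inj_\<iota> by (auto simp: F_carrier vec_def)

lemma unit_vec_closed [simp, intro]: "unit_vec n j \<in> carrier (F n)"
  unfolding unit_vec_def by (rule vec_closed) simp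

lemma unit_vec_app: "j < n \<Longrightarrow> unit_vec n j (\<iota> l) = (if l = j then \<one> else \<zero>)"
  by (auto simp: unit_vec_def vec_app)

lemma F_comp: "f \<in> carrier (F n) \<Longrightarrow> f \<circ> \<iota> \<in> Vec n"
  using inj_\<iota> by (auto simp: F_carrier Vec_def inj_image_mem_iff)

lemma vec_comp: "f \<in> carrier (F n) \<Longrightarrow> vec n (f \<circ> \<iota>) = f"
  by (rule F_ext[of _ n]) (simp_all add: vec_app vec_closed F_carrier[of f])

lemma Vec_closed: "r \<in> Vec n \<Longrightarrow> r l \<in> carrier R"
  by (simp add: Vec_def)

lemma row_closed: "r \<in> Vec n \<Longrightarrow> row i r l \<in> carrier R"
  unfolding row_def by (auto intro!: finsum_closed simp: Vec_def)

lemma F_left_module: "left_module R (F n)"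
proof (intro left_module.intro left_module_axioms.intro abelian_groupI)
  fix f assume "f \<in> carrier (F n)"
  then show "\<exists>g\<in>carrier (F n). g \<oplus>\<^bsub>F n\<^esub> f = \<zero>\<^bsub>F n\<^esub>"
    by (intro bexI[of _ "\<lambda>i. \<ominus> f i"]) (auto simp: F_carrier l_neg)
qed (auto simp: F_carrier local.ring_axioms a_ac l_distr r_distr m_assoc)

text \<open>In \<open>projective\<close> the free module must be indexed by elements of the module
  itself. The basis is therefore relabelled by the indicator functions \<open>\<kappa> i\<close>,
  which are distinct because 1 differs from 0; \<open>s\<close> and \<open>\<pi>\<close> are the
  relabelling and its inverse on the relevant indices.\<close>

lemma F_projective: "projective R (F n)"
proof -
  let ?I = "\<iota> ` {..<n}"
  define \<kappa> where "\<kappa> i = (\<lambda>j. if j = i then \<one> else \<zero>)" for i :: 'i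
  have inj: "inj \<kappa>"
    by (rule injI) (metis \<kappa>_def nontrivial)
  have "finite (\<kappa> ` ?I)" by simp
  note carr = free_module_carrier[OF this]
  define s where "s f = (\<lambda>x. if x \<in> \<kappa> ` ?I then f (inv_into UNIV \<kappa> x) else \<zero>)" for f :: "'i \<Rightarrow> 'r"
  define \<pi> where "\<pi> g = (\<lambda>i. if i \<in> ?I then g (\<kappa> i) else \<zero>)" for g :: "('i \<Rightarrow> 'r) \<Rightarrow> 'r"
  have "s \<in> mod_hom R (F n) (free_module R (\<kappa> ` ?I))"
    unfolding mod_hom_def by (auto simp: s_def F_carrier carr)
  moreover have "\<pi> \<in> mod_hom R (free_module R (\<kappa> ` ?I)) (F n)"
    unfolding mod_hom_def by (auto simp: \<pi>_def F_carrier carr)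
  moreover have "\<pi> (s f) = f" if "f \<in> carrier (F n)" for f
    using that inj by (auto simp: \<pi>_def s_def F_carrier)
  ultimately show ?thesis
    unfolding projective_def using F_left_module by blast
qed

text \<open>The truncations \<open>t m\<close> of \<open>f\<close> to its first m coordinates grow
  by one multiple of a unit vector at a time, so additivity of \<open>h\<close> builds up the sum
  term by term until \<open>t n\<close> is \<open>f\<close>.\<close>

lemma hom_expand:
  assumes X: "left_module R X" and h: "h \<in> mod_hom R (F n) X" and f: "f \<in> carrier (F n)"
  shows "h f = (\<Oplus>\<^bsub>X\<^esub>j\<in>{..<n}. f (\<iota> j) \<odot>\<^bsub>X\<^esub> h (unit_vec n j))"
proof -
  interpret X: left_module R X by fact
  have hc: "h v \<in> carrier X" if "v \<in> carrier (F n)" for v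
    using h that by (auto simp: mod_hom_def)
  have fc: "f i \<in> carrier R" for i using f by (simp add: F_carrier)
  define t where "t m = vec n (\<lambda>l. if l < m then f (\<iota> l) else \<zero>)" for m
  have tc: "t m \<in> carrier (F n)" for m
    unfolding t_def by (rule vec_closed) (simp add: fc)
  have h0: "h (\<lambda>i. \<zero>) = \<zero>\<^bsub>X\<^esub>"
  proof -
    have z: "(\<lambda>i. \<zero>) \<in> carrier (F n)" by (simp add: F_carrier)
    have "h ((\<lambda>i. \<zero>) \<oplus>\<^bsub>F n\<^esub> (\<lambda>i. \<zero>)) = h (\<lambda>i. \<zero>) \<oplus>\<^bsub>X\<^esub> h (\<lambda>i. \<zero>)"
      using h z unfolding mod_hom_def by blast
    then show ?thesis using hc[OF z] by simp
  qed
  have "h (t m) = (\<Oplus>\<^bsub>X\<^esub>j\<in>{..<m}. f (\<iota> j) \<odot>\<^bsub>X\<^esub> h (unit_vec n j))" if "m \<le> n" for m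
    using that
  proof (induction m)
    case 0
    have "t 0 = (\<lambda>i. \<zero>)" by (simp add: t_def vec_def)
    then show ?case by (simp add: h0)
  next
    case (Suc m)
    have sc: "f (\<iota> m) \<odot>\<^bsub>F n\<^esub> unit_vec n m \<in> carrier (F n)"
      using unit_vec_closed[of n m] fc by (auto simp: F_carrier)
    have "t (Suc m) = t m \<oplus>\<^bsub>F n\<^esub> f (\<iota> m) \<odot>\<^bsub>F n\<^esub> unit_vec n m"
    proof (rule F_ext[OF tc])
      show "t m \<oplus>\<^bsub>F n\<^esub> f (\<iota> m) \<odot>\<^bsub>F n\<^esub> unit_vec n m \<in> carrier (F n)"
        using tc[of m] unit_vec_closed[of n m] fc by (auto simp: F_carrier)
      fix j assume "j < n"
      then show "t (Suc m) (\<iota> j) = (t m \<oplus>\<^bsub>F n\<^esub> f (\<iota> m) \<odot>\<^bsub>F n\<^esub> unit_vec n m) (\<iota> j)"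
        using Suc.prems fc by (auto simp: t_def vec_app unit_vec_app less_Suc_eq)
    qed
    moreover have "h (t m \<oplus>\<^bsub>F n\<^esub> f (\<iota> m) \<odot>\<^bsub>F n\<^esub> unit_vec n m)
        = h (t m) \<oplus>\<^bsub>X\<^esub> h (f (\<iota> m) \<odot>\<^bsub>F n\<^esub> unit_vec n m)"
      using h tc[of m] sc unfolding mod_hom_def by blast
    moreover have "h (f (\<iota> m) \<odot>\<^bsub>F n\<^esub> unit_vec n m) = f (\<iota> m) \<odot>\<^bsub>X\<^esub> h (unit_vec n m)"
      using h fc unit_vec_closed[of n m] unfolding mod_hom_def by blast
    ultimately have "h (t (Suc m)) = h (t m) \<oplus>\<^bsub>X\<^esub> f (\<iota> m) \<odot>\<^bsub>X\<^esub> h (unit_vec n m)"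
      by (simp del: F_simps)
    then show ?case
      using Suc hc fc by (simp add: lessThan_Suc X.M.finsum_insert X.act_closed X.M.a_comm)
  qed
  moreover have "t n = f"
    by (rule F_ext[OF tc f]) (simp add: t_def vec_app)
  ultimately show ?thesis by auto
qed

lemma F_fin_gen: "fin_gen R (F n)"
proof -
  interpret X: left_module R "F n" by (rule F_left_module)
  let ?e = "unit_vec n"
  have inj: "inj_on ?e {..<n}"
  proof (rule inj_onI)
    fix j l assume "j \<in> {..<n}" "l \<in> {..<n}" "?e j = ?e l"
    then show "j = l" using unit_vec_app[of j n j] unit_vec_app[of l n j] nontrivial by (auto split: if_splits)
  qed
  show ?thesis
    unfolding fin_gen_def
  proof (intro exI[of _ "?e ` {..<n}"] conjI ballI)
    fix f assume f: "f \<in> carrier (F n)"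
    \<comment> \<open>Coefficients have to be indexed by the generators themselves, so the
      coordinate is recovered from the unit vector by inverting j \<mapsto>
      \<open>unit_vec n j\<close>.\<close>
    define c where "c v = f (\<iota> (inv_into {..<n} ?e v))" for v
    have c: "c v \<in> carrier R" for v using f by (simp add: c_def F_carrier)
    \<comment> \<open>Expanding the identity map along the unit vectors says that they
      generate.\<close>
    have "(\<lambda>v. v) \<in> mod_hom R (F n) (F n)" by (auto simp: mod_hom_def)
    from hom_expand[OF F_left_module this f]
    have "f = (\<Oplus>\<^bsub>F n\<^esub>j\<in>{..<n}. f (\<iota> j) \<odot>\<^bsub>F n\<^esub> ?e j)" .
    also have "\<dots> = (\<Oplus>\<^bsub>F n\<^esub>j\<in>{..<n}. c (?e j) \<odot>\<^bsub>F n\<^esub> ?e j)"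
      using f unit_vec_closed[of n]
      by (intro X.M.finsum_cong') (auto simp: c_def inv_into_f_f[OF inj] F_carrier)
    also have "\<dots> = (\<Oplus>\<^bsub>F n\<^esub>v\<in>?e ` {..<n}. c v \<odot>\<^bsub>F n\<^esub> v)"
      by (rule X.M.finsum_reindex[symmetric, OF _ inj]) (use c X.act_closed in auto)
    finally show "\<exists>c. c \<in> ?e ` {..<n} \<rightarrow> carrier R \<and> f = (\<Oplus>\<^bsub>F n\<^esub>v\<in>?e ` {..<n}. c v \<odot>\<^bsub>F n\<^esub> v)"
      using c by (intro exI[of _ c]) auto
  qed auto
qed

lemma row_cong: "(\<And>j. j < N (Suc i) \<Longrightarrow> r j = s j) \<Longrightarrow> s \<in> Vec n \<Longrightarrow> row i r l = row i s l"
  unfolding row_def by (rule finsum_cong') (auto simp: Vec_def)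

lemma row_add: "r \<in> Vec n \<Longrightarrow> s \<in> Vec n \<Longrightarrow> row i (\<lambda>j. r j \<oplus> s j) l = row i r l \<oplus> row i s l"
  unfolding row_def by (subst finsum_addf[symmetric]) (auto simp: Vec_def l_distr intro!: finsum_cong')

lemma row_mult: "r \<in> Vec n \<Longrightarrow> a \<in> carrier R \<Longrightarrow> row i (\<lambda>j. a \<otimes> r j) l = a \<otimes> row i r l"
  unfolding row_def by (subst finsum_rdistr) (auto simp: Vec_def m_assoc intro!: finsum_cong')

lemma P_simps [simp]:
  "\<zero>\<^bsub>P n\<^esub> = (\<lambda>i. \<zero>)" "f \<oplus>\<^bsub>P n\<^esub> g = (\<lambda>i. f i \<oplus> g i)" "r \<odot>\<^bsub>P n\<^esub> f = (\<lambda>i. r \<otimes> f i)"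
  by (simp_all add: P_def)

lemma D_closed: "f \<in> carrier (P (Suc i)) \<Longrightarrow> D i f \<in> carrier (P i)"
  unfolding P_def D_def by (intro vec_closed row_closed F_comp)

lemma D_app: "l < N i \<Longrightarrow> D i f (\<iota> l) = row i (f \<circ> \<iota>) l"
  by (simp add: D_def vec_app)

lemma D_hom: "D i \<in> mod_hom R (P (Suc i)) (P i)"
  unfolding mod_hom_def
proof (intro CollectI conjI ballI Pi_I)
  fix f assume f: "f \<in> carrier (P (Suc i))"
  then show "D i f \<in> carrier (P i)" by (rule D_closed)
  fix g assume g: "g \<in> carrier (P (Suc i))"
  have "row i ((\<lambda>i. f i \<oplus> g i) \<circ> \<iota>) l = row i (f \<circ> \<iota>) l \<oplus> row i (g \<circ> \<iota>) l" for l
    using row_add[OF F_comp F_comp] f g by (simp add: P_def o_def)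
  then show "D i (f \<oplus>\<^bsub>P (Suc i)\<^esub> g) = D i f \<oplus>\<^bsub>P i\<^esub> D i g"
    by (auto simp: D_def vec_def)
next
  fix r f assume r: "r \<in> carrier R" and f: "f \<in> carrier (P (Suc i))"
  have "row i ((\<lambda>i. r \<otimes> f i) \<circ> \<iota>) l = r \<otimes> row i (f \<circ> \<iota>) l" for l
    using row_mult[OF F_comp] r f by (simp add: P_def o_def)
  then show "D i (r \<odot>\<^bsub>P (Suc i)\<^esub> f) = r \<odot>\<^bsub>P i\<^esub> D i f"
    using r by (auto simp: D_def vec_def)
qed

lemma D_unit_vec:
  assumes "j < N (Suc i)"
  shows "D i (unit_vec (N (Suc i)) j) = vec (N i) (A i j)"
proof (rule F_ext[of _ "N i"])
  show "D i (unit_vec (N (Suc i)) j) \<in> carrier (F (N i))"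
    using D_closed[of _ i] by (simp add: P_def)
  show "vec (N i) (A i j) \<in> carrier (F (N i))" by (rule vec_closed) simp
  fix l assume l: "l < N i"
  have "row i (unit_vec (N (Suc i)) j \<circ> \<iota>) l = (\<Oplus>m\<in>{..<N (Suc i)}. if j = m then A i m l else \<zero>)"
    unfolding row_def by (rule finsum_cong') (auto simp: unit_vec_app assms)
  also have "\<dots> = A i j l"
    by (rule add.finprod_singleton) (use assms in auto)
  finally show "D i (unit_vec (N (Suc i)) j) (\<iota> l) = vec (N i) (A i j) (\<iota> l)"
    using l by (simp add: D_app vec_app)
qed

text \<open>Turns exactness into solvability of linear systems. The hypotheses are equivalences, so
  they contain both inclusions: consecutive maps compose to zero, and every cycle is a
  boundary.\<close>

lemma proj_resolution:
  assumes X: "left_module R X" and \<epsilon>: "\<epsilon> \<in> mod_hom R (P 0) X"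
    and onto: "\<epsilon> ` carrier (P 0) = carrier X"
    and exact0: "\<And>r. r \<in> Vec (N 0) \<Longrightarrow>
      \<epsilon> (vec (N 0) r) = \<zero>\<^bsub>X\<^esub> \<longleftrightarrow> (\<exists>s\<in>Vec (N (Suc 0)). \<forall>l<N 0. r l = row 0 s l)"
    and exact: "\<And>i r. r \<in> Vec (N (Suc i)) \<Longrightarrow>
      (\<forall>l<N i. row i r l = \<zero>) \<longleftrightarrow> (\<exists>s\<in>Vec (N (Suc (Suc i))). \<forall>l<N (Suc i). r l = row (Suc i) s l)"
  shows "proj_resolution R X P D \<epsilon>"
proof -
  have im: "f \<in> D i ` carrier (P (Suc i)) \<longleftrightarrow> (\<exists>s\<in>Vec (N (Suc i)). \<forall>l<N i. (f \<circ> \<iota>) l = row i s l)"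
    if f: "f \<in> carrier (P i)" for i f
  proof
    assume "f \<in> D i ` carrier (P (Suc i))"
    then obtain g where g: "g \<in> carrier (P (Suc i))" "f = D i g" by blast
    then show "\<exists>s\<in>Vec (N (Suc i)). \<forall>l<N i. (f \<circ> \<iota>) l = row i s l"
      by (intro bexI[of _ "g \<circ> \<iota>"]) (auto simp: D_app P_def intro: F_comp)
  next
    assume "\<exists>s\<in>Vec (N (Suc i)). \<forall>l<N i. (f \<circ> \<iota>) l = row i s l"
    then obtain s where s: "s \<in> Vec (N (Suc i))" "\<And>l. l < N i \<Longrightarrow> f (\<iota> l) = row i s l" by auto
    let ?g = "vec (N (Suc i)) s"
    have g: "?g \<in> carrier (P (Suc i))" unfolding P_def by (rule vec_closed) (use s in \<open>simp add: Vec_def\<close>)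
    have "f = D i ?g"
    proof (rule F_ext[of _ "N i"])
      show "f \<in> carrier (F (N i))" using f by (simp add: P_def)
      show "D i ?g \<in> carrier (F (N i))" using D_closed[OF g] by (simp add: P_def)
      show "f (\<iota> j) = D i ?g (\<iota> j)" if "j < N i" for j
        using that s(2)[OF that] row_cong[of i "?g \<circ> \<iota>" s] s(1) by (simp add: D_app vec_app)
    qed
    then show "f \<in> D i ` carrier (P (Suc i))" using g by blast
  qed
  have ker: "D i f = \<zero>\<^bsub>P i\<^esub> \<longleftrightarrow> (\<forall>l<N i. row i (f \<circ> \<iota>) l = \<zero>)" if "f \<in> carrier (P (Suc i))" for i f
  proof
    assume "D i f = \<zero>\<^bsub>P i\<^esub>"
    then show "\<forall>l<N i. row i (f \<circ> \<iota>) l = \<zero>" by (auto simp: D_app[symmetric])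
  next
    assume *: "\<forall>l<N i. row i (f \<circ> \<iota>) l = \<zero>"
    show "D i f = \<zero>\<^bsub>P i\<^esub>"
      by (rule F_ext[of _ "N i"])
        (use * D_closed[OF that] in \<open>auto simp: D_app P_def, auto simp: F_carrier\<close>)
  qed
  have "{f \<in> carrier (P 0). \<epsilon> f = \<zero>\<^bsub>X\<^esub>} = D 0 ` carrier (P 1)"
  proof (intro equalityI subsetI)
    fix f assume f: "f \<in> {f \<in> carrier (P 0). \<epsilon> f = \<zero>\<^bsub>X\<^esub>}"
    then have f0: "f \<in> carrier (F (N 0))" by (simp add: P_def)
    then show "f \<in> D 0 ` carrier (P 1)"
      using f im[of f 0] exact0[OF F_comp[OF f0]] vec_comp[OF f0] by simp
  next
    fix f assume f: "f \<in> D 0 ` carrier (P 1)"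
    then have f1: "f \<in> carrier (P 0)" using D_closed by auto
    then have f0: "f \<in> carrier (F (N 0))" by (simp add: P_def)
    then show "f \<in> {f \<in> carrier (P 0). \<epsilon> f = \<zero>\<^bsub>X\<^esub>}"
      using f f1 im[of f 0] exact0[OF F_comp[OF f0]] vec_comp[OF f0] by simp
  qed
  moreover have "{f \<in> carrier (P (Suc i)). D i f = \<zero>\<^bsub>P i\<^esub>} = D (Suc i) ` carrier (P (Suc (Suc i)))" for i
  proof (intro equalityI subsetI)
    fix f assume f: "f \<in> {f \<in> carrier (P (Suc i)). D i f = \<zero>\<^bsub>P i\<^esub>}"
    then have f0: "f \<in> carrier (F (N (Suc i)))" by (simp add: P_def)
    show "f \<in> D (Suc i) ` carrier (P (Suc (Suc i)))"
      using f im[of f "Suc i"] ker[of f i] exact[OF F_comp[OF f0]] by simp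
  next
    fix f assume f: "f \<in> D (Suc i) ` carrier (P (Suc (Suc i)))"
    then have f1: "f \<in> carrier (P (Suc i))" using D_closed by auto
    then have f0: "f \<in> carrier (F (N (Suc i)))" by (simp add: P_def)
    show "f \<in> {f \<in> carrier (P (Suc i)). D i f = \<zero>\<^bsub>P i\<^esub>}"
      using f f1 im[of f "Suc i"] ker[of f i] exact[OF F_comp[OF f0]] by simp
  qed
  ultimately show ?thesis
    unfolding proj_resolution_def using X \<epsilon> onto D_hom F_projective by (simp add: P_def)
qed

lemma P_fin_gen: "fin_gen R (P i)"
  unfolding P_def by (rule F_fin_gen)

lemma P_trivial: "N i = 0 \<Longrightarrow> carrier (P i) = {\<zero>\<^bsub>P i\<^esub>}"
  by (auto simp: P_def F_carrier)

subsection \<open>The dual complex\<close>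

lemma regular_left_module: "left_module R (regular_module R)"
  by (intro left_module.intro left_module_axioms.intro abelian_group_cong[OF abelian_group_axioms])
    (auto simp: regular_module_def l_distr r_distr m_assoc local.ring_axioms)

lemma regular_simps [simp]:
  "carrier (regular_module R) = carrier R" "\<zero>\<^bsub>regular_module R\<^esub> = \<zero>"
  "a \<oplus>\<^bsub>regular_module R\<^esub> b = a \<oplus> b" "a \<odot>\<^bsub>regular_module R\<^esub> b = a \<otimes> b"
  by (simp_all add: regular_module_def)

lemma finsum_regular [simp]: "finsum (regular_module R) f S = finsum R f S"
  by (simp add: finsum_def finprod_def regular_module_def)

text \<open>A left linear map on a free left module has its coefficients on the right, so the right
  module structure of the dual becomes right multiplication of the column \<open>h\<close>. The
  restriction to the carrier matches the extensional functions in
  \<open>dual_module\<close>.\<close>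

definition functional :: "nat \<Rightarrow> (nat \<Rightarrow> 'r) \<Rightarrow> ('i \<Rightarrow> 'r) \<Rightarrow> 'r" where
  "functional n h = (\<lambda>f\<in>carrier (F n). \<Oplus>l\<in>{..<n}. f (\<iota> l) \<otimes> h l)"

definition coords :: "nat \<Rightarrow> (('i \<Rightarrow> 'r) \<Rightarrow> 'r) \<Rightarrow> nat \<Rightarrow> 'r" where
  "coords n g = (\<lambda>l. if l < n then g (unit_vec n l) else \<zero>)"

lemma dual_simps [simp]:
  "\<zero>\<^bsub>dual_module R M\<^esub> = (\<lambda>x\<in>carrier M. \<zero>)"
  "g \<oplus>\<^bsub>dual_module R M\<^esub> h = (\<lambda>x\<in>carrier M. g x \<oplus> h x)"
  "r \<odot>\<^bsub>dual_module R M\<^esub> h = (\<lambda>x\<in>carrier M. h x \<otimes> r)"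
  by (simp_all add: dual_module_def)

lemma dual_carrier:
  "g \<in> carrier (dual_module R (F n)) \<longleftrightarrow> g \<in> mod_hom R (F n) (regular_module R) \<and> g \<in> extensional (carrier (F n))"
  by (simp add: dual_module_def)

lemma functional_closed:
  assumes "h \<in> Vec n"
  shows "functional n h \<in> carrier (dual_module R (F n))"
proof -
  interpret X: left_module R "F n" by (rule F_left_module)
  have *: "functional n h f = (\<Oplus>l\<in>{..<n}. f (\<iota> l) \<otimes> h l)" if "f \<in> carrier (F n)" for f
    using that by (simp add: functional_def)
  have "functional n h \<in> mod_hom R (F n) (regular_module R)"
    unfolding mod_hom_def
  proof (intro CollectI conjI ballI Pi_I)
    fix f assume f: "f \<in> carrier (F n)"
    then show "functional n h f \<in> carrier (regular_module R)"
      using assms by (auto simp: Vec_def * F_carrier intro!: finsum_closed)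
    fix g assume g: "g \<in> carrier (F n)"
    have "(\<Oplus>l\<in>{..<n}. (f (\<iota> l) \<oplus> g (\<iota> l)) \<otimes> h l) = (\<Oplus>l\<in>{..<n}. f (\<iota> l) \<otimes> h l \<oplus> g (\<iota> l) \<otimes> h l)"
      using f g assms by (intro finsum_cong') (auto simp: Vec_def F_carrier l_distr)
    also have "\<dots> = functional n h f \<oplus> functional n h g"
      using f g assms by (auto simp: Vec_def * F_carrier intro!: finsum_addf)
    finally show "functional n h (f \<oplus>\<^bsub>F n\<^esub> g) = functional n h f \<oplus>\<^bsub>regular_module R\<^esub> functional n h g"
      using *[OF X.M.a_closed[OF f g]] by simp
  next
    fix r f assume r: "r \<in> carrier R" and f: "f \<in> carrier (F n)"
    have "(\<Oplus>l\<in>{..<n}. (r \<otimes> f (\<iota> l)) \<otimes> h l) = (\<Oplus>l\<in>{..<n}. r \<otimes> (f (\<iota> l) \<otimes> h l))"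
      using f r assms by (intro finsum_cong') (auto simp: Vec_def F_carrier m_assoc)
    also have "\<dots> = r \<otimes> functional n h f"
      using f r assms by (auto simp: Vec_def * F_carrier intro!: finsum_rdistr[symmetric])
    finally show "functional n h (r \<odot>\<^bsub>F n\<^esub> f) = r \<odot>\<^bsub>regular_module R\<^esub> functional n h f"
      using *[OF X.act_closed[OF r f]] by simp
  qed
  then show ?thesis by (simp add: dual_carrier functional_def)
qed

lemma dual_app: "g \<in> carrier (dual_module R (F n)) \<Longrightarrow> f \<in> carrier (F n) \<Longrightarrow> g f \<in> carrier R"
  unfolding dual_carrier mod_hom_def regular_simps by blast

lemma coords_Vec:
  assumes "g \<in> carrier (dual_module R (F n))"
  shows "coords n g \<in> Vec n"
  using dual_app[OF assms unit_vec_closed] by (simp add: coords_def Vec_def)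

lemma functional_coords:
  assumes g: "g \<in> carrier (dual_module R (F n))"
  shows "functional n (coords n g) = g"
proof (rule extensionalityI[of _ "carrier (F n)"])
  fix f assume f: "f \<in> carrier (F n)"
  have "g f = (\<Oplus>j\<in>{..<n}. f (\<iota> j) \<otimes> g (unit_vec n j))"
    using hom_expand[OF regular_left_module _ f] g by (simp add: dual_carrier)
  also have "\<dots> = (\<Oplus>j\<in>{..<n}. f (\<iota> j) \<otimes> coords n g j)"
  proof (rule finsum_cong')
    show "(\<lambda>j. f (\<iota> j) \<otimes> coords n g j) \<in> {..<n} \<rightarrow> carrier R"
      using f Vec_closed[OF coords_Vec[OF g]] by (auto simp: F_carrier)
  qed (simp_all add: coords_def)
  finally show "functional n (coords n g) f = g f" using f by (simp add: functional_def)
qed (use g in \<open>auto simp: functional_def dual_carrier\<close>)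

lemma coords_functional:
  assumes h: "h \<in> Vec n"
  shows "coords n (functional n h) = h"
proof
  fix j
  show "coords n (functional n h) j = h j"
  proof (cases "j < n")
    case True
    have "functional n h (unit_vec n j) = (\<Oplus>l\<in>{..<n}. unit_vec n j (\<iota> l) \<otimes> h l)"
      by (simp add: functional_def)
    also have "\<dots> = (\<Oplus>l\<in>{..<n}. if j = l then h l else \<zero>)"
      by (rule finsum_cong') (use h True in \<open>auto simp: unit_vec_app Vec_def\<close>)
    also have "\<dots> = h j"
      by (rule add.finprod_singleton) (use h True in \<open>auto simp: Vec_def\<close>)
    finally show ?thesis using True by (simp add: coords_def)
  qed (use h in \<open>auto simp: coords_def Vec_def\<close>)
qed

lemma dual_eq_iff:
  assumes "g \<in> carrier (dual_module R (F n))" "h \<in> carrier (dual_module R (F n))"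
  shows "g = h \<longleftrightarrow> (\<forall>l<n. coords n g l = coords n h l)"
proof
  assume "\<forall>l<n. coords n g l = coords n h l"
  then have "coords n g = coords n h" by (auto simp: coords_def)
  then show "g = h" using assms functional_coords by metis
qed simp

definition pullback :: "nat \<Rightarrow> (('i \<Rightarrow> 'r) \<Rightarrow> 'r) \<Rightarrow> ('i \<Rightarrow> 'r) \<Rightarrow> 'r" where
  "pullback i g = (\<lambda>f\<in>carrier (P (Suc i)). g (D i f))"

lemma pullback_closed:
  assumes "g \<in> carrier (dual_module R (P i))"
  shows "pullback i g \<in> carrier (dual_module R (P (Suc i)))"
proof -
  interpret X: left_module R "P (Suc i)" unfolding P_def by (rule F_left_module)
  have g: "g \<in> mod_hom R (P i) (regular_module R)" using assms by (simp add: dual_module_def)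
  have "pullback i g \<in> mod_hom R (P (Suc i)) (regular_module R)"
    unfolding mod_hom_def
  proof (intro CollectI conjI ballI Pi_I)
    fix f assume f: "f \<in> carrier (P (Suc i))"
    then show "pullback i g f \<in> carrier (regular_module R)"
      using dual_app[of g "N i" "D i f"] assms D_closed[OF f] by (simp add: pullback_def P_def)
    fix f' assume f': "f' \<in> carrier (P (Suc i))"
    have "D i (f \<oplus>\<^bsub>P (Suc i)\<^esub> f') = D i f \<oplus>\<^bsub>P i\<^esub> D i f'"
      using D_hom f f' unfolding mod_hom_def by blast
    then show "pullback i g (f \<oplus>\<^bsub>P (Suc i)\<^esub> f') = pullback i g f \<oplus>\<^bsub>regular_module R\<^esub> pullback i g f'"
      using g D_closed[OF f] D_closed[OF f'] X.M.a_closed[OF f f'] f f'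
      unfolding mod_hom_def pullback_def by (simp del: P_simps regular_simps)
  next
    fix r f assume r: "r \<in> carrier R" and f: "f \<in> carrier (P (Suc i))"
    have "D i (r \<odot>\<^bsub>P (Suc i)\<^esub> f) = r \<odot>\<^bsub>P i\<^esub> D i f"
      using D_hom f r unfolding mod_hom_def by blast
    then show "pullback i g (r \<odot>\<^bsub>P (Suc i)\<^esub> f) = r \<odot>\<^bsub>regular_module R\<^esub> pullback i g f"
      using g D_closed[OF f] X.act_closed[OF r f] f r
      unfolding mod_hom_def pullback_def by (simp del: P_simps regular_simps)
  qed
  then show ?thesis by (simp add: dual_module_def pullback_def)
qed

text \<open>The j-th coordinate is the value at the image of the j-th unit vector, that is at row j
  of the matrix. Hence the dual differential is the same matrix, now acting on columns from the
  left.\<close>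

lemma coords_pullback:
  assumes g: "g \<in> carrier (dual_module R (P i))" and j: "j < N (Suc i)"
  shows "coords (N (Suc i)) (pullback i g) j = col i (coords (N i) g) j"
proof -
  have g': "g \<in> carrier (dual_module R (F (N i)))" using g by (simp add: P_def)
  have v: "vec (N i) (A i j) \<in> carrier (F (N i))" by (rule vec_closed) simp
  have "coords (N (Suc i)) (pullback i g) j = g (vec (N i) (A i j))"
    using j D_unit_vec[OF j] by (simp add: coords_def pullback_def P_def)
  also have "\<dots> = functional (N i) (coords (N i) g) (vec (N i) (A i j))"
    using functional_coords[OF g'] by simp
  also have "\<dots> = (\<Oplus>l\<in>{..<N i}. vec (N i) (A i j) (\<iota> l) \<otimes> coords (N i) g l)"
    using v by (simp add: functional_def)
  also have "\<dots> = col i (coords (N i) g) j"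
    unfolding col_def by (rule finsum_cong') (use Vec_closed[OF coords_Vec[OF g']] in \<open>auto simp: vec_app\<close>)
  finally show ?thesis .
qed

lemma dual_cocycles_iff:
  "g \<in> dual_cocycles R P D i \<longleftrightarrow>
     g \<in> carrier (dual_module R (P i)) \<and> (\<forall>j<N (Suc i). col i (coords (N i) g) j = \<zero>)"
proof -
  have "(\<forall>x\<in>carrier (P (Suc i)). g (D i x) = \<zero>) \<longleftrightarrow> (\<forall>j<N (Suc i). col i (coords (N i) g) j = \<zero>)"
    if g: "g \<in> carrier (dual_module R (P i))"
  proof -
    \<comment> \<open>The zero functional, presented through its coordinates, so that the vanishing
      of a pullback becomes a comparison of columns.\<close>
    define z where "z = functional (N (Suc i)) (\<lambda>l. \<zero>)"
    have zc: "z \<in> carrier (dual_module R (F (N (Suc i))))" 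
      and cz: "coords (N (Suc i)) z = (\<lambda>l. \<zero>)"
      unfolding z_def using functional_closed[of "\<lambda>l. \<zero>"] coords_functional[of "\<lambda>l. \<zero>"]
      by (simp_all add: Vec_def)
    have zz: "z f = \<zero>" if "f \<in> carrier (F (N (Suc i)))" for f
    proof -
      have "(\<Oplus>l\<in>{..<N (Suc i)}. f (\<iota> l) \<otimes> \<zero>) = (\<Oplus>l\<in>{..<N (Suc i)}. \<zero>)"
        using that by (intro finsum_cong') (auto simp: F_carrier)
      then show ?thesis using that by (simp add: z_def functional_def)
    qed
    have pc: "pullback i g \<in> carrier (dual_module R (F (N (Suc i))))"
      using pullback_closed[OF g] by (simp add: P_def)
    have "(\<forall>x\<in>carrier (P (Suc i)). g (D i x) = \<zero>) \<longleftrightarrow> pullback i g = z"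
    proof
      assume "\<forall>x\<in>carrier (P (Suc i)). g (D i x) = \<zero>"
      then show "pullback i g = z"
        by (intro extensionalityI[of _ "carrier (F (N (Suc i)))"])
          (use pc zc zz in \<open>auto simp: dual_carrier pullback_def P_def\<close>)
    next
      assume *: "pullback i g = z"
      show "\<forall>x\<in>carrier (P (Suc i)). g (D i x) = \<zero>"
      proof
        fix f assume f: "f \<in> carrier (P (Suc i))"
        have "pullback i g f = \<zero>" unfolding * by (rule zz) (use f in \<open>simp add: P_def\<close>)
        then show "g (D i f) = \<zero>" using f by (simp add: pullback_def)
      qed
    qed
    also have "\<dots> \<longleftrightarrow> (\<forall>j<N (Suc i). col i (coords (N i) g) j = \<zero>)"
      unfolding dual_eq_iff[OF pc zc] cz using coords_pullback[OF g] by simp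
    finally show ?thesis .
  qed
  then show ?thesis unfolding dual_cocycles_def by auto
qed

lemma dual_coboundaries_iff:
  "g \<in> dual_coboundaries R P D i \<longleftrightarrow> g \<in> carrier (dual_module R (P i)) \<and>
    (case i of 0 \<Rightarrow> \<forall>l<N 0. coords (N 0) g l = \<zero>
     | Suc m \<Rightarrow> \<exists>h\<in>Vec (N m). \<forall>l<N i. coords (N i) g l = col m h l)"
proof (cases i)
  case 0
  interpret X: left_module R "F (N 0)" by (rule F_left_module)
  let ?z = "\<lambda>x\<in>carrier (F (N 0)). \<zero>"
  have z: "?z \<in> carrier (dual_module R (F (N 0)))"
    using X.M.a_closed X.act_closed by (auto simp: dual_carrier mod_hom_def simp del: F_simps)
  have "coords (N 0) ?z = (\<lambda>l. \<zero>)" by (auto simp: coords_def)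
  then show ?thesis
    unfolding dual_coboundaries_def using dual_eq_iff[OF _ z] z 0 by (auto simp: P_def)
next
  case (Suc m)
  have U: "dual_coboundaries R P D i = pullback m ` carrier (dual_module R (P m))"
    unfolding dual_coboundaries_def pullback_def Suc by auto
  show ?thesis unfolding U
  proof
    assume "g \<in> pullback m ` carrier (dual_module R (P m))"
    then obtain h where h: "h \<in> carrier (dual_module R (P m))" "g = pullback m h" by blast
    then show "g \<in> carrier (dual_module R (P i)) \<and>
      (case i of 0 \<Rightarrow> \<forall>l<N 0. coords (N 0) g l = \<zero>
       | Suc m \<Rightarrow> \<exists>h\<in>Vec (N m). \<forall>l<N i. coords (N i) g l = col m h l)"
      using pullback_closed[OF h(1)] coords_pullback[OF h(1)] coords_Vec[of h "N m"]
      by (auto simp: Suc P_def)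
  next
    assume *: "g \<in> carrier (dual_module R (P i)) \<and>
      (case i of 0 \<Rightarrow> \<forall>l<N 0. coords (N 0) g l = \<zero>
       | Suc m \<Rightarrow> \<exists>h\<in>Vec (N m). \<forall>l<N i. coords (N i) g l = col m h l)"
    then obtain h where h: "h \<in> Vec (N m)" "\<And>l. l < N i \<Longrightarrow> coords (N i) g l = col m h l"
      and g: "g \<in> carrier (dual_module R (P i))"
      by (auto simp: Suc)
    let ?h = "functional (N m) h"
    have hc: "?h \<in> carrier (dual_module R (P m))" using functional_closed[OF h(1)] by (simp add: P_def)
    have "g = pullback m ?h"
      using dual_eq_iff[of g "N i" "pullback m ?h"] g pullback_closed[OF hc] h(2)
        coords_pullback[OF hc] coords_functional[OF h(1)]
      by (simp add: Suc P_def)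
    then show "g \<in> pullback m ` carrier (dual_module R (P m))" using hc by blast
  qed
qed

definition cocycles :: "nat \<Rightarrow> (nat \<Rightarrow> 'r) set" where
  "cocycles i = {h \<in> Vec (N i). \<forall>j<N (Suc i). col i h j = \<zero>}"

text \<open>Reduces the computation of a cohomology module to columns: it is enough to map the
  column cocycles onto \<open>Y\<close> with the column coboundaries as kernel. In degree 0 the only
  coboundary is zero, whence the case distinction.\<close>

lemma dual_cohomology_isomorphic:
  fixes Y :: "('r, 'y) module"
  assumes Y: "abelian_group Y"
  assumes closed: "\<And>h. h \<in> cocycles i \<Longrightarrow> \<psi> h \<in> carrier Y"
    and add: "\<And>g h. g \<in> cocycles i \<Longrightarrow> h \<in> cocycles i \<Longrightarrow> \<psi> (\<lambda>l. g l \<oplus> h l) = \<psi> g \<oplus>\<^bsub>Y\<^esub> \<psi> h"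
    and act: "\<And>r h. r \<in> carrier R \<Longrightarrow> h \<in> cocycles i \<Longrightarrow> \<psi> (\<lambda>l. h l \<otimes> r) = r \<odot>\<^bsub>Y\<^esub> \<psi> h"
    and onto: "\<And>y. y \<in> carrier Y \<Longrightarrow> \<exists>h\<in>cocycles i. \<psi> h = y"
    and kernel: "\<And>h. h \<in> Vec (N i) \<Longrightarrow>
      (h \<in> cocycles i \<and> \<psi> h = \<zero>\<^bsub>Y\<^esub>) \<longleftrightarrow>
        (case i of 0 \<Rightarrow> \<forall>l<N 0. h l = \<zero> | Suc m \<Rightarrow> \<exists>h'\<in>Vec (N m). \<forall>l<N i. h l = col m h' l)"
  shows "mod_isomorphic (opp R) (dual_cohomology R P D i) Y"
proof -
  let ?n = "N i"
  interpret X: left_module R "F ?n" by (rule F_left_module)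
  let ?M = "(dual_module R (P i))\<lparr>carrier := dual_cocycles R P D i\<rparr>"
  let ?c = "coords ?n"
  have Zc: "?c g \<in> cocycles i" and Zd: "g \<in> carrier (dual_module R (F ?n))" if "g \<in> dual_cocycles R P D i" for g
    using that coords_Vec[of g ?n] by (auto simp: dual_cocycles_iff cocycles_def P_def)
  have mem: "functional ?n h \<in> dual_cocycles R P D i" if "h \<in> cocycles i" for h
    using that functional_closed[of h ?n] coords_functional[of h ?n]
    by (auto simp: dual_cocycles_iff cocycles_def P_def)
  have cadd: "?c (\<lambda>x\<in>carrier (P i). g x \<oplus> h x) = (\<lambda>l. ?c g l \<oplus> ?c h l)" for g h
    by (auto simp: coords_def P_def)
  have cact: "?c (\<lambda>x\<in>carrier (P i). g x \<otimes> r) = (\<lambda>l. ?c g l \<otimes> r)" if "r \<in> carrier R" for g r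
    using that by (auto simp: coords_def P_def)
  have cadd': "(\<lambda>l. g l \<oplus> h l) \<in> cocycles i" if "g \<in> cocycles i" "h \<in> cocycles i" for g h
  proof -
    have "col i (\<lambda>l. g l \<oplus> h l) j = col i g j \<oplus> col i h j" for j
      unfolding col_def using that
      by (subst finsum_addf[symmetric]) (auto simp: r_distr cocycles_def Vec_def intro!: finsum_cong')
    then show ?thesis using that by (auto simp: cocycles_def Vec_def)
  qed
  have cact': "(\<lambda>l. h l \<otimes> r) \<in> cocycles i" if "h \<in> cocycles i" "r \<in> carrier R" for h r
  proof -
    have "col i (\<lambda>l. h l \<otimes> r) j = col i h j \<otimes> r" for j
      unfolding col_def using that
      by (subst finsum_ldistr) (auto simp: m_assoc cocycles_def Vec_def intro!: finsum_cong')
    then show ?thesis using that by (auto simp: cocycles_def Vec_def)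
  qed
  have gval: "g x \<in> carrier R" if "g \<in> dual_cocycles R P D i" "x \<in> carrier (P i)" for g x
    using dual_app[OF Zd[OF that(1)]] that(2) by (simp add: P_def)
  have fadd: "(\<lambda>x\<in>carrier (P i). g x \<oplus> h x) \<in> dual_cocycles R P D i"
    if "g \<in> dual_cocycles R P D i" "h \<in> dual_cocycles R P D i" for g h
  proof -
    have "(\<lambda>x\<in>carrier (P i). g x \<oplus> h x) = functional ?n (\<lambda>l. ?c g l \<oplus> ?c h l)"
    proof (rule extensionalityI[of _ "carrier (P i)"])
      fix f assume f: "f \<in> carrier (P i)"
      have *: "functional ?n (?c g) f = g f" "functional ?n (?c h) f = h f"
        using functional_coords Zd that by auto
      have "functional ?n (\<lambda>l. ?c g l \<oplus> ?c h l) f = functional ?n (?c g) f \<oplus> functional ?n (?c h) f"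
        unfolding functional_def using f Zc[OF that(1)] Zc[OF that(2)]
        by (simp add: P_def, subst finsum_addf[symmetric])
          (auto simp: r_distr cocycles_def Vec_def F_carrier intro!: finsum_cong')
      then show "(\<lambda>x\<in>carrier (P i). g x \<oplus> h x) f = functional ?n (\<lambda>l. ?c g l \<oplus> ?c h l) f"
        using f * by simp
    qed (auto simp: functional_def P_def)
    then show ?thesis using mem cadd' Zc that by simp
  qed
  have fact: "(\<lambda>x\<in>carrier (P i). h x \<otimes> r) \<in> dual_cocycles R P D i"
    if "h \<in> dual_cocycles R P D i" "r \<in> carrier R" for h r
  proof -
    have "(\<lambda>x\<in>carrier (P i). h x \<otimes> r) = functional ?n (\<lambda>l. ?c h l \<otimes> r)"
    proof (rule extensionalityI[of _ "carrier (P i)"])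
      fix f assume f: "f \<in> carrier (P i)"
      have *: "functional ?n (?c h) f = h f"
        using functional_coords Zd that by auto
      have "functional ?n (\<lambda>l. ?c h l \<otimes> r) f = functional ?n (?c h) f \<otimes> r"
        unfolding functional_def using f Zc[OF that(1)] that(2)
        by (simp add: P_def, subst finsum_ldistr)
          (auto simp: m_assoc cocycles_def Vec_def F_carrier intro!: finsum_cong')
      then show "(\<lambda>x\<in>carrier (P i). h x \<otimes> r) f = functional ?n (\<lambda>l. ?c h l \<otimes> r) f"
        using f * by simp
    qed (auto simp: functional_def P_def)
    then show ?thesis using mem cact' Zc that by simp
  qed
  have z: "(\<lambda>x\<in>carrier (P i). \<zero>) \<in> dual_cocycles R P D i"
  proof -
    have "(\<lambda>l. \<zero>) \<in> cocycles i" by (simp add: cocycles_def Vec_def col_def)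
    moreover have "(\<lambda>x\<in>carrier (P i). \<zero>) = functional ?n (\<lambda>l. \<zero>)"
    proof (rule extensionalityI[of _ "carrier (P i)"])
      fix f assume f: "f \<in> carrier (P i)"
      then have "(\<Oplus>l\<in>{..<?n}. f (\<iota> l) \<otimes> \<zero>) = (\<Oplus>l\<in>{..<?n}. \<zero>)"
        by (intro finsum_cong') (auto simp: P_def F_carrier)
      then show "(\<lambda>x\<in>carrier (P i). \<zero>) f = functional ?n (\<lambda>l. \<zero>) f"
        using f by (simp add: functional_def P_def)
    qed (auto simp: functional_def P_def)
    ultimately show ?thesis using mem by simp
  qed
  have ext: "g \<in> extensional (carrier (P i))" if "g \<in> dual_cocycles R P D i" for g
    using Zd[OF that] by (simp add: dual_carrier P_def)
  have M: "abelian_group ?M"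
  proof (rule abelian_groupI)
    fix g assume "g \<in> carrier ?M"
    then have g: "g \<in> dual_cocycles R P D i" by simp
    \<comment> \<open>The additive inverse is the right action of minus one, so closure under the
      action supplies it.\<close>
    show "\<exists>h\<in>carrier ?M. h \<oplus>\<^bsub>?M\<^esub> g = \<zero>\<^bsub>?M\<^esub>"
      using fact[OF g, of "\<ominus> \<one>"] gval[OF g]
      by (intro bexI[of _ "\<lambda>x\<in>carrier (P i). g x \<otimes> \<ominus> \<one>"]) (auto simp: r_minus l_neg)
    show "\<zero>\<^bsub>?M\<^esub> \<oplus>\<^bsub>?M\<^esub> g = g"
      by (rule extensionalityI[OF _ ext[OF g]]) (use gval[OF g] in auto)
  qed (use fadd z gval in \<open>auto simp: a_ac intro!: restrict_ext\<close>)
  show ?thesis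
    unfolding dual_cohomology_def
  proof (rule mod_quot_isomorphic[OF M Y, of "\<lambda>g. \<psi> (?c g)"])
    show "(\<lambda>g. \<psi> (?c g)) \<in> mod_hom (opp R) ?M Y"
      unfolding mod_hom_def using closed Zc by (auto simp: cadd cact add act)
    show "(\<lambda>g. \<psi> (?c g)) ` carrier ?M = carrier Y"
    proof (intro equalityI subsetI)
      fix y assume "y \<in> carrier Y"
      then obtain h where h: "h \<in> cocycles i" "\<psi> h = y" using onto by blast
      then show "y \<in> (\<lambda>g. \<psi> (?c g)) ` carrier ?M"
        using mem[OF h(1)] coords_functional[of h ?n]
        by (intro image_eqI[of _ _ "functional ?n h"]) (auto simp: cocycles_def)
    qed (use closed Zc in auto)
    show "dual_coboundaries R P D i = {g \<in> carrier ?M. \<psi> (?c g) = \<zero>\<^bsub>Y\<^esub>}"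
    proof -
      have "g \<in> dual_coboundaries R P D i \<longleftrightarrow> g \<in> dual_cocycles R P D i \<and> \<psi> (?c g) = \<zero>\<^bsub>Y\<^esub>" for g
      proof (cases "g \<in> carrier (dual_module R (P i))")
        case True
        then have "?c g \<in> Vec ?n" using coords_Vec by (simp add: P_def)
        from kernel[OF this] show ?thesis
          unfolding dual_coboundaries_iff dual_cocycles_iff using True \<open>?c g \<in> Vec ?n\<close>
          by (auto simp: cocycles_def split: nat.splits)
      qed (auto simp: dual_coboundaries_iff dual_cocycles_iff)
      then show ?thesis by auto
    qed
  qed (use fact in auto)
qed

end


section \<open>Exactness of the Koszul complex\<close>

context ring
begin

lemma minus_eq_zero_imp: "a \<in> carrier R \<Longrightarrow> b \<in> carrier R \<Longrightarrow> a \<ominus> b = \<zero> \<Longrightarrow> a = b"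
  using minus_equality[of a "\<ominus> b"] by (simp add: a_minus_def)

text \<open>Stated for arbitrary ring elements because only the listed products matter. In the
  application \<open>Y\<close>, \<open>T\<close> are y and t in the left factor, \<open>Y'\<close>,
  \<open>T'\<close> the same in the right factor; the mixed products commute and the others come
  from the relation for yt in either factor.\<close>

lemma koszul_row_x:
  assumes c: "Y \<in> carrier R" "V \<in> carrier R" "T \<in> carrier R" "T' \<in> carrier R" "W \<in> carrier R"
      "Y' \<in> carrier R" "S \<in> carrier R"
    and r: "Y \<otimes> T = W \<otimes> Y" "Y \<otimes> T' = T' \<otimes> Y" "W \<otimes> Y' = V \<otimes> T \<oplus> S" "T' \<otimes> Y' = V \<otimes> T' \<oplus> S"
  shows "(Y \<ominus> V) \<otimes> (T \<ominus> T') \<oplus> (T' \<ominus> W) \<otimes> (Y \<ominus> Y') = \<zero>"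
proof -
  have "(Y \<ominus> V) \<otimes> (T \<ominus> T') \<oplus> (T' \<ominus> W) \<otimes> (Y \<ominus> Y') =
      Y \<otimes> T \<ominus> Y \<otimes> T' \<ominus> V \<otimes> T \<oplus> V \<otimes> T' \<oplus> T' \<otimes> Y \<ominus> T' \<otimes> Y' \<ominus> W \<otimes> Y \<oplus> W \<otimes> Y'"
    using c by algebra
  also have "\<dots> = \<zero>" unfolding r using c by algebra
  finally show ?thesis .
qed

lemma koszul_row_y:
  assumes c: "T \<in> carrier R" "W \<in> carrier R" "X \<in> carrier R" "X' \<in> carrier R" "Z \<in> carrier R"
      "T' \<in> carrier R" "S \<in> carrier R"
    and r: "T \<otimes> X = Z \<otimes> T \<oplus> S" "T \<otimes> X' = X' \<otimes> T" "W \<otimes> X = Z \<otimes> T' \<oplus> S" "W \<otimes> X' = X' \<otimes> T'"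
  shows "(T \<ominus> W) \<otimes> (X \<ominus> X') \<oplus> (X' \<ominus> Z) \<otimes> (T \<ominus> T') = \<zero>"
proof -
  have "(T \<ominus> W) \<otimes> (X \<ominus> X') \<oplus> (X' \<ominus> Z) \<otimes> (T \<ominus> T') =
      T \<otimes> X \<ominus> T \<otimes> X' \<ominus> W \<otimes> X \<oplus> W \<otimes> X' \<oplus> X' \<otimes> T \<ominus> X' \<otimes> T' \<ominus> Z \<otimes> T \<oplus> Z \<otimes> T'"
    using c by algebra
  also have "\<dots> = \<zero>" unfolding r using c by algebra
  finally show ?thesis .
qed

text \<open>The two outer products leave the difference of the right and left copies of p g'(t); the
  middle product compensates it, since \<open>G\<close> is the divided difference of that
  polynomial.\<close>

lemma koszul_row_t:
  assumes c: "Y' \<in> carrier R" "Q \<in> carrier R" "X \<in> carrier R" "X' \<in> carrier R" "G \<in> carrier R"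
      "T \<in> carrier R" "T' \<in> carrier R" "P \<in> carrier R" "Y \<in> carrier R" "g \<in> carrier R" "g' \<in> carrier R"
    and r: "Y' \<otimes> X = X \<otimes> Y'" "Q \<otimes> X' = P \<otimes> Y" "Q \<otimes> X = X \<otimes> Y \<oplus> g" "P \<otimes> Y' = Y' \<otimes> X' \<oplus> g'"
      "G \<otimes> (T \<ominus> T') = g \<ominus> g'"
  shows "(Y' \<ominus> Q) \<otimes> (X \<ominus> X') \<oplus> G \<otimes> (T \<ominus> T') \<oplus> (X \<ominus> P) \<otimes> (Y \<ominus> Y') = \<zero>"
proof -
  have "(Y' \<ominus> Q) \<otimes> (X \<ominus> X') \<oplus> (X \<ominus> P) \<otimes> (Y \<ominus> Y') =
      Y' \<otimes> X \<ominus> Y' \<otimes> X' \<ominus> Q \<otimes> X \<oplus> Q \<otimes> X' \<oplus> X \<otimes> Y \<ominus> X \<otimes> Y' \<ominus> P \<otimes> Y \<oplus> P \<otimes> Y'"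
    using c by algebra
  also have "\<dots> = g' \<ominus> g" unfolding r using c by algebra
  finally have *: "(Y' \<ominus> Q) \<otimes> (X \<ominus> X') \<oplus> (X \<ominus> P) \<otimes> (Y \<ominus> Y') = g' \<ominus> g" .
  have "(Y' \<ominus> Q) \<otimes> (X \<ominus> X') \<oplus> G \<otimes> (T \<ominus> T') \<oplus> (X \<ominus> P) \<otimes> (Y \<ominus> Y') =
      ((Y' \<ominus> Q) \<otimes> (X \<ominus> X') \<oplus> (X \<ominus> P) \<otimes> (Y \<ominus> Y')) \<oplus> G \<otimes> (T \<ominus> T')"
    using c by algebra
  also have "\<dots> = \<zero>" unfolding * r(5) using c by algebra
  finally show ?thesis .
qed

end

text \<open>Here p and q become inverse to each other. This makes the third relation proportional to
  a cyclic derivative of the potential and allows division by an element with leading coefficient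
  -p.\<close>

locale hq_env = hq_algebra A x t y p q k c d e \<phi>
  for A :: "('k::field, 'a) module" (structure) and x t y p q k c d e \<phi> +
  assumes pq: "p * q = 1"

sublocale hq_env \<subseteq> env A
  by unfold_locales

section \<open>Coefficients in the second tensor factor\<close>

context hq_env
begin

text \<open>The functional \<open>\<phi> m\<close> tensored with the identity: it extracts the
  element of A that stands next to the monomial m.\<close>

definition coef :: "nat \<times> nat \<times> nat \<Rightarrow> ('a \<times> 'a \<Rightarrow>\<^sub>0 'k) set \<Rightarrow> 'a" where
  "coef m = env_lift A (\<lambda>u. \<phi> m (fst u) \<odot> snd u)"

lemma coef_bilinear: "bilinear_map A A (\<lambda>u. \<phi> m (fst u) \<odot> snd u)"
  by (auto simp: bilinear_map_def \<phi>_add \<phi>_smult smult_l_distr smult_r_distr smult_assoc[symmetric] mult.commute)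

lemmas coef_lift = k_space_axioms coef_bilinear

lemma coef_closed [simp, intro]: "z \<in> carrier E \<Longrightarrow> coef m z \<in> carrier A"
  unfolding coef_def by (rule env_lift_closed[OF coef_lift])

lemma coef_add: "z \<in> carrier E \<Longrightarrow> w \<in> carrier E \<Longrightarrow> coef m (z \<boxplus> w) = coef m z \<oplus> coef m w"
  unfolding coef_def by (rule env_lift_add[OF coef_lift])

lemma coef_zero [simp]: "coef m \<zero>\<^sub>E = \<zero>"
  unfolding coef_def by (rule env_lift_zero[OF coef_lift])

lemma coef_minus: "z \<in> carrier E \<Longrightarrow> coef m (\<ominus>\<^bsub>E\<^esub> z) = \<ominus> coef m z"
  unfolding coef_def by (rule env_lift_minus[OF coef_lift])

lemma coef_diff: "z \<in> carrier E \<Longrightarrow> w \<in> carrier E \<Longrightarrow> coef m (z \<boxminus> w) = coef m z \<ominus> coef m w"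
  by (simp add: a_minus_def coef_add coef_minus)

lemma coef_tens: "a \<in> carrier A \<Longrightarrow> b \<in> carrier A \<Longrightarrow> coef m (a \<bowtie> b) = \<phi> m a \<odot> b"
  unfolding coef_def by (simp add: env_lift_tens[OF coef_lift])

lemma coef_pbw: "b \<in> carrier A \<Longrightarrow> coef m (pbw i j l \<bowtie> b) = (if m = (i, j, l) then b else \<zero>)"
  by (simp add: coef_tens \<phi>_pbw')

lemma tens_zero_right [simp]: "a \<in> carrier A \<Longrightarrow> a \<bowtie> \<zero> = \<zero>\<^sub>E"
  using tens_smult_right[of a \<zero> 0] by simp

lemma tens_zero_left [simp]: "a \<in> carrier A \<Longrightarrow> \<zero> \<bowtie> a = \<zero>\<^sub>E"
  using tens_smult_left[of \<zero> a 0] by simp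

lemma pbw_induct [consumes 1, case_names pbw add]:
  assumes "z \<in> carrier E"
    and m: "\<And>i j l b. b \<in> carrier A \<Longrightarrow> P (pbw i j l \<bowtie> b)"
    and add: "\<And>z w. z \<in> carrier E \<Longrightarrow> w \<in> carrier E \<Longrightarrow> P z \<Longrightarrow> P w \<Longrightarrow> P (z \<boxplus> w)"
  shows "P z"
  using assms(1)
proof (induction rule: tens_induct)
  case (tens a b)
  from tens(1) have "a \<in> span" by (simp add: span_eq)
  then show ?case using tens(2)
  proof (induction arbitrary: b rule: span.induct)
    case zero
    then show ?case using m[of \<zero> 0 0 0] by simp
  next
    case (pbw i j l)
    then show ?case using m by simp
  next
    case (add a a')
    then show ?case using assms(3) by (simp add: tens_add_left)
  next
    case (smult a r)
    \<comment> \<open>The scalar is moved to the second factor, so the first one can remain a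
      monomial.\<close>
    then have "(r \<odot> a) \<bowtie> b = a \<bowtie> (r \<odot> b)" by (simp add: tens_smult_left tens_smult_right)
    then show ?case using smult by simp
  qed
qed (rule add)

text \<open>\<open>M\<close> only has to contain the support: for a sum the union of the two sets
  serves even where coefficients cancel. Finiteness of the support, on which the vanishing argument
  for coefficients rests, follows from it.\<close>

lemma pbw_expansion:
  assumes "z \<in> carrier E"
  shows "\<exists>M. finite M \<and> (\<forall>m. m \<notin> M \<longrightarrow> coef m z = \<zero>) \<and>
    z = (\<Oplus>\<^bsub>E\<^esub>m\<in>M. case m of (i, j, l) \<Rightarrow> pbw i j l \<bowtie> coef m z)"
  using assms
proof (induction rule: pbw_induct)
  case (pbw i j l b)
  then show ?case
    by (intro exI[of _ "{(i, j, l)}"]) (auto simp: coef_pbw)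
next
  case (add z w)
  let ?f = "\<lambda>z m. case m of (i, j, l) \<Rightarrow> pbw i j l \<bowtie> coef m z"
  obtain M1 where M1: "finite M1" "\<forall>m. m \<notin> M1 \<longrightarrow> coef m z = \<zero>" "z = (\<Oplus>\<^bsub>E\<^esub>m\<in>M1. ?f z m)"
    using add.IH(1) by (elim exE conjE) (rule that)
  obtain M2 where M2: "finite M2" "\<forall>m. m \<notin> M2 \<longrightarrow> coef m w = \<zero>" "w = (\<Oplus>\<^bsub>E\<^esub>m\<in>M2. ?f w m)"
    using add.IH(2) by (elim exE conjE) (rule that)
  have cl: "?f v m \<in> carrier E" if "v \<in> carrier E" for v m
    using that by (auto split: prod.split)
  have z: "(\<Oplus>\<^bsub>E\<^esub>m\<in>M1. ?f z m) = (\<Oplus>\<^bsub>E\<^esub>m\<in>M1 \<union> M2. ?f z m)"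
    by (rule E.add.finprod_mono_neutral_cong_left)
      (use M1(1,2) M2(1) add.hyps cl in \<open>auto split: prod.split\<close>)
  have w: "(\<Oplus>\<^bsub>E\<^esub>m\<in>M2. ?f w m) = (\<Oplus>\<^bsub>E\<^esub>m\<in>M1 \<union> M2. ?f w m)"
    by (rule E.add.finprod_mono_neutral_cong_left)
      (use M2(1,2) M1(1) add.hyps cl in \<open>auto split: prod.split\<close>)
  have "z \<boxplus> w = (\<Oplus>\<^bsub>E\<^esub>m\<in>M1. ?f z m) \<boxplus> (\<Oplus>\<^bsub>E\<^esub>m\<in>M2. ?f w m)"
    using M1(3) M2(3) by simp
  also have "\<dots> = (\<Oplus>\<^bsub>E\<^esub>m\<in>M1 \<union> M2. ?f z m \<boxplus> ?f w m)"
    unfolding z w using add.hyps cl by (intro E.finsum_addf[symmetric]) auto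
  also have "\<dots> = (\<Oplus>\<^bsub>E\<^esub>m\<in>M1 \<union> M2. ?f (z \<boxplus> w) m)"
    using add.hyps cl[OF E.a_closed[OF add.hyps]]
    by (intro E.finsum_cong') (auto simp: coef_add tens_add_right split: prod.split)
  finally have "z \<boxplus> w = (\<Oplus>\<^bsub>E\<^esub>m\<in>M1 \<union> M2. ?f (z \<boxplus> w) m)" .
  moreover have "finite (M1 \<union> M2)" using M1(1) M2(1) by simp
  moreover have "\<forall>m. m \<notin> M1 \<union> M2 \<longrightarrow> coef m (z \<boxplus> w) = \<zero>"
    using M1(2) M2(2) add.hyps by (simp add: coef_add)
  ultimately show ?case by blast
qed

lemma finite_coef: "z \<in> carrier E \<Longrightarrow> finite {m. coef m z \<noteq> \<zero>}"
  using pbw_expansion[of z] by (auto elim!: finite_subset[rotated])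

section \<open>Subspaces spanned by sets of monomials\<close>

definition supp :: "(nat \<times> nat \<times> nat) set \<Rightarrow> ('a \<times> 'a \<Rightarrow>\<^sub>0 'k) set set" where
  "supp S = {z \<in> carrier E. \<forall>m. m \<notin> S \<longrightarrow> coef m z = \<zero>}"

lemma supp_carrier: "z \<in> supp S \<Longrightarrow> z \<in> carrier E"
  by (simp add: supp_def)

lemma supp_add: "z \<in> supp S \<Longrightarrow> w \<in> supp S \<Longrightarrow> z \<boxplus> w \<in> supp S"
  by (auto simp: supp_def coef_add)

lemma supp_minus: "z \<in> supp S \<Longrightarrow> \<ominus>\<^bsub>E\<^esub> z \<in> supp S"
  by (auto simp: supp_def coef_minus)

lemma supp_diff: "z \<in> supp S \<Longrightarrow> w \<in> supp S \<Longrightarrow> z \<boxminus> w \<in> supp S"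
  unfolding a_minus_def by (intro supp_add supp_minus)

lemma supp_zero: "\<zero>\<^sub>E \<in> supp S"
  by (simp add: supp_def)

lemma supp_pbw: "(i, j, l) \<in> S \<Longrightarrow> b \<in> carrier A \<Longrightarrow> pbw i j l \<bowtie> b \<in> supp S"
  by (auto simp: supp_def coef_pbw)

lemma supp_empty: "z \<in> supp {} \<Longrightarrow> z = \<zero>\<^sub>E"
proof -
  assume z: "z \<in> supp {}"
  obtain M where M: "z = (\<Oplus>\<^bsub>E\<^esub>m\<in>M. case m of (i, j, l) \<Rightarrow> pbw i j l \<bowtie> coef m z)"
    using pbw_expansion[OF supp_carrier[OF z]] by blast
  note M
  also have "(\<Oplus>\<^bsub>E\<^esub>m\<in>M. case m of (i, j, l) \<Rightarrow> pbw i j l \<bowtie> coef m z) = (\<Oplus>\<^bsub>E\<^esub>m\<in>M. \<zero>\<^sub>E)"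
    using z by (intro E.finsum_cong') (auto simp: supp_def split: prod.split)
  finally show ?thesis by simp
qed

lemma supp_induct [consumes 2, case_names pbw add]:
  assumes z: "z \<in> supp S" and "S \<noteq> {}"
    and m: "\<And>i j l b. (i, j, l) \<in> S \<Longrightarrow> b \<in> carrier A \<Longrightarrow> P (pbw i j l \<bowtie> b)"
    and add: "\<And>z w. z \<in> supp S \<Longrightarrow> w \<in> supp S \<Longrightarrow> P z \<Longrightarrow> P w \<Longrightarrow> P (z \<boxplus> w)"
  shows "P z"
proof -
  let ?f = "\<lambda>m. case m of (i, j, l) \<Rightarrow> pbw i j l \<bowtie> coef m z"
  have zc: "z \<in> carrier E" using z by (rule supp_carrier)
  obtain i0 j0 l0 where "(i0, j0, l0) \<in> S" using assms(2) by auto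
  from m[OF this zero_closed] have P0: "P \<zero>\<^sub>E" by simp
  obtain M where M: "finite M" "z = (\<Oplus>\<^bsub>E\<^esub>m\<in>M. ?f m)"
    using pbw_expansion[OF zc] by blast
  have f: "?f m \<in> supp S \<and> P (?f m)" for m
  proof (cases m)
    case (fields i j l)
    show ?thesis
    proof (cases "m \<in> S")
      case True
      then show ?thesis using m supp_pbw zc fields by auto
    next
      case False
      then have "?f m = \<zero>\<^sub>E" using z fields by (auto simp: supp_def)
      then show ?thesis using P0 supp_zero by simp
    qed
  qed
  have "(\<Oplus>\<^bsub>E\<^esub>m\<in>M. ?f m) \<in> supp S \<and> P (\<Oplus>\<^bsub>E\<^esub>m\<in>M. ?f m)"
    using M(1)
  proof (induction M rule: finite_induct)
    case empty
    then show ?case using P0 supp_zero by simp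
  next
    case (insert m M)
    have "(\<Oplus>\<^bsub>E\<^esub>m\<in>insert m M. ?f m) = ?f m \<boxplus> (\<Oplus>\<^bsub>E\<^esub>m\<in>M. ?f m)"
      using insert.hyps f[THEN conjunct1, THEN supp_carrier] by (intro E.finsum_insert) auto
    then show ?case using insert.IH f[of m] supp_add add by simp
  qed
  then show ?thesis using M(2) by simp
qed

text \<open>The monomials in the first factor are untouched. The coefficient is multiplied on the
  left because the second factor carries the opposite product.\<close>

lemma coef_mult_right:
  assumes "z \<in> carrier E" "v \<in> carrier A"
  shows "coef m (z \<cdot> \<one> \<bowtie> v) = v \<otimes> coef m z"
  using assms(1) by (induction rule: pbw_induct)
    (use assms in \<open>auto simp: tens_mult coef_pbw E.l_distr coef_add r_distr\<close>)

lemma supp_mult_right: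
  "z \<in> supp S \<Longrightarrow> v \<in> carrier A \<Longrightarrow> z \<cdot> \<one> \<bowtie> v \<in> supp S"
  by (auto simp: supp_def coef_mult_right)

section \<open>Right multiplication by the generators\<close>

definition XX ("X") where "XX = x \<bowtie> \<one>"
definition TT ("T") where "TT = t \<bowtie> \<one>"
definition YY ("Y") where "YY = y \<bowtie> \<one>"

lemma XTY_closed [simp, intro]: "X \<in> carrier E" "T \<in> carrier E" "Y \<in> carrier E"
  by (auto simp: XX_def TT_def YY_def)

definition B1 where "B1 = supp {(i, j, 0) | i j. True}"
definition B0 where "B0 = supp {(i, 0, 0) | i. True}"

text \<open>y stands last in the monomials, so it can be appended to any of them; t can be appended
  without reordering only when no y is present, and x only when neither t nor y is. These
  restrictions are the origin of \<open>B1\<close> and \<open>B0\<close>.\<close>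

lemma pbw_Y: "b \<in> carrier A \<Longrightarrow> pbw i j l \<bowtie> b \<cdot> Y = pbw i j (Suc l) \<bowtie> b"
  by (simp add: YY_def tens_mult pbw_def m_assoc)

lemma pbw_T: "b \<in> carrier A \<Longrightarrow> pbw i j 0 \<bowtie> b \<cdot> T = pbw i (Suc j) 0 \<bowtie> b"
  by (simp add: TT_def tens_mult pbw_def m_assoc)

lemma pbw_X: "b \<in> carrier A \<Longrightarrow> pbw i 0 0 \<bowtie> b \<cdot> X = pbw (Suc i) 0 0 \<bowtie> b"
  by (simp add: XX_def tens_mult pbw_def m_assoc)

lemma coef_Y: "z \<in> carrier E \<Longrightarrow> coef (i, j, Suc l) (z \<cdot> Y) = coef (i, j, l) z"
  by (induction rule: pbw_induct) (auto simp: pbw_Y coef_pbw E.l_distr coef_add)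

lemma coef_T:
  assumes "z \<in> B1"
  shows "coef (i, Suc j, 0) (z \<cdot> T) = coef (i, j, 0) z" "z \<cdot> T \<in> B1"
proof -
  have "coef (i, Suc j, 0) (z \<cdot> T) = coef (i, j, 0) z \<and> z \<cdot> T \<in> B1"
    using assms unfolding B1_def by (rule supp_induct)
      (auto simp: pbw_T coef_pbw E.l_distr coef_add supp_carrier supp_pbw supp_add)
  then show "coef (i, Suc j, 0) (z \<cdot> T) = coef (i, j, 0) z" "z \<cdot> T \<in> B1" by auto
qed

lemma coef_X:
  assumes "z \<in> B0"
  shows "coef (Suc i, 0, 0) (z \<cdot> X) = coef (i, 0, 0) z" "z \<cdot> X \<in> B0"
proof -
  have "coef (Suc i, 0, 0) (z \<cdot> X) = coef (i, 0, 0) z \<and> z \<cdot> X \<in> B0"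
    using assms unfolding B0_def by (rule supp_induct)
      (auto simp: pbw_X coef_pbw E.l_distr coef_add supp_carrier supp_pbw supp_add)
  then show "coef (Suc i, 0, 0) (z \<cdot> X) = coef (i, 0, 0) z" "z \<cdot> X \<in> B0" by auto
qed

lemma B0_B1: "z \<in> B0 \<Longrightarrow> z \<in> B1"
  by (auto simp: B0_def B1_def supp_def)

lemma B_carrier [simp]: "z \<in> B0 \<Longrightarrow> z \<in> carrier E" "z \<in> B1 \<Longrightarrow> z \<in> carrier E"
  by (simp_all add: B0_def B1_def supp_carrier)

text \<open>The coefficients satisfy \<open>a\<^sub>n = v a\<^sub>n\<^sub>+\<^sub>1\<close>, and only finitely many of them are nonzero.\<close>

lemma coef_vanish:
  assumes z: "z \<in> carrier E" and v: "v \<in> carrier A" and W: "W \<in> carrier E" and "inj \<kappa>"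
    and shift: "\<And>n. coef (\<kappa> (Suc n)) (z \<cdot> W) = coef (\<kappa> n) z"
    and zero: "\<And>n. coef (\<kappa> (Suc n)) (z \<cdot> (W \<boxminus> \<one> \<bowtie> v)) = \<zero>"
  shows "coef (\<kappa> n) z = \<zero>"
proof -
  have step: "coef (\<kappa> n) z = v \<otimes> coef (\<kappa> (Suc n)) z" for n
  proof -
    have "z \<cdot> (W \<boxminus> \<one> \<bowtie> v) = z \<cdot> W \<boxminus> z \<cdot> \<one> \<bowtie> v"
      using z v W by (simp add: a_minus_def E.r_distr E.r_minus)
    then have "coef (\<kappa> n) z \<ominus> v \<otimes> coef (\<kappa> (Suc n)) z = \<zero>"
      using zero[of n] shift[of n] z v W by (simp add: coef_diff coef_mult_right)
    from minus_eq_zero_imp[OF _ _ this] show ?thesis using z v by simp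
  qed
  have "finite {n. coef (\<kappa> n) z \<noteq> \<zero>}"
    using finite_vimageI[OF finite_coef[OF z] \<open>inj \<kappa>\<close>] by (simp add: vimage_def)
  then obtain b where b: "\<And>n. coef (\<kappa> n) z \<noteq> \<zero> \<Longrightarrow> n < b"
    using finite_nat_set_iff_bounded by auto
  have "coef (\<kappa> n) z = \<zero>" if "n \<le> b" for n
    using that
  proof (induction rule: inc_induct)
    case base
    then show ?case using b[of b] by auto
  next
    case (step n)
    then show ?case using \<open>\<And>n. coef (\<kappa> n) z = v \<otimes> coef (\<kappa> (Suc n)) z\<close>[of n] v by simp
  qed
  then show ?thesis using b[of n] by (cases "n \<le> b") auto
qed

lemma coef_B1: "z \<in> B1 \<Longrightarrow> coef (i, j, Suc l) z = \<zero>"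
  unfolding B1_def supp_def by blast

lemma coef_B0: "z \<in> B0 \<Longrightarrow> coef (i, Suc j, l) z = \<zero>"
  unfolding B0_def supp_def by blast

text \<open>Asking for the product to lie in \<open>B1\<close>, rather than to vanish, gives two
  facts at once: the factor is cancellable, and its multiples meet \<open>B1\<close> only in zero,
  so remainders are unique.\<close>

lemma zero_Y:
  assumes z: "z \<in> carrier E" and v: "v \<in> carrier A" and "z \<cdot> (Y \<boxminus> \<one> \<bowtie> v) \<in> B1"
  shows "z = \<zero>\<^sub>E"
proof (rule supp_empty)
  have "coef (i, j, l) z = \<zero>" for i j l
  proof (rule coef_vanish[OF z v XTY_closed(3), of "\<lambda>l. (i, j, l)"])
    show "inj (\<lambda>l. (i, j, l))" by (simp add: inj_def)
  qed (rule coef_Y[OF z], rule coef_B1[OF assms(3)])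
  then show "z \<in> supp {}" using z by (auto simp: supp_def)
qed

lemma zero_T:
  assumes z: "z \<in> B1" and v: "v \<in> carrier A" and "z \<cdot> (T \<boxminus> \<one> \<bowtie> v) \<in> B0"
  shows "z = \<zero>\<^sub>E"
proof (rule supp_empty)
  have "coef (i, j, 0) z = \<zero>" for i j
  proof (rule coef_vanish[OF B_carrier(2)[OF z] v XTY_closed(2), of "\<lambda>j. (i, j, 0)"])
    show "inj (\<lambda>j. (i, j, 0))" by (simp add: inj_def)
  qed (rule coef_T(1)[OF z], rule coef_B0[OF assms(3)])
  then have "coef (i, j, l) z = \<zero>" for i j l
    by (cases l) (simp_all add: coef_B1[OF z])
  then show "z \<in> supp {}" using z by (auto simp: supp_def)
qed

lemma zero_X:
  assumes z: "z \<in> B0" and v: "v \<in> carrier A" and "z \<cdot> (X \<boxminus> \<one> \<bowtie> v) = \<zero>\<^sub>E"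
  shows "z = \<zero>\<^sub>E"
proof (rule supp_empty)
  have "coef (i, 0, 0) z = \<zero>" for i
  proof (rule coef_vanish[OF B_carrier(1)[OF z] v XTY_closed(1), of "\<lambda>i. (i, 0, 0)"])
    show "inj (\<lambda>i. (i, 0, 0))" by (simp add: inj_def)
  qed (rule coef_X(1)[OF z], simp add: assms(3))
  then have "coef (i, j, l) z = \<zero>" for i j l
    by (cases j; cases l) (simp_all add: coef_B0[OF z] coef_B1[OF B0_B1[OF z]])
  then show "z \<in> supp {}" using z by (auto simp: supp_def)
qed

section \<open>Right division by linear forms\<close>

lemma division_step:
  assumes "u \<in> carrier E" "W \<in> carrier E" "v \<in> carrier A" "b \<in> carrier E" "s \<in> carrier E"
    and "u \<cdot> \<one> \<bowtie> v = b \<boxplus> s \<cdot> (W \<boxminus> \<one> \<bowtie> v)"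
  shows "u \<cdot> W = b \<boxplus> (s \<boxplus> u) \<cdot> (W \<boxminus> \<one> \<bowtie> v)"
proof -
  have "u \<cdot> W = u \<cdot> \<one> \<bowtie> v \<boxplus> u \<cdot> (W \<boxminus> \<one> \<bowtie> v)"
    using assms(1-3) by (simp add: a_minus_def E.r_distr E.r_minus E.a_lcomm E.r_neg)
  then show ?thesis
    using assms by (simp add: E.l_distr E.a_assoc)
qed

lemma division_add:
  assumes "b \<in> carrier E" "s \<in> carrier E" "b' \<in> carrier E" "s' \<in> carrier E" "L \<in> carrier E"
  shows "(b \<boxplus> s \<cdot> L) \<boxplus> (b' \<boxplus> s' \<cdot> L) = (b \<boxplus> b') \<boxplus> (s \<boxplus> s') \<cdot> L"
  using assms by (simp add: E.l_distr E.a_ac)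

text \<open>The divisor is monic in \<open>W\<close>. A monomial with n+1 factors \<open>W\<close>
  is u W, which equals u(W - 1 \<bowtie> v) plus u(1 \<bowtie> v), and the latter has only n factors
  with v absorbed into its coefficient. In \<open>\<kappa> h n\<close> the number n is the exponent
  being lowered and h records the other exponents.\<close>

lemma division:
  assumes W: "W \<in> carrier E" and v: "v \<in> carrier A"
    and z: "z \<in> supp S"
    and S: "S = {\<kappa> h n | h n. True}" and S': "S' = {\<kappa> h 0 | h. True}"
    and shift: "\<And>h n i j l i' j' l' b. \<kappa> h n = (i, j, l) \<Longrightarrow> \<kappa> h (Suc n) = (i', j', l') \<Longrightarrow>
      b \<in> carrier A \<Longrightarrow> pbw i j l \<bowtie> b \<cdot> W = pbw i' j' l' \<bowtie> b"
  shows "\<exists>b\<in>supp S'. \<exists>s\<in>supp S. z = b \<boxplus> s \<cdot> (W \<boxminus> \<one> \<bowtie> v)"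
proof -
  have L: "W \<boxminus> \<one> \<bowtie> v \<in> carrier E" using W v by simp
  have m: "\<exists>b\<in>supp S'. \<exists>s\<in>supp S. pbw i j l \<bowtie> a = b \<boxplus> s \<cdot> (W \<boxminus> \<one> \<bowtie> v)"
    if "\<kappa> h n = (i, j, l)" "a \<in> carrier A" for h n i j l a
    using that
  proof (induction n arbitrary: i j l a)
    case 0
    have "pbw i j l \<bowtie> a \<in> supp S'"
      using 0 by (intro supp_pbw) (auto simp: S' intro!: exI[of _ h])
    then show ?case
      using 0 L by (intro bexI[of _ "pbw i j l \<bowtie> a"] bexI[of _ "\<zero>\<^sub>E"]) (auto simp: supp_zero)
  next
    case (Suc n)
    obtain i0 j0 l0 where k0: "\<kappa> h n = (i0, j0, l0)" by (cases "\<kappa> h n") auto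
    have us: "pbw i0 j0 l0 \<bowtie> a \<in> supp S"
      using Suc.prems k0 by (intro supp_pbw) (auto simp: S intro!: exI[of _ h] exI[of _ n])
    have "v \<otimes> a \<in> carrier A" using v Suc.prems by simp
    from Suc.IH[OF k0 this] obtain b s where bs: "b \<in> supp S'" "s \<in> supp S"
      "pbw i0 j0 l0 \<bowtie> (v \<otimes> a) = b \<boxplus> s \<cdot> (W \<boxminus> \<one> \<bowtie> v)"
      by blast
    have uv: "pbw i0 j0 l0 \<bowtie> a \<cdot> \<one> \<bowtie> v = b \<boxplus> s \<cdot> (W \<boxminus> \<one> \<bowtie> v)"
      using bs(3) v Suc.prems by (simp add: tens_mult)
    have "pbw i j l \<bowtie> a = b \<boxplus> (s \<boxplus> pbw i0 j0 l0 \<bowtie> a) \<cdot> (W \<boxminus> \<one> \<bowtie> v)"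
      using division_step[OF supp_carrier[OF us] W v supp_carrier[OF bs(1)] supp_carrier[OF bs(2)] uv]
        shift[OF k0 Suc.prems] by simp
    then show ?case using bs(1) supp_add[OF bs(2) us] by blast
  qed
  have "S \<noteq> {}" unfolding S by blast
  with z show ?thesis
  proof (induction rule: supp_induct)
    case (pbw i j l b)
    then obtain h n where "\<kappa> h n = (i, j, l)" by (auto simp: S)
    from m[OF this pbw(2)] show ?case .
  next
    case (add z w)
    then obtain b s b' s' where
      *: "b \<in> supp S'" "s \<in> supp S" "z = b \<boxplus> s \<cdot> (W \<boxminus> \<one> \<bowtie> v)"
        "b' \<in> supp S'" "s' \<in> supp S" "w = b' \<boxplus> s' \<cdot> (W \<boxminus> \<one> \<bowtie> v)"
      by blast
    show ?case unfolding *(3) *(6)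
        division_add[OF supp_carrier[OF *(1)] supp_carrier[OF *(2)] supp_carrier[OF *(4)] supp_carrier[OF *(5)] L]
      using *(1,2,4,5) supp_add by blast
  qed
qed

lemma division_Y:
  assumes "z \<in> carrier E" "v \<in> carrier A"
  shows "\<exists>b\<in>B1. \<exists>s\<in>carrier E. z = b \<boxplus> s \<cdot> (Y \<boxminus> \<one> \<bowtie> v)"
proof -
  have "z \<in> supp UNIV" using assms by (simp add: supp_def)
  from division[OF XTY_closed(3) assms(2) this, of "\<lambda>(i, j) n. (i, j, n)" "{(i, j, 0) | i j. True}"]
  show ?thesis using supp_carrier unfolding B1_def by (fastforce simp: pbw_Y)
qed

lemma division_T:
  assumes "z \<in> B1" "v \<in> carrier A"
  shows "\<exists>b\<in>B0. \<exists>s\<in>B1. z = b \<boxplus> s \<cdot> (T \<boxminus> \<one> \<bowtie> v)"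
  unfolding B0_def B1_def
  by (rule division[OF XTY_closed(2) assms(2) assms(1)[unfolded B1_def], of "\<lambda>i n. (i, n, 0)"])
    (auto simp: pbw_T)

lemma division_X:
  assumes "z \<in> B0" "v \<in> carrier A"
  shows "\<exists>a\<in>carrier A. \<exists>s\<in>B0. z = \<one> \<bowtie> a \<boxplus> s \<cdot> (X \<boxminus> \<one> \<bowtie> v)"
proof -
  have ne: "{(0, 0, 0)} \<noteq> {}" by simp
  have "\<exists>b\<in>supp {(0, 0, 0)}. \<exists>s\<in>B0. z = b \<boxplus> s \<cdot> (X \<boxminus> \<one> \<bowtie> v)"
    unfolding B0_def
    \<comment> \<open>No other exponents remain in this case, so the parameter h ranges over a
      one-point type.\<close>
    by (rule division[OF XTY_closed(1) assms(2) assms(1)[unfolded B0_def], of "\<lambda>(_ :: unit) n. (n, 0, 0)"])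
      (auto simp: pbw_X)
  moreover have "\<exists>a\<in>carrier A. b = \<one> \<bowtie> a" if "b \<in> supp {(0, 0, 0)}" for b
    using that ne
  proof (induction rule: supp_induct)
    case (pbw i j l b)
    then show ?case by (intro bexI[of _ b]) (auto simp: pbw_def)
  next
    case (add z w)
    then show ?case using tens_add_right[of _ _ \<one>] by (metis one_closed a_closed)
  qed
  ultimately show ?thesis by blast
qed

end


text \<open>The formal step of the elimination: replacing a row r by b + sM changes its product with
  the column of differences only by s times (M applied to that column). The two corner entries of M
  on the diagonal are absent because they are zero in the Hessian.\<close>

lemma (in ring) koszul_substitution:
  assumes "b0 \<in> carrier R" "b1 \<in> carrier R" "b2 \<in> carrier R" "sx \<in> carrier R" "st \<in> carrier R"
    "sy \<in> carrier R" "Mxt \<in> carrier R" "Mxy \<in> carrier R" "Mtx \<in> carrier R" "Mtt \<in> carrier R"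
    "Mty \<in> carrier R" "Myx \<in> carrier R" "Myt \<in> carrier R" "dx \<in> carrier R" "dt \<in> carrier R" "dy \<in> carrier R"
  shows "(b0 \<oplus> (st \<otimes> Mtx \<oplus> sy \<otimes> Myx)) \<otimes> dx \<oplus> (b1 \<oplus> (sx \<otimes> Mxt \<oplus> st \<otimes> Mtt \<oplus> sy \<otimes> Myt)) \<otimes> dt
      \<oplus> (b2 \<oplus> (sx \<otimes> Mxy \<oplus> st \<otimes> Mty)) \<otimes> dy =
    (b0 \<otimes> dx \<oplus> b1 \<otimes> dt \<oplus> b2 \<otimes> dy) \<oplus> sx \<otimes> (Mxt \<otimes> dt \<oplus> Mxy \<otimes> dy)
      \<oplus> st \<otimes> (Mtx \<otimes> dx \<oplus> Mtt \<otimes> dt \<oplus> Mty \<otimes> dy) \<oplus> sy \<otimes> (Myx \<otimes> dx \<oplus> Myt \<otimes> dt)"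
  using assms by algebra

lemma (in k_space) smult_diff_eq:
  assumes "a \<in> carrier C" "a' \<in> carrier C" "b \<in> carrier C" "b' \<in> carrier C" "u \<in> carrier C"
  shows "p \<odot> (c \<odot> (a \<ominus> a') \<oplus> d \<odot> (b \<ominus> b')) =
    p \<odot> (u \<oplus> d \<odot> b \<oplus> c \<odot> a) \<ominus> p \<odot> (u \<oplus> d \<odot> b' \<oplus> c \<odot> a')"
proof -
  let ?z = "u \<oplus> d \<odot> b \<oplus> c \<odot> a" and ?z' = "u \<oplus> d \<odot> b' \<oplus> c \<odot> a'"
  have "?z = (c \<odot> (a \<ominus> a') \<oplus> d \<odot> (b \<ominus> b')) \<oplus> ?z'"
    using assms by (simp add: a_minus_def smult_r_distr smult_minus_right a_ac r_neg r_neg1 r_neg2)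
  then have "p \<odot> ?z = p \<odot> (c \<odot> (a \<ominus> a') \<oplus> d \<odot> (b \<ominus> b')) \<oplus> p \<odot> ?z'"
    using assms by (simp only: smult_r_distr smult_closed a_closed minus_closed)
  then show ?thesis using assms
    by (simp add: a_minus_def a_assoc r_neg)
qed

section \<open>The Hessian and its row and column identities\<close>

context hq_env
begin

definition "dx = X \<boxminus> \<one> \<bowtie> x"
definition "dt = T \<boxminus> \<one> \<bowtie> t"
definition "dy = Y \<boxminus> \<one> \<bowtie> y"

text \<open>The noncommutative Hessian of the potential
  \<open>y t x - p y x t - k y x + p (c t\<^sup>3 / 3 + d t\<^sup>2 / 2 + e t)\<close>, whose cyclic derivatives are the
  defining relations up to a scalar; the division by \<open>6\<close> disappears after differentiation.\<close>

definition "Mxt = Y \<boxminus> \<one> \<bowtie> (p \<odot> y)"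
definition "Mxy = \<one> \<bowtie> t \<boxminus> (p \<odot> t \<oplus> k \<odot> \<one>) \<bowtie> \<one>"
definition "Mtx = \<one> \<bowtie> y \<boxminus> (p \<odot> y) \<bowtie> \<one>"
definition "Mtt = p \<odot>\<^bsub>E\<^esub> (c \<odot>\<^bsub>E\<^esub> (T \<boxplus> \<one> \<bowtie> t) \<boxplus> d \<odot>\<^bsub>E\<^esub> \<one>\<^bsub>E\<^esub>)"
definition "Mty = X \<boxminus> \<one> \<bowtie> (p \<odot> x)"
definition "Myx = T \<boxminus> \<one> \<bowtie> (p \<odot> t \<oplus> k \<odot> \<one>)"
definition "Myt = \<one> \<bowtie> x \<boxminus> (p \<odot> x) \<bowtie> \<one>"

lemmas M_defs = dx_def dt_def dy_def Mxt_def Mxy_def Mtx_def Mtt_def Mty_def Myx_def Myt_def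

lemma M_closed [simp, intro]:
  "dx \<in> carrier E" "dt \<in> carrier E" "dy \<in> carrier E" "Mxt \<in> carrier E" "Mxy \<in> carrier E"
  "Mtx \<in> carrier E" "Mtt \<in> carrier E" "Mty \<in> carrier E" "Myx \<in> carrier E" "Myt \<in> carrier E"
  by (simp_all add: M_defs)

lemmas tens_simps = tens_mult tens_add_left tens_add_right tens_smult_left tens_smult_right
  l_distr r_distr scalar_mult_left scalar_mult_right
  E.l_distr E.r_distr E.scalar_mult_left E.scalar_mult_right

text \<open>A row of the Hessian consists of the two-sided partial derivatives of a relation r.
  Multiplying them by the differences and adding telescopes along each word of r to
  \<open>r \<bowtie> \<one> \<boxminus> \<one> \<bowtie> r\<close>, which vanishes because r is zero
  in A.\<close>

lemma row_x: "Mxt \<cdot> dt \<boxplus> Mxy \<cdot> dy = \<zero>\<^sub>E"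
  unfolding M_defs
  by (rule E.koszul_row_x[where S = "\<one> \<bowtie> (k \<odot> y)"]) (simp_all add: YY_def TT_def tens_simps yt)

lemma row_y: "Myx \<cdot> dx \<boxplus> Myt \<cdot> dt = \<zero>\<^sub>E"
  unfolding M_defs
  by (rule E.koszul_row_y[where S = "(k \<odot> x) \<bowtie> \<one>"]) (simp_all add: XX_def TT_def tens_simps tx)

lemma row_t: "Mtx \<cdot> dx \<boxplus> Mtt \<cdot> dt \<boxplus> Mty \<cdot> dy = \<zero>\<^sub>E"
proof -
  let ?g = "p \<odot> (e \<odot> \<one> \<oplus> d \<odot> t \<oplus> c \<odot> (t \<otimes> t))"
  \<comment> \<open>Only for this relation do both parameters meet: p yx = xy + p g'(t) needs the
    product pq to cancel.\<close>
  have pq': "p \<odot> (q \<odot> a) = a" if "a \<in> carrier A" for a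
    using that by (simp add: smult_assoc[symmetric] pq)
  have pqE: "p \<odot>\<^bsub>E\<^esub> (q \<odot>\<^bsub>E\<^esub> a) = a" if "a \<in> carrier E" for a
    using that by (simp add: E.smult_assoc[symmetric] pq)
  \<comment> \<open>The left and right copies of t commute, so this is the difference of two
    squares; it shows that \<open>Mtt\<close> is the divided difference of p g'.\<close>
  have sq: "(T \<boxplus> \<one> \<bowtie> t) \<cdot> (T \<boxminus> \<one> \<bowtie> t) = (t \<otimes> t) \<bowtie> \<one> \<boxminus> \<one> \<bowtie> (t \<otimes> t)"
    by (simp add: TT_def a_minus_def E.r_distr E.l_distr E.r_minus tens_mult E.a_assoc E.minus_add E.r_neg1 E.r_neg2)
  have G: "Mtt \<cdot> dt = ?g \<bowtie> \<one> \<boxminus> \<one> \<bowtie> ?g"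
  proof -
    have "Mtt \<cdot> dt = p \<odot>\<^bsub>E\<^esub> (c \<odot>\<^bsub>E\<^esub> ((T \<boxplus> \<one> \<bowtie> t) \<cdot> dt) \<boxplus> d \<odot>\<^bsub>E\<^esub> dt)"
      unfolding Mtt_def by (simp add: E.scalar_mult_left E.l_distr)
    also have "\<dots> = p \<odot>\<^bsub>E\<^esub> (c \<odot>\<^bsub>E\<^esub> ((t \<otimes> t) \<bowtie> \<one> \<boxminus> \<one> \<bowtie> (t \<otimes> t)) \<boxplus> d \<odot>\<^bsub>E\<^esub> (T \<boxminus> \<one> \<bowtie> t))"
      unfolding dt_def sq ..
    also have "\<dots> = p \<odot>\<^bsub>E\<^esub> (e \<odot>\<^bsub>E\<^esub> \<one> \<bowtie> \<one> \<boxplus> d \<odot>\<^bsub>E\<^esub> T \<boxplus> c \<odot>\<^bsub>E\<^esub> (t \<otimes> t) \<bowtie> \<one>) \<boxminus>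
        p \<odot>\<^bsub>E\<^esub> (e \<odot>\<^bsub>E\<^esub> \<one> \<bowtie> \<one> \<boxplus> d \<odot>\<^bsub>E\<^esub> \<one> \<bowtie> t \<boxplus> c \<odot>\<^bsub>E\<^esub> \<one> \<bowtie> (t \<otimes> t))"
      by (rule E.smult_diff_eq) auto
    also have "\<dots> = ?g \<bowtie> \<one> \<boxminus> \<one> \<bowtie> ?g"
      by (simp add: TT_def tens_simps)
    finally show ?thesis .
  qed
  show ?thesis
    unfolding Mtx_def dx_def Mty_def dy_def dt_def
  proof (rule E.koszul_row_t[where g = "?g \<bowtie> \<one>" and g' = "\<one> \<bowtie> ?g"])
    show "Mtt \<cdot> (T \<boxminus> \<one> \<bowtie> t) = ?g \<bowtie> \<one> \<boxminus> \<one> \<bowtie> ?g"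
      using G by (simp add: dt_def)
  qed (simp_all add: XX_def YY_def tens_simps yx smult_r_distr pq' E.smult_r_distr pqE)
qed

lemma flip_diff: "z \<in> carrier E \<Longrightarrow> w \<in> carrier E \<Longrightarrow> flip (z \<boxminus> w) = flip z \<boxminus> flip w"
  by (simp add: a_minus_def flip_add flip_minus)

lemma flip_d: "flip dx = \<ominus>\<^bsub>E\<^esub> dx" "flip dt = \<ominus>\<^bsub>E\<^esub> dt" "flip dy = \<ominus>\<^bsub>E\<^esub> dy"
  by (simp_all add: M_defs XX_def TT_def YY_def flip_add flip_minus flip_tens a_minus_def E.minus_add E.a_comm)

lemma flip_M: "flip Mxt = Mtx" "flip Mxy = Myx" "flip Mtx = Mxt" "flip Mtt = Mtt" "flip Mty = Myt"
  "flip Myx = Mxy" "flip Myt = Mty"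
  by (simp_all add: M_defs XX_def TT_def YY_def flip_diff flip_tens flip_smult flip_add tens_one E.a_comm)

text \<open>The flip reverses products, transposes the Hessian and negates the differences, so each
  column identity is a row identity read backwards. Together they say that the last two
  differentials compose to zero.\<close>

lemma col_x: "dt \<cdot> Mtx \<boxplus> dy \<cdot> Myx = \<zero>\<^sub>E"
proof -
  have "flip (Mxt \<cdot> dt \<boxplus> Mxy \<cdot> dy) = \<zero>\<^sub>E" by (simp add: row_x)
  then have "\<ominus>\<^bsub>E\<^esub> (dt \<cdot> Mtx \<boxplus> dy \<cdot> Myx) = \<zero>\<^sub>E"
    by (simp add: flip_add flip_mult flip_d flip_M E.l_minus E.minus_add)
  then show ?thesis by (simp add: E.add.inv_eq_1_iff)
qed

lemma col_y: "dx \<cdot> Mxy \<boxplus> dt \<cdot> Mty = \<zero>\<^sub>E"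
proof -
  have "flip (Myx \<cdot> dx \<boxplus> Myt \<cdot> dt) = \<zero>\<^sub>E" by (simp add: row_y)
  then have "\<ominus>\<^bsub>E\<^esub> (dx \<cdot> Mxy \<boxplus> dt \<cdot> Mty) = \<zero>\<^sub>E"
    by (simp add: flip_add flip_mult flip_d flip_M E.l_minus E.minus_add)
  then show ?thesis by (simp add: E.add.inv_eq_1_iff)
qed

lemma col_t: "dx \<cdot> Mxt \<boxplus> dt \<cdot> Mtt \<boxplus> dy \<cdot> Myt = \<zero>\<^sub>E"
proof -
  have "flip (Mtx \<cdot> dx \<boxplus> Mtt \<cdot> dt \<boxplus> Mty \<cdot> dy) = \<zero>\<^sub>E" by (simp add: row_t)
  then have "\<ominus>\<^bsub>E\<^esub> (dx \<cdot> Mxt \<boxplus> dt \<cdot> Mtt \<boxplus> dy \<cdot> Myt) = \<zero>\<^sub>E"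
    by (simp add: flip_add flip_mult flip_d flip_M E.l_minus E.minus_add)
  then show ?thesis by (simp add: E.add.inv_eq_1_iff)
qed

subsection \<open>Exactness\<close>

text \<open>As a polynomial in \<open>Y\<close> the entry has leading coefficient -p. Factoring it
  out leaves a monic divisor with v = qy, to which division and cancellation apply.\<close>

lemma Mtx_eq:
  assumes "s \<in> carrier E"
  shows "s \<cdot> Mtx = ((- p) \<odot>\<^bsub>E\<^esub> s) \<cdot> (Y \<boxminus> \<one> \<bowtie> (q \<odot> y))"
proof -
  have "Mtx = (- p) \<odot>\<^bsub>E\<^esub> (Y \<boxminus> \<one> \<bowtie> (q \<odot> y))"
    by (simp add: Mtx_def YY_def tens_smult_left tens_smult_right a_minus_def E.smult_r_distr
        E.smult_minus_right E.smult_minus_left E.smult_assoc[symmetric] pq E.a_comm)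
  then show ?thesis using assms by (simp add: E.scalar_mult_left E.scalar_mult_right)
qed

lemma B1_closed:
  "z \<in> B1 \<Longrightarrow> w \<in> B1 \<Longrightarrow> z \<boxplus> w \<in> B1" "z \<in> B1 \<Longrightarrow> \<ominus>\<^bsub>E\<^esub> z \<in> B1" "\<zero>\<^sub>E \<in> B1"
  "z \<in> B1 \<Longrightarrow> v \<in> carrier A \<Longrightarrow> z \<cdot> (T \<boxminus> \<one> \<bowtie> v) \<in> B1"
proof -
  show "z \<in> B1 \<Longrightarrow> w \<in> B1 \<Longrightarrow> z \<boxplus> w \<in> B1" "z \<in> B1 \<Longrightarrow> \<ominus>\<^bsub>E\<^esub> z \<in> B1" "\<zero>\<^sub>E \<in> B1"
    unfolding B1_def by (fact supp_add supp_minus supp_zero)+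
  show "z \<cdot> (T \<boxminus> \<one> \<bowtie> v) \<in> B1" if "z \<in> B1" "v \<in> carrier A"
  proof -
    have "z \<cdot> T \<boxminus> z \<cdot> \<one> \<bowtie> v \<in> B1"
      using coef_T(2)[OF that(1)] supp_mult_right[OF that(1)[unfolded B1_def] that(2)]
      unfolding B1_def by (rule supp_diff)
    then show ?thesis using that by (simp add: a_minus_def E.r_distr E.r_minus)
  qed
qed

lemma B0_closed:
  "z \<in> B0 \<Longrightarrow> \<ominus>\<^bsub>E\<^esub> z \<in> B0" "\<zero>\<^sub>E \<in> B0"
  "z \<in> B0 \<Longrightarrow> v \<in> carrier A \<Longrightarrow> z \<cdot> (X \<boxminus> \<one> \<bowtie> v) \<in> B0"
proof -
  show "z \<in> B0 \<Longrightarrow> \<ominus>\<^bsub>E\<^esub> z \<in> B0" "\<zero>\<^sub>E \<in> B0"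
    unfolding B0_def by (fact supp_minus supp_zero)+
  show "z \<cdot> (X \<boxminus> \<one> \<bowtie> v) \<in> B0" if "z \<in> B0" "v \<in> carrier A"
  proof -
    have "z \<cdot> X \<boxminus> z \<cdot> \<one> \<bowtie> v \<in> B0"
      using coef_X(2)[OF that(1)] supp_mult_right[OF that(1)[unfolded B0_def] that(2)]
      unfolding B0_def by (rule supp_diff)
    then show ?thesis using that by (simp add: a_minus_def E.r_distr E.r_minus)
  qed
qed

lemma E_sum_zero: "a \<in> carrier E \<Longrightarrow> b \<in> carrier E \<Longrightarrow> a \<boxplus> b = \<zero>\<^sub>E \<Longrightarrow> b = \<ominus>\<^bsub>E\<^esub> a"
  by (rule E.sum_zero_eq_neg) (auto simp: E.a_comm)

text \<open>The first two products lie in \<open>B1\<close>, so the third one does as well and its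
  factor vanishes. What remains forces the second product into \<open>B0\<close>, and then the first
  one to be zero.\<close>

lemma triangular_zero:
  assumes b0: "b0 \<in> B0" and b1: "b1 \<in> B1" and b2: "b2 \<in> carrier E"
    and z: "b0 \<cdot> dx \<boxplus> b1 \<cdot> dt \<boxplus> b2 \<cdot> dy = \<zero>\<^sub>E"
  shows "b0 = \<zero>\<^sub>E" "b1 = \<zero>\<^sub>E" "b2 = \<zero>\<^sub>E"
proof -
  have c0: "b0 \<cdot> dx \<in> B0" unfolding dx_def by (rule B0_closed(3)[OF b0]) simp
  have c1: "b1 \<cdot> dt \<in> B1" unfolding dt_def by (rule B1_closed(4)[OF b1]) simp
  have "b2 \<cdot> dy = \<ominus>\<^bsub>E\<^esub> (b0 \<cdot> dx \<boxplus> b1 \<cdot> dt)"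
    using z b0 b1 b2 by (intro E_sum_zero) auto
  also have "\<dots> \<in> B1" by (intro B1_closed B0_B1 c0 c1)
  finally show z2: "b2 = \<zero>\<^sub>E" unfolding dy_def by (rule zero_Y[OF b2 gens(3)])
  have "b0 \<cdot> dx \<boxplus> b1 \<cdot> dt = \<zero>\<^sub>E" using z b0 b1 by (simp add: z2)
  then have "b1 \<cdot> dt = \<ominus>\<^bsub>E\<^esub> (b0 \<cdot> dx)" using b0 b1 by (intro E_sum_zero) auto
  also have "\<dots> \<in> B0" by (intro B0_closed c0)
  finally show z1: "b1 = \<zero>\<^sub>E" unfolding dt_def by (rule zero_T[OF b1 gens(2)])
  have "b0 \<cdot> dx = \<zero>\<^sub>E" using z b0 by (simp add: z1 z2)
  then show "b0 = \<zero>\<^sub>E" unfolding dx_def by (rule zero_X[OF b0 gens(1)])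
qed

lemma lact_zero: "r \<in> carrier E \<Longrightarrow> lact r \<zero> = \<zero>"
  using lact_add_right[of r \<zero> \<zero>] by (simp add: add.l_cancel_one)

lemma lact_d: "lact dx \<one> = \<zero>" "lact dt \<one> = \<zero>" "lact dy \<one> = \<zero>"
proof -
  have "lact (a \<bowtie> \<one> \<boxminus> \<one> \<bowtie> a) \<one> = \<zero>" if "a \<in> carrier A" for a
  proof -
    have "\<ominus>\<^bsub>E\<^esub> (\<one> \<bowtie> a) = \<one> \<bowtie> (\<ominus> a)"
      using tens_smult_right[of \<one> a "- 1"] that by (simp add: E.smult_minus_left smult_minus_left)
    then show ?thesis using that by (simp add: a_minus_def lact_add lact_tens r_neg)
  qed
  then show "lact dx \<one> = \<zero>" "lact dt \<one> = \<zero>" "lact dy \<one> = \<zero>"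
    by (simp_all add: M_defs XX_def TT_def YY_def)
qed

text \<open>Successive division by \<open>dy\<close>, \<open>dt\<close> and \<open>dx\<close> leaves
  a remainder \<open>\<one> \<bowtie> a\<close>. The multiples of the differences act as zero on 1,
  so a is the value of \<open>z\<close> on 1.\<close>

lemma exact_0:
  assumes z: "z \<in> carrier E" and "lact z \<one> = \<zero>"
  shows "\<exists>rx\<in>carrier E. \<exists>rt\<in>carrier E. \<exists>ry\<in>carrier E.
    z = rx \<cdot> dx \<boxplus> rt \<cdot> dt \<boxplus> ry \<cdot> dy"
proof -
  obtain b1 ry where 1: "b1 \<in> B1" "ry \<in> carrier E" "z = b1 \<boxplus> ry \<cdot> dy"
    using division_Y[OF z gens(3)] unfolding dy_def by blast
  obtain b0 rt where 2: "b0 \<in> B0" "rt \<in> B1" "b1 = b0 \<boxplus> rt \<cdot> dt"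
    using division_T[OF 1(1) gens(2)] unfolding dt_def by blast
  obtain a rx where 3: "a \<in> carrier A" "rx \<in> B0" "b0 = \<one> \<bowtie> a \<boxplus> rx \<cdot> dx"
    using division_X[OF 2(1) gens(1)] unfolding dx_def by blast
  note carr = 1(2) B_carrier(2)[OF 2(2)] B_carrier(1)[OF 3(2)]
  have z': "z = \<one> \<bowtie> a \<boxplus> rx \<cdot> dx \<boxplus> rt \<cdot> dt \<boxplus> ry \<cdot> dy"
    using 1(3) 2(3) 3(3) by simp
  have "lact z \<one> = a"
    unfolding z' using carr 3(1) by (simp add: lact_add lact_mult lact_d lact_zero lact_tens)
  then have "a = \<zero>" using assms(2) by simp
  then have "z = rx \<cdot> dx \<boxplus> rt \<cdot> dt \<boxplus> ry \<cdot> dy"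
    using z' carr by simp
  then show ?thesis using carr by blast
qed

lemma complex_0:
  assumes "rx \<in> carrier E" "rt \<in> carrier E" "ry \<in> carrier E"
  shows "lact (rx \<cdot> dx \<boxplus> rt \<cdot> dt \<boxplus> ry \<cdot> dy) \<one> = \<zero>"
  using assms by (simp add: lact_add lact_mult lact_d lact_zero)

text \<open>The row s is found by elimination: dividing \<open>rx\<close> by \<open>Mtx\<close> and
  the remainder by \<open>Myx\<close> gives \<open>st\<close> and \<open>sy\<close>, and dividing
  what is left of \<open>rt\<close> by \<open>Mxt\<close> gives \<open>sx\<close>. The residue of r
  then has its first two entries in \<open>B0\<close> and \<open>B1\<close> and is still a cycle,
  which forces it to vanish.\<close>

lemma exact_1:
  assumes r: "rx \<in> carrier E" "rt \<in> carrier E" "ry \<in> carrier E"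
    and z: "rx \<cdot> dx \<boxplus> rt \<cdot> dt \<boxplus> ry \<cdot> dy = \<zero>\<^sub>E"
  shows "\<exists>sx\<in>carrier E. \<exists>st\<in>carrier E. \<exists>sy\<in>carrier E.
    rx = st \<cdot> Mtx \<boxplus> sy \<cdot> Myx \<and>
    rt = sx \<cdot> Mxt \<boxplus> st \<cdot> Mtt \<boxplus> sy \<cdot> Myt \<and>
    ry = sx \<cdot> Mxy \<boxplus> st \<cdot> Mty"
proof -
  obtain b s where 1: "b \<in> B1" "s \<in> carrier E" "rx = b \<boxplus> s \<cdot> (Y \<boxminus> \<one> \<bowtie> (q \<odot> y))"
    using division_Y[OF r(1), of "q \<odot> y"] by auto
  \<comment> \<open>The factor -q undoes the leading coefficient -p of \<open>Mtx\<close>.\<close>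
  define st where "st = (- q) \<odot>\<^bsub>E\<^esub> s"
  have st: "st \<in> carrier E" using 1(2) by (simp add: st_def)
  have "(- p) \<odot>\<^bsub>E\<^esub> st = s" using 1(2) by (simp add: st_def E.smult_assoc[symmetric] pq)
  then have st_eq: "st \<cdot> Mtx = s \<cdot> (Y \<boxminus> \<one> \<bowtie> (q \<odot> y))"
    using Mtx_eq[OF st] by simp
  obtain b0 sy where 2: "b0 \<in> B0" "sy \<in> B1" "b = b0 \<boxplus> sy \<cdot> Myx"
    using division_T[OF 1(1), of "p \<odot> t \<oplus> k \<odot> \<one>"] unfolding Myx_def by auto
  have sy: "sy \<in> carrier E" and b0: "b0 \<in> carrier E" using 2 by auto
  have rx: "rx = b0 \<boxplus> (st \<cdot> Mtx \<boxplus> sy \<cdot> Myx)"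
    unfolding 1(3) 2(3) st_eq[symmetric] using b0 sy st by (simp add: E.a_ac)
  let ?u = "st \<cdot> Mtt \<boxplus> sy \<cdot> Myt"
  have u: "?u \<in> carrier E" using st sy by simp
  obtain b1 sx where 3: "b1 \<in> B1" "sx \<in> carrier E" "rt \<boxminus> ?u = b1 \<boxplus> sx \<cdot> Mxt"
    using division_Y[of "rt \<boxminus> ?u" "p \<odot> y"] r u unfolding Mxt_def by auto
  have b1: "b1 \<in> carrier E" using 3 by auto
  have "rt = (rt \<boxminus> ?u) \<boxplus> ?u"
    using r(2) u by (simp add: a_minus_def E.a_assoc E.l_neg)
  then have rt: "rt = b1 \<boxplus> (sx \<cdot> Mxt \<boxplus> st \<cdot> Mtt \<boxplus> sy \<cdot> Myt)"
    unfolding 3(3) using b1 3(2) st sy by (simp add: E.a_assoc)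
  let ?w = "sx \<cdot> Mxy \<boxplus> st \<cdot> Mty"
  define b2 where "b2 = ry \<boxminus> ?w"
  have w: "?w \<in> carrier E" using 3(2) st by simp
  have b2: "b2 \<in> carrier E" using r(3) w by (simp add: b2_def)
  have ry: "ry = b2 \<boxplus> ?w"
    using r(3) w by (simp add: b2_def a_minus_def E.a_assoc E.l_neg)
  \<comment> \<open>Subtracting sM does not affect the cycle condition, because the rows of the
    Hessian annihilate the differences.\<close>
  have "b0 \<cdot> dx \<boxplus> b1 \<cdot> dt \<boxplus> b2 \<cdot> dy = \<zero>\<^sub>E"
    using z E.koszul_substitution[OF b0 b1 b2 3(2) st sy M_closed(4-10) M_closed(1-3)]
    unfolding rx[symmetric] rt[symmetric] ry[symmetric] row_x row_t row_y
    using b0 b1 b2 3(2) st sy by simp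
  from triangular_zero[OF 2(1) 3(1) b2 this]
  have "b0 = \<zero>\<^sub>E" "b1 = \<zero>\<^sub>E" "b2 = \<zero>\<^sub>E" .
  then show ?thesis
    using rx rt ry 3(2) st sy
    by (intro bexI[of _ sx] bexI[of _ st] bexI[of _ sy] conjI) simp_all
qed

lemma complex_1:
  assumes "sx \<in> carrier E" "st \<in> carrier E" "sy \<in> carrier E"
  shows "(st \<cdot> Mtx \<boxplus> sy \<cdot> Myx) \<cdot> dx \<boxplus>
    (sx \<cdot> Mxt \<boxplus> st \<cdot> Mtt \<boxplus> sy \<cdot> Myt) \<cdot> dt \<boxplus>
    (sx \<cdot> Mxy \<boxplus> st \<cdot> Mty) \<cdot> dy = \<zero>\<^sub>E"
  using E.koszul_substitution[OF E.zero_closed E.zero_closed E.zero_closed assms M_closed(4-10) M_closed(1-3)] assms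
  by (simp add: row_x row_t row_y)

text \<open>Dividing \<open>sy\<close> by \<open>dy\<close> determines the candidate r. Subtracting
  r times the differences preserves the equations by the column identities and leaves the last entry
  in \<open>B1\<close>; the x-column then kills the middle entry and the last one, and the t-column
  kills the first.\<close>

lemma exact_2:
  assumes s: "sx \<in> carrier E" "st \<in> carrier E" "sy \<in> carrier E"
    and zx: "st \<cdot> Mtx \<boxplus> sy \<cdot> Myx = \<zero>\<^sub>E"
    and zt: "sx \<cdot> Mxt \<boxplus> st \<cdot> Mtt \<boxplus> sy \<cdot> Myt = \<zero>\<^sub>E"
  shows "\<exists>r\<in>carrier E. sx = r \<cdot> dx \<and> st = r \<cdot> dt \<and> sy = r \<cdot> dy"
proof -
  obtain b r where 1: "b \<in> B1" "r \<in> carrier E" "sy = b \<boxplus> r \<cdot> dy"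
    using division_Y[OF s(3) gens(3)] unfolding dy_def by blast
  have b: "b \<in> carrier E" using 1(1) by simp
  define st' where "st' = st \<boxminus> r \<cdot> dt"
  define sx' where "sx' = sx \<boxminus> r \<cdot> dx"
  have c: "st' \<in> carrier E" "sx' \<in> carrier E" using s 1(2) by (simp_all add: st'_def sx'_def)
  have st: "st = st' \<boxplus> r \<cdot> dt" and sx: "sx = sx' \<boxplus> r \<cdot> dx"
    using s 1(2) by (simp_all add: st'_def sx'_def a_minus_def E.a_assoc E.l_neg)
  have "st \<cdot> Mtx \<boxplus> sy \<cdot> Myx =
      (st' \<cdot> Mtx \<boxplus> b \<cdot> Myx) \<boxplus> r \<cdot> (dt \<cdot> Mtx \<boxplus> dy \<cdot> Myx)"
    unfolding st 1(3) using c b 1(2) by (simp add: E.l_distr E.r_distr E.m_assoc E.a_ac)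
  then have zx': "st' \<cdot> Mtx \<boxplus> b \<cdot> Myx = \<zero>\<^sub>E"
    unfolding zx col_x using c b 1(2) by simp
  have "sx \<cdot> Mxt \<boxplus> st \<cdot> Mtt \<boxplus> sy \<cdot> Myt =
      (sx' \<cdot> Mxt \<boxplus> st' \<cdot> Mtt \<boxplus> b \<cdot> Myt) \<boxplus>
      r \<cdot> (dx \<cdot> Mxt \<boxplus> dt \<cdot> Mtt \<boxplus> dy \<cdot> Myt)"
    unfolding st sx 1(3) using c b 1(2) by (simp add: E.l_distr E.r_distr E.m_assoc E.a_ac)
  then have zt': "sx' \<cdot> Mxt \<boxplus> st' \<cdot> Mtt \<boxplus> b \<cdot> Myt = \<zero>\<^sub>E"
    unfolding zt col_t using c b 1(2) by simp
  have bM: "b \<cdot> Myx \<in> B1" unfolding Myx_def by (rule B1_closed(4)[OF 1(1)]) simp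
  have "st' \<cdot> Mtx = \<ominus>\<^bsub>E\<^esub> (b \<cdot> Myx)"
    using zx' c b by (intro E.sum_zero_eq_neg) auto
  \<comment> \<open>A multiple of a divisor that is monic in \<open>Y\<close> can lie in
    \<open>B1\<close> only if its factor is zero.\<close>
  then have "((- p) \<odot>\<^bsub>E\<^esub> st') \<cdot> (Y \<boxminus> \<one> \<bowtie> (q \<odot> y)) \<in> B1"
    unfolding Mtx_eq[OF c(1)] using B1_closed(2)[OF bM] by simp
  then have "(- p) \<odot>\<^bsub>E\<^esub> st' = \<zero>\<^sub>E"
    using c by (intro zero_Y[of _ "q \<odot> y"]) auto
  then have "(- q) \<odot>\<^bsub>E\<^esub> ((- p) \<odot>\<^bsub>E\<^esub> st') = \<zero>\<^sub>E" by simp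
  then have z1: "st' = \<zero>\<^sub>E"
    using c by (simp add: E.smult_assoc[symmetric] mult.commute[of q] pq)
  have "b \<cdot> Myx = \<zero>\<^sub>E" using zx' b by (simp add: z1)
  then have z2: "b = \<zero>\<^sub>E"
    unfolding Myx_def by (intro zero_T[OF 1(1), of "p \<odot> t \<oplus> k \<odot> \<one>"]) (auto simp: B0_closed)
  have "sx' \<cdot> Mxt = \<zero>\<^sub>E" using zt' c by (simp add: z1 z2)
  then have "sx' = \<zero>\<^sub>E"
    unfolding Mxt_def using c by (intro zero_Y[of _ "p \<odot> y"]) (auto simp: B1_closed)
  then show ?thesis
    using st sx 1(2,3) z1 z2 by (intro bexI[of _ r]) auto
qed

lemma complex_2:
  assumes r: "r \<in> carrier E"
  shows "(r \<cdot> dt) \<cdot> Mtx \<boxplus> (r \<cdot> dy) \<cdot> Myx = \<zero>\<^sub>E"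
    "(r \<cdot> dx) \<cdot> Mxt \<boxplus> (r \<cdot> dt) \<cdot> Mtt \<boxplus> (r \<cdot> dy) \<cdot> Myt = \<zero>\<^sub>E"
    "(r \<cdot> dx) \<cdot> Mxy \<boxplus> (r \<cdot> dt) \<cdot> Mty = \<zero>\<^sub>E"
proof -
  have "r \<cdot> (dt \<cdot> Mtx \<boxplus> dy \<cdot> Myx) = \<zero>\<^sub>E"
    "r \<cdot> (dx \<cdot> Mxt \<boxplus> dt \<cdot> Mtt \<boxplus> dy \<cdot> Myt) = \<zero>\<^sub>E"
    "r \<cdot> (dx \<cdot> Mxy \<boxplus> dt \<cdot> Mty) = \<zero>\<^sub>E"
    using r by (simp_all only: col_x col_t col_y E.r_null)
  then show "(r \<cdot> dt) \<cdot> Mtx \<boxplus> (r \<cdot> dy) \<cdot> Myx = \<zero>\<^sub>E"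
    "(r \<cdot> dx) \<cdot> Mxt \<boxplus> (r \<cdot> dt) \<cdot> Mtt \<boxplus> (r \<cdot> dy) \<cdot> Myt = \<zero>\<^sub>E"
    "(r \<cdot> dx) \<cdot> Mxy \<boxplus> (r \<cdot> dt) \<cdot> Mty = \<zero>\<^sub>E"
    using r by (simp_all add: E.r_distr E.m_assoc)
qed

lemma exact_3:
  assumes "r \<in> carrier E" "r \<cdot> dy = \<zero>\<^sub>E"
  shows "r = \<zero>\<^sub>E"
  using assms unfolding dy_def by (intro zero_Y[of r y]) (auto simp: B1_closed)

end


context hq_env
begin

subsection \<open>The dual complex and the Calabi--Yau property\<close>

lemma E_neg_eq_zero: "a \<in> carrier E \<Longrightarrow> \<ominus>\<^bsub>E\<^esub> a = \<zero>\<^sub>E \<Longrightarrow> a = \<zero>\<^sub>E"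
  by (simp add: E.add.inv_eq_1_iff)

lemma flip_eq: "h \<in> carrier E \<Longrightarrow> flip h = z \<Longrightarrow> h = flip z"
  by auto

lemma dual_exact_0:
  assumes h: "h \<in> carrier E" and "dy \<cdot> h = \<zero>\<^sub>E"
  shows "h = \<zero>\<^sub>E"
proof -
  have "flip (dy \<cdot> h) = \<zero>\<^sub>E" by (simp add: assms(2))
  then have "\<ominus>\<^bsub>E\<^esub> (flip h \<cdot> dy) = \<zero>\<^sub>E" using h by (simp add: flip_mult flip_d E.r_minus)
  from E_neg_eq_zero[OF _ this] have "flip h \<cdot> dy = \<zero>\<^sub>E" using h by simp
  from exact_3[OF _ this] have "flip h = \<zero>\<^sub>E" using h by simp
  from flip_eq[OF h this] show ?thesis by simp
qed

text \<open>Flipping turns equations for a column into equations for a row with the transposed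
  Hessian, which is the situation of \<open>exact_2\<close>. The signs of the flipped differences
  are absorbed by taking minus the flip of r as the witness.\<close>

lemma dual_exact_1:
  assumes h: "hx \<in> carrier E" "ht \<in> carrier E" "hy \<in> carrier E"
    and zx: "Mxt \<cdot> ht \<boxplus> Mxy \<cdot> hy = \<zero>\<^sub>E"
    and zt: "Mtx \<cdot> hx \<boxplus> Mtt \<cdot> ht \<boxplus> Mty \<cdot> hy = \<zero>\<^sub>E"
  shows "\<exists>r\<in>carrier E. hx = dx \<cdot> r \<and> ht = dt \<cdot> r \<and> hy = dy \<cdot> r"
proof -
  have "flip (Mxt \<cdot> ht \<boxplus> Mxy \<cdot> hy) = \<zero>\<^sub>E"
    "flip (Mtx \<cdot> hx \<boxplus> Mtt \<cdot> ht \<boxplus> Mty \<cdot> hy) = \<zero>\<^sub>E"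
    by (simp_all add: zx zt)
  then have "flip ht \<cdot> Mtx \<boxplus> flip hy \<cdot> Myx = \<zero>\<^sub>E"
    "flip hx \<cdot> Mxt \<boxplus> flip ht \<cdot> Mtt \<boxplus> flip hy \<cdot> Myt = \<zero>\<^sub>E"
    using h by (simp_all add: flip_add flip_mult flip_M)
  from exact_2[OF _ _ _ this] h obtain r where r: "r \<in> carrier E"
    "flip hx = r \<cdot> dx" "flip ht = r \<cdot> dt" "flip hy = r \<cdot> dy"
    by auto
  have "hx = dx \<cdot> (\<ominus>\<^bsub>E\<^esub> flip r)" "ht = dt \<cdot> (\<ominus>\<^bsub>E\<^esub> flip r)" "hy = dy \<cdot> (\<ominus>\<^bsub>E\<^esub> flip r)"
    using flip_eq[OF h(1) r(2)] flip_eq[OF h(2) r(3)] flip_eq[OF h(3) r(4)] r(1)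
    by (simp_all add: flip_mult flip_d E.r_minus E.l_minus)
  then show ?thesis using r(1) by (intro bexI[of _ "\<ominus>\<^bsub>E\<^esub> flip r"]) auto
qed

lemma dual_complex_1:
  assumes r: "r \<in> carrier E"
  shows "Mxt \<cdot> (dt \<cdot> r) \<boxplus> Mxy \<cdot> (dy \<cdot> r) = \<zero>\<^sub>E"
    "Mtx \<cdot> (dx \<cdot> r) \<boxplus> Mtt \<cdot> (dt \<cdot> r) \<boxplus> Mty \<cdot> (dy \<cdot> r) = \<zero>\<^sub>E"
    "Myx \<cdot> (dx \<cdot> r) \<boxplus> Myt \<cdot> (dt \<cdot> r) = \<zero>\<^sub>E"
proof -
  have "(Mxt \<cdot> dt \<boxplus> Mxy \<cdot> dy) \<cdot> r = \<zero>\<^sub>E"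
    "(Mtx \<cdot> dx \<boxplus> Mtt \<cdot> dt \<boxplus> Mty \<cdot> dy) \<cdot> r = \<zero>\<^sub>E"
    "(Myx \<cdot> dx \<boxplus> Myt \<cdot> dt) \<cdot> r = \<zero>\<^sub>E"
    using r by (simp_all only: row_x row_t row_y E.l_null)
  then show "Mxt \<cdot> (dt \<cdot> r) \<boxplus> Mxy \<cdot> (dy \<cdot> r) = \<zero>\<^sub>E"
    "Mtx \<cdot> (dx \<cdot> r) \<boxplus> Mtt \<cdot> (dt \<cdot> r) \<boxplus> Mty \<cdot> (dy \<cdot> r) = \<zero>\<^sub>E"
    "Myx \<cdot> (dx \<cdot> r) \<boxplus> Myt \<cdot> (dt \<cdot> r) = \<zero>\<^sub>E"
    using r by (simp_all add: E.l_distr E.m_assoc)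
qed

lemma dual_exact_2:
  assumes h: "hx \<in> carrier E" "ht \<in> carrier E" "hy \<in> carrier E"
    and z: "dx \<cdot> hx \<boxplus> dt \<cdot> ht \<boxplus> dy \<cdot> hy = \<zero>\<^sub>E"
  shows "\<exists>sx\<in>carrier E. \<exists>st\<in>carrier E. \<exists>sy\<in>carrier E.
    hx = Mxt \<cdot> st \<boxplus> Mxy \<cdot> sy \<and>
    ht = Mtx \<cdot> sx \<boxplus> Mtt \<cdot> st \<boxplus> Mty \<cdot> sy \<and>
    hy = Myx \<cdot> sx \<boxplus> Myt \<cdot> st"
proof -
  have "flip (dx \<cdot> hx \<boxplus> dt \<cdot> ht \<boxplus> dy \<cdot> hy) = \<zero>\<^sub>E" by (simp add: z)
  then have "\<ominus>\<^bsub>E\<^esub> (flip hx \<cdot> dx \<boxplus> flip ht \<cdot> dt \<boxplus> flip hy \<cdot> dy) = \<zero>\<^sub>E"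
    using h by (simp add: flip_add flip_mult flip_d E.r_minus E.minus_add)
  from E_neg_eq_zero[OF _ this] have "flip hx \<cdot> dx \<boxplus> flip ht \<cdot> dt \<boxplus> flip hy \<cdot> dy = \<zero>\<^sub>E"
    using h by simp
  from exact_1[OF _ _ _ this] h obtain sx st sy where s: "sx \<in> carrier E" "st \<in> carrier E" "sy \<in> carrier E"
    "flip hx = st \<cdot> Mtx \<boxplus> sy \<cdot> Myx"
    "flip ht = sx \<cdot> Mxt \<boxplus> st \<cdot> Mtt \<boxplus> sy \<cdot> Myt"
    "flip hy = sx \<cdot> Mxy \<boxplus> st \<cdot> Mty"
    by auto
  show ?thesis
  proof (intro bexI conjI)
    show "hx = Mxt \<cdot> flip st \<boxplus> Mxy \<cdot> flip sy"
      using flip_eq[OF h(1) s(4)] s(1-3) by (simp add: flip_add flip_mult flip_M)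
    show "ht = Mtx \<cdot> flip sx \<boxplus> Mtt \<cdot> flip st \<boxplus> Mty \<cdot> flip sy"
      using flip_eq[OF h(2) s(5)] s(1-3) by (simp add: flip_add flip_mult flip_M)
    show "hy = Myx \<cdot> flip sx \<boxplus> Myt \<cdot> flip st"
      using flip_eq[OF h(3) s(6)] s(1-3) by (simp add: flip_add flip_mult flip_M)
  qed (use s(1-3) in auto)
qed

lemma dual_complex_2:
  assumes s: "sx \<in> carrier E" "st \<in> carrier E" "sy \<in> carrier E"
  shows "dx \<cdot> (Mxt \<cdot> st \<boxplus> Mxy \<cdot> sy) \<boxplus>
    dt \<cdot> (Mtx \<cdot> sx \<boxplus> Mtt \<cdot> st \<boxplus> Mty \<cdot> sy) \<boxplus>
    dy \<cdot> (Myx \<cdot> sx \<boxplus> Myt \<cdot> st) = \<zero>\<^sub>E" (is "?l = _")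
proof -
  have "?l = (dt \<cdot> Mtx \<boxplus> dy \<cdot> Myx) \<cdot> sx \<boxplus>
      (dx \<cdot> Mxt \<boxplus> dt \<cdot> Mtt \<boxplus> dy \<cdot> Myt) \<cdot> st \<boxplus>
      (dx \<cdot> Mxy \<boxplus> dt \<cdot> Mty) \<cdot> sy"
    using s by (simp add: E.l_distr E.r_distr E.m_assoc E.a_ac)
  also have "\<dots> = \<zero>\<^sub>E" unfolding col_x col_t col_y using s by simp
  finally show ?thesis .
qed

text \<open>Exactness at the augmentation, flipped. It identifies the image of the last dual
  differential with the kernel of the right action on 1, so that its cokernel is A.\<close>

lemma ract_one_eq_zero_iff:
  assumes h: "h \<in> carrier E"
  shows "ract h \<one> = \<zero> \<longleftrightarrow> (\<exists>sx\<in>carrier E. \<exists>st\<in>carrier E. \<exists>sy\<in>carrier E.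
    h = dx \<cdot> sx \<boxplus> dt \<cdot> st \<boxplus> dy \<cdot> sy)"
proof
  assume "ract h \<one> = \<zero>"
  then have "lact (flip h) \<one> = \<zero>" using h by (simp add: ract_flip)
  from exact_0[OF _ this] h obtain rx rt ry where r: "rx \<in> carrier E" "rt \<in> carrier E" "ry \<in> carrier E"
    "flip h = rx \<cdot> dx \<boxplus> rt \<cdot> dt \<boxplus> ry \<cdot> dy"
    by auto
  show "\<exists>sx\<in>carrier E. \<exists>st\<in>carrier E. \<exists>sy\<in>carrier E.
    h = dx \<cdot> sx \<boxplus> dt \<cdot> st \<boxplus> dy \<cdot> sy"
  proof (rule bexI, rule bexI, rule bexI)
    show "h = dx \<cdot> (\<ominus>\<^bsub>E\<^esub> flip rx) \<boxplus> dt \<cdot> (\<ominus>\<^bsub>E\<^esub> flip rt) \<boxplus> dy \<cdot> (\<ominus>\<^bsub>E\<^esub> flip ry)"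
      using flip_eq[OF h r(4)] r(1-3) by (simp add: flip_add flip_mult flip_d E.r_minus E.l_minus)
  qed (use r(1-3) in auto)
next
  assume "\<exists>sx\<in>carrier E. \<exists>st\<in>carrier E. \<exists>sy\<in>carrier E.
    h = dx \<cdot> sx \<boxplus> dt \<cdot> st \<boxplus> dy \<cdot> sy"
  then obtain sx st sy where s: "sx \<in> carrier E" "st \<in> carrier E" "sy \<in> carrier E"
    "h = dx \<cdot> sx \<boxplus> dt \<cdot> st \<boxplus> dy \<cdot> sy"
    by blast
  have "flip h = (\<ominus>\<^bsub>E\<^esub> flip sx) \<cdot> dx \<boxplus> (\<ominus>\<^bsub>E\<^esub> flip st) \<cdot> dt \<boxplus> (\<ominus>\<^bsub>E\<^esub> flip sy) \<cdot> dy"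
    unfolding s(4) using s(1-3) by (simp add: flip_add flip_mult flip_d E.r_minus E.l_minus)
  then have "lact (flip h) \<one> = \<zero>" using s(1-3) by (simp add: complex_0)
  then show "ract h \<one> = \<zero>" using h by (simp add: ract_flip)
qed

section \<open>The complex in matrix form\<close>

definition rank :: "nat \<Rightarrow> nat" where
  "rank i = (if i = 0 \<or> i = 3 then 1 else if i = 1 \<or> i = 2 then 3 else 0)"

definition diff :: "nat \<Rightarrow> ('a \<times> 'a \<Rightarrow>\<^sub>0 'k) set" where
  "diff j = (if j = 0 then dx else if j = 1 then dt else dy)"

definition hessian :: "nat \<Rightarrow> nat \<Rightarrow> ('a \<times> 'a \<Rightarrow>\<^sub>0 'k) set" where
  "hessian j l =
    (if j = 0 then (if l = 0 then \<zero>\<^sub>E else if l = 1 then Mxt else Mxy)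
     else if j = 1 then (if l = 0 then Mtx else if l = 1 then Mtt else Mty)
     else (if l = 0 then Myx else if l = 1 then Myt else \<zero>\<^sub>E))"

text \<open>The coordinates 0, 1, 2 stand for x, t, y. The same three differences form the single
  column of the matrix in degree 0 and the single row of the one in degree 2, with the Hessian
  between them; this is the self-duality in matrix form.\<close>

definition koszul :: "nat \<Rightarrow> nat \<Rightarrow> nat \<Rightarrow> ('a \<times> 'a \<Rightarrow>\<^sub>0 'k) set" where
  "koszul i j l =
    (if i = 0 then diff j else if i = 1 then hessian j l else if i = 2 then diff l else \<zero>\<^sub>E)"

text \<open>The type \<open>res_elem\<close> prescribes triples as indices. The last component
  carries the position in the basis, the first two are fixed fillers.\<close>

definition index :: "nat \<Rightarrow> 'a \<times> ('a \<times> 'a \<Rightarrow>\<^sub>0 'k) set \<times> nat" where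
  "index j = (\<zero>, \<zero>\<^sub>E, j)"

lemma enveloping_simps [simp]:
  "carrier (enveloping A) = carrier E" "mult (enveloping A) = mult E" "one (enveloping A) = one E"
  "zero (enveloping A) = zero E" "add (enveloping A) = add E"
  by (simp_all add: enveloping_eq)

lemma koszul_closed: "koszul i j l \<in> carrier E"
  by (simp add: koszul_def diff_def hessian_def)

text \<open>The unit tensor has coefficient 1 at the empty monomial, and the functional
  \<open>\<phi>\<close> at that monomial separates 1 from 0 in A.\<close>

lemma E_nontrivial: "\<one>\<^bsub>E\<^esub> \<noteq> \<zero>\<^sub>E"
proof
  assume "\<one>\<^bsub>E\<^esub> = \<zero>\<^sub>E"
  then have "coef (0, 0, 0) (pbw 0 0 0 \<bowtie> \<one>) = \<zero>" by (simp add: pbw_def tens_one[symmetric])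
  then have "\<one> = \<zero>" by (simp add: coef_pbw)
  then have "\<phi> (0, 0, 0) (pbw 0 0 0) = \<phi> (0, 0, 0) (0 \<odot> \<one>)" by (simp add: pbw_def)
  then show False by (simp add: \<phi>_pbw' \<phi>_smult del: smult_zero_left)
qed

end

sublocale hq_env \<subseteq> K: matrix_complex "enveloping A" index rank koszul
proof (intro matrix_complex.intro matrix_complex_axioms.intro enveloping_ring)
  show "inj index" by (simp add: inj_def index_def)
qed (simp_all add: E_nontrivial koszul_closed)

context hq_env
begin

lemma Vec_E: "r \<in> K.Vec n \<Longrightarrow> r l \<in> carrier E"
  using K.Vec_closed by auto

lemma sum_1: "f (0::nat) \<in> carrier E \<Longrightarrow> finsum (enveloping A) f {..<Suc 0} = f 0"
  by (simp add: lessThan_Suc)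

lemma sum_3:
  assumes "f (0::nat) \<in> carrier E" "f 1 \<in> carrier E" "f 2 \<in> carrier E"
  shows "finsum (enveloping A) f {..<3} = f 0 \<boxplus> f 1 \<boxplus> f 2"
  using assms by (simp add: eval_nat_numeral lessThan_Suc E.a_ac)

lemma row_eq:
  assumes "r \<in> K.Vec n"
  shows "K.row 0 r l = r 0 \<cdot> dx \<boxplus> r 1 \<cdot> dt \<boxplus> r 2 \<cdot> dy"
    "K.row 1 r l = r 0 \<cdot> hessian 0 l \<boxplus> r 1 \<cdot> hessian 1 l \<boxplus> r 2 \<cdot> hessian 2 l"
    "K.row 2 r l = r 0 \<cdot> diff l"
    "K.row (Suc (Suc (Suc i))) r l = \<zero>\<^sub>E"
proof -
  have h: "hessian j l \<in> carrier E" "diff l \<in> carrier E" for j by (simp_all add: hessian_def diff_def)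
  note r = Vec_E[OF assms]
  show "K.row 0 r l = r 0 \<cdot> dx \<boxplus> r 1 \<cdot> dt \<boxplus> r 2 \<cdot> dy"
    unfolding K.row_def using r by (simp add: rank_def sum_3 koszul_def diff_def)
  show "K.row 1 r l = r 0 \<cdot> hessian 0 l \<boxplus> r 1 \<cdot> hessian 1 l \<boxplus> r 2 \<cdot> hessian 2 l"
    unfolding K.row_def using r h by (simp add: rank_def sum_3 koszul_def)
  show "K.row 2 r l = r 0 \<cdot> diff l"
    unfolding K.row_def using r h by (simp add: rank_def sum_1 koszul_def)
  show "K.row (Suc (Suc (Suc i))) r l = \<zero>\<^sub>E"
    unfolding K.row_def by (simp add: rank_def)
qed

lemma col_eq:
  assumes "h \<in> K.Vec n"
  shows "K.col 0 h j = diff j \<cdot> h 0"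
    "K.col 1 h j = hessian j 0 \<cdot> h 0 \<boxplus> hessian j 1 \<cdot> h 1 \<boxplus> hessian j 2 \<cdot> h 2"
    "K.col 2 h j = dx \<cdot> h 0 \<boxplus> dt \<cdot> h 1 \<boxplus> dy \<cdot> h 2"
proof -
  have c: "hessian j l \<in> carrier E" "diff j \<in> carrier E" for l by (simp_all add: hessian_def diff_def)
  note h = Vec_E[OF assms]
  show "K.col 0 h j = diff j \<cdot> h 0"
    unfolding K.col_def using h c by (simp add: rank_def sum_1 koszul_def)
  show "K.col 1 h j = hessian j 0 \<cdot> h 0 \<boxplus> hessian j 1 \<cdot> h 1 \<boxplus> hessian j 2 \<cdot> h 2"
    unfolding K.col_def using h c by (simp add: rank_def sum_3 koszul_def)
  show "K.col 2 h j = dx \<cdot> h 0 \<boxplus> dt \<cdot> h 1 \<boxplus> dy \<cdot> h 2"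
    unfolding K.col_def using h by (simp add: rank_def sum_3 koszul_def diff_def)
qed

definition triple :: "('a \<times> 'a \<Rightarrow>\<^sub>0 'k) set \<Rightarrow> ('a \<times> 'a \<Rightarrow>\<^sub>0 'k) set \<Rightarrow> ('a \<times> 'a \<Rightarrow>\<^sub>0 'k) set \<Rightarrow> nat
    \<Rightarrow> ('a \<times> 'a \<Rightarrow>\<^sub>0 'k) set" where
  "triple u v w = (\<lambda>l. if l = 0 then u else if l = 1 then v else if l = 2 then w else \<zero>\<^sub>E)"

lemma triple_app [simp]: "triple u v w 0 = u" "triple u v w 1 = v" "triple u v w (Suc 0) = v" "triple u v w 2 = w"
  by (simp_all add: triple_def)

lemma ex_Vec_3: "(\<exists>s\<in>K.Vec 3. Q (s 0) (s 1) (s 2)) \<longleftrightarrow>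
  (\<exists>u\<in>carrier E. \<exists>v\<in>carrier E. \<exists>w\<in>carrier E. Q u v w)"
proof
  assume "\<exists>u\<in>carrier E. \<exists>v\<in>carrier E. \<exists>w\<in>carrier E. Q u v w"
  then obtain u v w where uvw: "u \<in> carrier E" "v \<in> carrier E" "w \<in> carrier E" "Q u v w" by blast
  then have "triple u v w \<in> K.Vec 3" by (auto simp: K.Vec_def triple_def)
  then show "\<exists>s\<in>K.Vec 3. Q (s 0) (s 1) (s 2)" using uvw(4) by (intro bexI[of _ "triple u v w"]) auto
qed (use Vec_E in blast)

lemma ex_Vec_1: "(\<exists>s\<in>K.Vec 1. Q (s 0)) \<longleftrightarrow> (\<exists>a\<in>carrier E. Q a)"
proof
  assume "\<exists>a\<in>carrier E. Q a"
  then obtain a where a: "a \<in> carrier E" "Q a" by blast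
  then have "triple a \<zero>\<^sub>E \<zero>\<^sub>E \<in> K.Vec 1" by (auto simp: K.Vec_def triple_def)
  then show "\<exists>s\<in>K.Vec 1. Q (s 0)" using a(2) by (intro bexI[of _ "triple a \<zero>\<^sub>E \<zero>\<^sub>E"]) auto
qed (use Vec_E in blast)

lemma zero_Vec: "(\<lambda>l. \<zero>\<^sub>E) \<in> K.Vec n"
  by (simp add: K.Vec_def)

lemma all_less_3: "(\<forall>l<3. Q l) \<longleftrightarrow> Q 0 \<and> Q 1 \<and> Q (2 :: nat)"
  by (auto simp: less_Suc_eq eval_nat_numeral)

lemma hessian_simps:
  "hessian 0 0 = \<zero>\<^sub>E" "hessian 0 1 = Mxt" "hessian 0 2 = Mxy" "hessian 1 0 = Mtx" "hessian 1 1 = Mtt"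
  "hessian 1 2 = Mty" "hessian 2 0 = Myx" "hessian 2 1 = Myt" "hessian 2 2 = \<zero>\<^sub>E"
  by (simp_all add: hessian_def)

lemma diff_simps: "diff 0 = dx" "diff 1 = dt" "diff 2 = dy"
  by (simp_all add: diff_def)

lemma row_1_eq:
  assumes "r \<in> K.Vec n"
  shows "K.row 1 r 0 = r 1 \<cdot> Mtx \<boxplus> r 2 \<cdot> Myx"
    "K.row 1 r 1 = r 0 \<cdot> Mxt \<boxplus> r 1 \<cdot> Mtt \<boxplus> r 2 \<cdot> Myt"
    "K.row 1 r 2 = r 0 \<cdot> Mxy \<boxplus> r 1 \<cdot> Mty"
  unfolding row_eq(2)[OF assms] hessian_simps using Vec_E[OF assms] by simp_all

lemma col_1_eq:
  assumes "h \<in> K.Vec n"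
  shows "K.col 1 h 0 = Mxt \<cdot> h 1 \<boxplus> Mxy \<cdot> h 2"
    "K.col 1 h 1 = Mtx \<cdot> h 0 \<boxplus> Mtt \<cdot> h 1 \<boxplus> Mty \<cdot> h 2"
    "K.col 1 h 2 = Myx \<cdot> h 0 \<boxplus> Myt \<cdot> h 1"
  unfolding col_eq(2)[OF assms] hessian_simps using Vec_E[OF assms] by simp_all

lemma row_exact_1:
  assumes r: "r \<in> K.Vec 3"
  shows "(\<forall>l<1. K.row 0 r l = \<zero>\<^sub>E) \<longleftrightarrow> (\<exists>s\<in>K.Vec 3. \<forall>l<3. r l = K.row 1 s l)"
proof -
  have "(\<exists>s\<in>K.Vec 3. \<forall>l<3. r l = K.row 1 s l) \<longleftrightarrow>
    (\<exists>s\<in>K.Vec 3. r 0 = s 1 \<cdot> Mtx \<boxplus> s 2 \<cdot> Myx \<and>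
      r 1 = s 0 \<cdot> Mxt \<boxplus> s 1 \<cdot> Mtt \<boxplus> s 2 \<cdot> Myt \<and>
      r 2 = s 0 \<cdot> Mxy \<boxplus> s 1 \<cdot> Mty)"
    by (rule bex_cong[OF refl]) (simp only: all_less_3 row_1_eq)
  also have "\<dots> \<longleftrightarrow> (\<exists>sx\<in>carrier E. \<exists>st\<in>carrier E. \<exists>sy\<in>carrier E.
      r 0 = st \<cdot> Mtx \<boxplus> sy \<cdot> Myx \<and>
      r 1 = sx \<cdot> Mxt \<boxplus> st \<cdot> Mtt \<boxplus> sy \<cdot> Myt \<and>
      r 2 = sx \<cdot> Mxy \<boxplus> st \<cdot> Mty)"
    by (rule ex_Vec_3)
  also have "\<dots> \<longleftrightarrow> r 0 \<cdot> dx \<boxplus> r 1 \<cdot> dt \<boxplus> r 2 \<cdot> dy = \<zero>\<^sub>E"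
    using exact_1[OF Vec_E[OF r] Vec_E[OF r] Vec_E[OF r]] complex_1 by metis
  finally show ?thesis by (simp add: row_eq(1)[OF r])
qed

lemma row_exact_2:
  assumes r: "r \<in> K.Vec 3"
  shows "(\<forall>l<3. K.row 1 r l = \<zero>\<^sub>E) \<longleftrightarrow> (\<exists>s\<in>K.Vec 1. \<forall>l<3. r l = K.row 2 s l)"
proof -
  have "(\<exists>s\<in>K.Vec 1. \<forall>l<3. r l = K.row 2 s l) \<longleftrightarrow>
    (\<exists>s\<in>K.Vec 1. r 0 = s 0 \<cdot> dx \<and> r 1 = s 0 \<cdot> dt \<and> r 2 = s 0 \<cdot> dy)"
    by (rule bex_cong[OF refl]) (simp only: all_less_3 row_eq(3) diff_simps)
  also have "\<dots> \<longleftrightarrow> (\<exists>s\<in>carrier E. r 0 = s \<cdot> dx \<and> r 1 = s \<cdot> dt \<and> r 2 = s \<cdot> dy)"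
    by (rule ex_Vec_1)
  also have "\<dots> \<longleftrightarrow> r 1 \<cdot> Mtx \<boxplus> r 2 \<cdot> Myx = \<zero>\<^sub>E \<and>
      r 0 \<cdot> Mxt \<boxplus> r 1 \<cdot> Mtt \<boxplus> r 2 \<cdot> Myt = \<zero>\<^sub>E \<and>
      r 0 \<cdot> Mxy \<boxplus> r 1 \<cdot> Mty = \<zero>\<^sub>E"
    using exact_2[OF Vec_E[OF r] Vec_E[OF r] Vec_E[OF r]] complex_2 by metis
  also have "\<dots> \<longleftrightarrow> (\<forall>l<3. K.row 1 r l = \<zero>\<^sub>E)"
    unfolding all_less_3 row_1_eq[OF r] ..
  finally show ?thesis ..
qed

lemma row_exact_3:
  assumes r: "r \<in> K.Vec 1"
  shows "(\<forall>l<3. K.row 2 r l = \<zero>\<^sub>E) \<longleftrightarrow> r 0 = \<zero>\<^sub>E"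
  unfolding all_less_3 row_eq(3)[OF r] diff_simps using Vec_E[OF r] exact_3 by auto

lemma row_exact:
  assumes r: "r \<in> K.Vec (rank (Suc i))"
  shows "(\<forall>l<rank i. K.row i r l = \<zero>\<^sub>E) \<longleftrightarrow>
    (\<exists>s\<in>K.Vec (rank (Suc (Suc i))). \<forall>l<rank (Suc i). r l = K.row (Suc i) s l)"
proof -
  consider "i = 0" | "i = 1" | "i = 2" | j where "i = Suc (Suc (Suc j))"
    by (metis One_nat_def Suc_1 not0_implies_Suc)
  then show ?thesis
  proof cases
    case 1
    then show ?thesis using row_exact_1[of r] r by (simp add: rank_def)
  next
    case 2
    then show ?thesis using row_exact_2[of r] r by (simp add: rank_def eval_nat_numeral)
  next
    case 3
    then have r1: "r \<in> K.Vec 1" using r by (simp add: rank_def eval_nat_numeral)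
    \<comment> \<open>The next term of the complex is zero, so exactness here means injectivity of
      the last differential.\<close>
    show ?thesis
      using row_exact_3[OF r1] zero_Vec row_eq(4)[of _ _ 0] 3 by (auto simp: rank_def eval_nat_numeral)
  next
    case 4
    then show ?thesis using zero_Vec row_eq(4)[OF r] by (auto simp: rank_def)
  qed
qed

text \<open>Evaluating the bimodule action at 1 sends a pure tensor of a and b to ab, so this is the
  multiplication map of A.\<close>

definition augmentation :: "('a \<times> ('a \<times> 'a \<Rightarrow>\<^sub>0 'k) set \<times> nat \<Rightarrow> ('a \<times> 'a \<Rightarrow>\<^sub>0 'k) set) \<Rightarrow> 'a" where
  "augmentation f = lact (f (index 0)) \<one>"

lemma P0_carrier: "f \<in> carrier (K.P 0) \<Longrightarrow> f i \<in> carrier E"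
  unfolding K.P_def K.F_carrier enveloping_simps by blast

lemma augmentation_hom: "augmentation \<in> mod_hom (enveloping A) (K.P 0) (bimod_left A)"
  unfolding mod_hom_def augmentation_def using P0_carrier by (auto simp: lact_add lact_mult)

lemma augmentation_onto: "augmentation ` carrier (K.P 0) = carrier A"
proof (intro equalityI subsetI)
  fix a assume a: "a \<in> carrier A"
  let ?f = "K.vec (rank 0) (\<lambda>_. a \<bowtie> \<one>)"
  have "?f \<in> carrier (K.P 0)"
    unfolding K.P_def by (rule K.vec_closed) (use a in simp)
  moreover have "augmentation ?f = a"
    using a by (simp add: augmentation_def K.vec_app rank_def lact_tens)
  ultimately show "a \<in> augmentation ` carrier (K.P 0)" by force
qed (auto simp: augmentation_def P0_carrier)

lemma resolution: "proj_resolution (enveloping A) (bimod_left A) K.P K.D augmentation"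
proof (rule K.proj_resolution[OF bimod_left_module augmentation_hom])
  show "augmentation ` carrier (K.P 0) = carrier (bimod_left A)" by (simp add: augmentation_onto)
  fix r assume r: "r \<in> K.Vec (rank 0)"
  have "(\<exists>s\<in>K.Vec (rank (Suc 0)). \<forall>l<rank 0. r l = K.row 0 s l) \<longleftrightarrow>
      (\<exists>s\<in>K.Vec 3. r 0 = s 0 \<cdot> dx \<boxplus> s 1 \<cdot> dt \<boxplus> s 2 \<cdot> dy)"
    by (simp add: rank_def row_eq(1) cong: bex_cong)
  also have "\<dots> \<longleftrightarrow> (\<exists>sx\<in>carrier E. \<exists>st\<in>carrier E. \<exists>sy\<in>carrier E.
      r 0 = sx \<cdot> dx \<boxplus> st \<cdot> dt \<boxplus> sy \<cdot> dy)"
    by (rule ex_Vec_3)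
  also have "\<dots> \<longleftrightarrow> lact (r 0) \<one> = \<zero>"
    using exact_0[OF Vec_E[OF r]] complex_0 by metis
  finally show "augmentation (K.vec (rank 0) r) = \<zero>\<^bsub>bimod_left A\<^esub> \<longleftrightarrow>
      (\<exists>s\<in>K.Vec (rank (Suc 0)). \<forall>l<rank 0. r l = K.row 0 s l)"
    by (simp add: augmentation_def K.vec_app rank_def)
qed (use row_exact in simp)

lemma finite_resolution: "finite_fg_resolvable (enveloping A) (bimod_left A)"
  unfolding finite_fg_resolvable_def
proof (intro exI conjI allI impI)
  show "proj_resolution (enveloping A) (bimod_left A) K.P K.D augmentation" by (rule resolution)
  show "fin_gen (enveloping A) (K.P i)" for i by (rule K.P_fin_gen)
  show "carrier (K.P i) = {\<zero>\<^bsub>K.P i\<^esub>}" if "3 < i" for i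
    by (rule K.P_trivial) (use that in \<open>simp add: rank_def\<close>)
qed

section \<open>Cohomology of the dual complex\<close>

lemma col_exact_0:
  assumes h: "h \<in> K.Vec 1"
  shows "(\<forall>j<3. K.col 0 h j = \<zero>\<^sub>E) \<longleftrightarrow> h 0 = \<zero>\<^sub>E"
  unfolding all_less_3 col_eq(1)[OF h] diff_simps using Vec_E[OF h] dual_exact_0 by auto

lemma col_exact_1:
  assumes h: "h \<in> K.Vec 3"
  shows "(\<forall>j<3. K.col 1 h j = \<zero>\<^sub>E) \<longleftrightarrow> (\<exists>s\<in>K.Vec 1. \<forall>l<3. h l = K.col 0 s l)"
proof -
  have "(\<exists>s\<in>K.Vec 1. \<forall>l<3. h l = K.col 0 s l) \<longleftrightarrow>
    (\<exists>s\<in>K.Vec 1. h 0 = dx \<cdot> s 0 \<and> h 1 = dt \<cdot> s 0 \<and> h 2 = dy \<cdot> s 0)"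
    by (rule bex_cong[OF refl]) (simp only: all_less_3 col_eq(1) diff_simps)
  also have "\<dots> \<longleftrightarrow> (\<exists>s\<in>carrier E. h 0 = dx \<cdot> s \<and> h 1 = dt \<cdot> s \<and> h 2 = dy \<cdot> s)"
    by (rule ex_Vec_1)
  also have "\<dots> \<longleftrightarrow> Mxt \<cdot> h 1 \<boxplus> Mxy \<cdot> h 2 = \<zero>\<^sub>E \<and>
      Mtx \<cdot> h 0 \<boxplus> Mtt \<cdot> h 1 \<boxplus> Mty \<cdot> h 2 = \<zero>\<^sub>E \<and>
      Myx \<cdot> h 0 \<boxplus> Myt \<cdot> h 1 = \<zero>\<^sub>E"
    using dual_exact_1[OF Vec_E[OF h] Vec_E[OF h] Vec_E[OF h]] dual_complex_1 by metis
  also have "\<dots> \<longleftrightarrow> (\<forall>j<3. K.col 1 h j = \<zero>\<^sub>E)"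
    unfolding all_less_3 col_1_eq[OF h] ..
  finally show ?thesis ..
qed

lemma col_exact_2:
  assumes h: "h \<in> K.Vec 3"
  shows "(\<forall>j<1. K.col 2 h j = \<zero>\<^sub>E) \<longleftrightarrow> (\<exists>s\<in>K.Vec 3. \<forall>l<3. h l = K.col 1 s l)"
proof -
  have "(\<exists>s\<in>K.Vec 3. \<forall>l<3. h l = K.col 1 s l) \<longleftrightarrow>
    (\<exists>s\<in>K.Vec 3. h 0 = Mxt \<cdot> s 1 \<boxplus> Mxy \<cdot> s 2 \<and>
      h 1 = Mtx \<cdot> s 0 \<boxplus> Mtt \<cdot> s 1 \<boxplus> Mty \<cdot> s 2 \<and>
      h 2 = Myx \<cdot> s 0 \<boxplus> Myt \<cdot> s 1)"
    by (rule bex_cong[OF refl]) (simp only: all_less_3 col_1_eq)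
  also have "\<dots> \<longleftrightarrow> (\<exists>sx\<in>carrier E. \<exists>st\<in>carrier E. \<exists>sy\<in>carrier E.
      h 0 = Mxt \<cdot> st \<boxplus> Mxy \<cdot> sy \<and>
      h 1 = Mtx \<cdot> sx \<boxplus> Mtt \<cdot> st \<boxplus> Mty \<cdot> sy \<and>
      h 2 = Myx \<cdot> sx \<boxplus> Myt \<cdot> st)"
    by (rule ex_Vec_3)
  also have "\<dots> \<longleftrightarrow> dx \<cdot> h 0 \<boxplus> dt \<cdot> h 1 \<boxplus> dy \<cdot> h 2 = \<zero>\<^sub>E"
    using dual_exact_2[OF Vec_E[OF h] Vec_E[OF h] Vec_E[OF h]] dual_complex_2 by metis
  finally show ?thesis by (simp add: col_eq(3)[OF h])
qed

lemma zero_module: "abelian_group zero_module"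
  by (rule abelian_groupI) (auto simp: zero_module_def)

text \<open>With the zero module as target the comparison map is constant, and the kernel condition
  says that all cocycles are coboundaries.\<close>

lemma ext_zero:
  assumes "i \<noteq> 3"
  shows "mod_isomorphic (opp (enveloping A)) (dual_cohomology (enveloping A) K.P K.D i) zero_module"
proof (rule K.dual_cohomology_isomorphic[OF zero_module, of i "\<lambda>_. ()"])
  have z: "(\<lambda>l. \<zero>\<^sub>E) \<in> K.cocycles i"
  proof -
    have "K.col i (\<lambda>l. \<zero>\<^sub>E) j = \<zero>\<^sub>E" for j
    proof -
      have "(\<Oplus>\<^bsub>enveloping A\<^esub>l\<in>{..<rank i}. koszul i j l \<cdot> \<zero>\<^sub>E) = (\<Oplus>\<^bsub>enveloping A\<^esub>l\<in>{..<rank i}. \<zero>\<^sub>E)"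
        using K.A_closed by (intro K.finsum_cong') auto
      then show ?thesis using K.finsum_zero by (simp add: K.col_def)
    qed
    then show ?thesis by (simp add: K.cocycles_def zero_Vec)
  qed
  then show "\<exists>h\<in>K.cocycles i. () = y" for y by auto
  fix h assume h: "h \<in> K.Vec (rank i)"
  consider "i = 0" | "i = 1" | "i = 2" | j where "i = Suc (Suc (Suc (Suc j)))"
    using assms by (metis One_nat_def Suc_1 not0_implies_Suc numeral_3_eq_3)
  then have "h \<in> K.cocycles i \<longleftrightarrow>
      (case i of 0 \<Rightarrow> \<forall>l<rank 0. h l = \<zero>\<^bsub>enveloping A\<^esub>
       | Suc m \<Rightarrow> \<exists>h'\<in>K.Vec (rank m). \<forall>l<rank i. h l = K.col m h' l)"
  proof cases
    case 1
    then show ?thesis using h col_exact_0[of h] by (simp add: K.cocycles_def rank_def)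
  next
    case 2
    then show ?thesis using h col_exact_1[of h] by (simp add: K.cocycles_def rank_def eval_nat_numeral)
  next
    case 3
    then show ?thesis using h col_exact_2[of h] by (simp add: K.cocycles_def rank_def eval_nat_numeral)
  next
    case 4
    then show ?thesis using h zero_Vec by (auto simp: K.cocycles_def rank_def)
  qed
  then show "(h \<in> K.cocycles i \<and> () = \<zero>\<^bsub>zero_module\<^esub>) \<longleftrightarrow>
      (case i of 0 \<Rightarrow> \<forall>l<rank 0. h l = \<zero>\<^bsub>enveloping A\<^esub>
       | Suc m \<Rightarrow> \<exists>h'\<in>K.Vec (rank m). \<forall>l<rank i. h l = K.col m h' l)"
    by simp
qed (simp_all add: zero_module_def)

text \<open>The term of degree 4 vanishes, so every column of degree 3 is a cocycle. Acting on 1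
  from the right sends such a column to A, with exactly the coboundaries as kernel.\<close>

lemma ext_3:
  "mod_isomorphic (opp (enveloping A)) (dual_cohomology (enveloping A) K.P K.D 3) (bimod_right A)"
proof (rule K.dual_cohomology_isomorphic[of _ 3 "\<lambda>h. ract (h 0) \<one>"])
  show "abelian_group (bimod_right A)"
    by (rule abelian_group_cong[OF abelian_group_axioms]) simp_all
  have cE: "h l \<in> carrier E" if "h \<in> K.cocycles 3" for h l
    using that Vec_E unfolding K.cocycles_def by blast
  have coc: "h \<in> K.cocycles 3 \<longleftrightarrow> h \<in> K.Vec 1" for h
    by (simp add: K.cocycles_def rank_def)
  show "ract (h 0) \<one> \<in> carrier (bimod_right A)" if "h \<in> K.cocycles 3" for h
    using cE[OF that] by (simp add: ract_flip)
  show "ract (g 0 \<oplus>\<^bsub>enveloping A\<^esub> h 0) \<one> = ract (g 0) \<one> \<oplus>\<^bsub>bimod_right A\<^esub> ract (h 0) \<one>"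
    if "g \<in> K.cocycles 3" "h \<in> K.cocycles 3" for g h
    using cE[OF that(1)] cE[OF that(2)] by (simp add: ract_flip flip_add lact_add)
  \<comment> \<open>The flip reverses the product, so right multiplication by r becomes the action
    of r after that of the column.\<close>
  show "ract (h 0 \<otimes>\<^bsub>enveloping A\<^esub> r) \<one> = ract r (ract (h 0) \<one>)"
    if "r \<in> carrier (enveloping A)" "h \<in> K.cocycles 3" for r h
    using cE[OF that(2)] that(1) by (simp add: ract_flip flip_mult lact_mult)
  show "\<exists>h\<in>K.cocycles 3. ract (h 0) \<one> = a" if "a \<in> carrier (bimod_right A)" for a
  proof -
    have "\<exists>h\<in>K.Vec 1. ract (h 0) \<one> = a"
      unfolding ex_Vec_1[of "\<lambda>z. ract z \<one> = a"]
      \<comment> \<open>The right action multiplies by the second tensor factor on the left, hence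
        this preimage of a.\<close>
      by (rule bexI[of _ "\<one> \<bowtie> a"]) (use that in \<open>auto simp: ract_flip flip_tens lact_tens\<close>)
    then show ?thesis using coc by blast
  qed
  fix h assume "h \<in> K.Vec (rank 3)"
  then have h: "h \<in> K.Vec 1" by (simp add: rank_def)
  have "(\<exists>s\<in>K.Vec 3. h 0 = dx \<cdot> s 0 \<boxplus> dt \<cdot> s 1 \<boxplus> dy \<cdot> s 2) \<longleftrightarrow>
    ract (h 0) \<one> = \<zero>"
    unfolding ract_one_eq_zero_iff[OF Vec_E[OF h]] by (rule ex_Vec_3)
  then have "(\<exists>s\<in>K.Vec 3. h 0 = K.col 2 s 0) \<longleftrightarrow> ract (h 0) \<one> = \<zero>"
    by (simp add: col_eq(3) cong: bex_cong)
  then show "(h \<in> K.cocycles 3 \<and> ract (h 0) \<one> = \<zero>\<^bsub>bimod_right A\<^esub>) \<longleftrightarrow>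
      (case 3 of 0 \<Rightarrow> \<forall>l<rank 0. h l = \<zero>\<^bsub>enveloping A\<^esub>
       | Suc m \<Rightarrow> \<exists>h'\<in>K.Vec (rank m). \<forall>l<rank 3. h l = K.col m h' l)"
    using h coc[of h] by (simp add: rank_def eval_nat_numeral)
qed

theorem calabi_yau_3: "calabi_yau 3 A"
  unfolding calabi_yau_def is_Ext_def
  using k_algebra_axioms finite_resolution resolution ext_zero ext_3 by blast

end

theorem theorem5p8:
  fixes c d e k p q :: "'k::alg_closed_field" and f' g' :: "'k poly"
  assumes "CHAR('k) \<noteq> 2" and "CHAR('k) \<noteq> 3"
    and "p \<noteq> 0" and "q = inverse p"
    and "f' = [:k, p:]" and "g' = [:e, d, c:]"
  shows "calabi_yau 3 (H_alg q f' g')"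
proof -
  have "p * q = 1" using assms by simp
  then have "hq_env (H_alg q [:k, p:] [:e, d, c:]) (hcoset p q k c d e (free_gen X_gen))
      (hcoset p q k c d e (free_gen T_gen)) (hcoset p q k c d e (free_gen Y_gen)) p q k c d e
      (coord p q k c d e)"
    by (intro hq_env.intro hq_env_axioms.intro H_hq_algebra)
  then show ?thesis unfolding assms(5,6) by (rule hq_env.calabi_yau_3)
qed

end
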